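(* Let $\mathbf{u}_0\in H$ and $\mathbf{S}_0\in L^2(\Omega)^9$. The weak problem (WF) with initial data $(\mathbf{u}_0,\mathbf{S}_0)$ has at most one solution belonging to $$\mathscr{F}:=\Big\{(\mathbf{u},\mathbf{S})\in\left[\mathscr{C}^0(\mathbb{R}_+,H)\cap L^1_{\mathrm{loc}}(\mathbb{R}_+,V)\right]\times\mathscr{C}^0\left((0,+\infty),L^2(\Omega)^9\right)\ :\ \|\nabla\mathbf{u}\|_{L^2(\Omega)^9}\in\mathscr{L},\ \|\mathbf{S}\|_{L^2(\Omega)^9}\in\mathscr{L}\Big\}.$$
   Context: $\Omega\subset\mathbb{R}^3$ is a bounded domain with sufficiently smooth boundary; $0<\alpha<\beta<1$ are fixed. $\mathbb{R}_+=[0,+\infty)$; $L^1_{\mathrm{loc}}(\mathbb{R}_+,X)$ means integrable on every $[0,T]$. Fields are real-valued; $L^2(\Omega)^9$ is the space of $3\times 3$-matrix-valued $L^2$ fields, $A:B=\sum_{i,j}A_{ij}B_{ij}$, $[\nabla\mathbf{u}]_{ij}=\partial_j u_i$. $\mathscr{L}=\{f\in L^1_{\mathrm{loc}}(\mathbb{R}_+):\exists M>0,\ fe^{-Mt}\in L^1(\mathbb{R}_+)\}$; the norms in the definition of $\mathscr{F}$ are viewed as functions of $t$. $V=\{\mathbf{h}\in H^1_0(\Omega)^3:\nabla\cdot\mathbf{h}=0\}$ with inner product $\langle \mathbf{f}|\mathbf{g}\rangle_V=\sum_{i,j}\int_\Omega\partial_j f_i\,\partial_j g_i\,d\mathbf{x}$;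 $H$ is the closure of $V$ in $L^2(\Omega)^3$, with the $L^2$ inner product. Weak problem (WF): a solution with data $(\mathbf{u}_0,\mathbf{S}_0)$ is a pair $(\mathbf{u},\mathbf{S})$ with $\mathbf{u}\in\mathscr{C}^0([0,+\infty),L^2(\Omega)^3)\cap L^1_{\mathrm{loc}}(\mathbb{R}_+,H^1_0(\Omega)^3)$, $\nabla\cdot\mathbf{u}=0$, $\mathbf{S}\in\mathscr{C}^0((0,+\infty),L^2(\Omega)^9)\cap L^1_{\mathrm{loc}}(\mathbb{R}_+,L^2(\Omega)^9)$, such that for all $\boldsymbol{\theta}\in V$, all $\mathbf{a}\in C_c^\infty(\Omega)^3$, all $\psi\in C^\infty([0,+\infty))$ vanishing in a neighborhood of $+\infty$, and all $i\in\{1,2,3\}$: $$\psi(0)\int_\Omega\mathbf{u}_0\cdot\boldsymbol{\theta}\,d\mathbf{x}+\int_0^{+\infty}\!\!\int_\Omega\mathbf{u}(t,\mathbf{x})\cdot\boldsymbol{\theta}(\mathbf{x})\psi'(t)\,d\mathbf{x}\,dt=\int_0^{+\infty}\!\!\int_\Omega(\mathbf{S}(t,\mathbf{x}):\nabla\boldsymbol{\theta}(\mathbf{x}))\psi(t)\,d\mathbf{x}\,dt,$$ $$-\int_0^{+\infty}\!\!\int_\Omega\frac{\psi(\tau)}{\Gamma(1-\alpha)\tau^\alpha}\sum_j[\mathbf{S}_0]_{ij}a_j\,d\mathbf{x}\,d\tau-\int_0^{+\infty}\!\!\int_\tau^{+\infty}\!\!\int_\Omega\frac{\psi'(t)}{\Gamma(1-\alpha)\tau^\alpha}\sum_j[\mathbf{S}]_{ij}(t-\tau,\mathbf{x})a_j(\mathbf{x})\,d\mathbf{x}\,dt\,d\tau+\int_0^{+\infty}\!\!\int_\Omega\sum_j[\mathbf{S}]_{ij}(t,\mathbf{x})a_j(\mathbf{x})\psi(t)\,d\mathbf{x}\,dt$$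 $$=-\frac{1}{\Gamma(1-\beta)}\int_0^{+\infty}\!\!\int_0^t\!\int_\Omega\frac{\psi(t)}{(t-\tau)^\beta}\Big\{(\nabla\cdot\mathbf{a})u_i+\sum_j u_j\,\partial_i a_j\Big\}(\tau,\mathbf{x})\,d\mathbf{x}\,d\tau\,dt.$$ *)

theory Defs
  imports "HOL-Analysis.Analysis"
begin

text \<open>
  Elements of function spaces over \<open>\<Omega>\<close> are represented by functions on the whole of \<open>\<real>\<^sup>3\<close>, of which
  only the values in \<open>\<Omega>\<close> matter; equality in such a space is equality almost everywhere in \<open>\<Omega>\<close>.
  All norms below are therefore seminorms on representatives.
\<close>

type_synonym pt = "real ^ 3"
type_synonym vfield = "pt \<Rightarrow> real ^ 3"
type_synonym mfield = "pt \<Rightarrow> real ^ 3 ^ 3"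


section \<open>Domains, test functions\<close>

text \<open>Near each boundary point, \<open>\<Omega>\<close> is a sublevel set of a \<open>C\<^sup>1\<close> function without critical point.\<close>

definition C1_boundary :: "pt set \<Rightarrow> bool" where
  "C1_boundary \<Omega> \<longleftrightarrow>
     (\<forall>p\<in>frontier \<Omega>. \<exists>U (\<phi> :: pt \<Rightarrow> real) (g :: pt \<Rightarrow> pt).
        open U \<and> p \<in> U \<and> continuous_on U g \<and>
        (\<forall>x\<in>U. (\<phi> has_derivative (\<lambda>h. g x \<bullet> h)) (at x) \<and> g x \<noteq> 0) \<and>
        \<Omega> \<inter> U = {x\<in>U. \<phi> x < 0})"

definition C1_bounded_domain :: "pt set \<Rightarrow> bool" where
  "C1_bounded_domain \<Omega> \<longleftrightarrow>
     open \<Omega> \<and> connected \<Omega> \<and> \<Omega> \<noteq> {} \<and> bounded \<Omega> \<and> C1_boundary \<Omega>"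

definition pd :: "3 \<Rightarrow> (pt \<Rightarrow> real) \<Rightarrow> pt \<Rightarrow> real" where
  "pd j f x = frechet_derivative f (at x) (axis j 1)"

fun Ck :: "nat \<Rightarrow> (pt \<Rightarrow> real) \<Rightarrow> bool" where
  "Ck 0 f \<longleftrightarrow> continuous_on UNIV f"
| "Ck (Suc k) f \<longleftrightarrow> (\<forall>x. f differentiable (at x)) \<and> (\<forall>j. Ck k (pd j f))"

definition Cc_inf :: "pt set \<Rightarrow> (pt \<Rightarrow> real) set" where
  "Cc_inf \<Omega> = {\<phi>. (\<forall>k. Ck k \<phi>) \<and> (\<exists>K. compact K \<and> K \<subseteq> \<Omega> \<and> (\<forall>x. x \<notin> K \<longrightarrow> \<phi> x = 0))}"

definition Cc_inf_vec :: "pt set \<Rightarrow> vfield set" where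
  "Cc_inf_vec \<Omega> = {a. \<forall>i. (\<lambda>x. a x $ i) \<in> Cc_inf \<Omega>}"

text \<open>Derivative on the closed half-line, one-sided at \<open>0\<close>.\<close>

definition hderiv :: "(real \<Rightarrow> real) \<Rightarrow> real \<Rightarrow> real" where
  "hderiv \<psi> t = vector_derivative \<psi> (at t within {0..})"

definition time_test :: "(real \<Rightarrow> real) set" where
  "time_test = {\<psi>. (\<forall>n. \<forall>t\<ge>0. (hderiv ^^ n) \<psi> differentiable (at t within {0..})) \<and>
                   (\<exists>R. \<forall>t\<ge>R. \<psi> t = 0)}"


section \<open>Spaces of functions on the domain\<close>

definition L2 :: "pt set \<Rightarrow> (pt \<Rightarrow> 'b::euclidean_space) set" where
  "L2 \<Omega> = {f \<in> borel_measurable (lebesgue_on \<Omega>). set_integrable lebesgue \<Omega> (\<lambda>x. (norm (f x))\<^sup>2)}"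

definition L2_inner :: "pt set \<Rightarrow> (pt \<Rightarrow> 'b::euclidean_space) \<Rightarrow> (pt \<Rightarrow> 'b) \<Rightarrow> real" where
  "L2_inner \<Omega> f g = (LINT x:\<Omega>|lebesgue. f x \<bullet> g x)"

definition L2_norm :: "pt set \<Rightarrow> (pt \<Rightarrow> 'b::euclidean_space) \<Rightarrow> real" where
  "L2_norm \<Omega> f = sqrt (L2_inner \<Omega> f f)"

definition has_weak_pd :: "pt set \<Rightarrow> 3 \<Rightarrow> (pt \<Rightarrow> real) \<Rightarrow> (pt \<Rightarrow> real) \<Rightarrow> bool" where
  "has_weak_pd \<Omega> j f g \<longleftrightarrow>
     (\<forall>\<phi>\<in>Cc_inf \<Omega>. (LINT x:\<Omega>|lebesgue. f x * pd j \<phi> x) = - (LINT x:\<Omega>|lebesgue. g x * \<phi> x))"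

definition H1 :: "pt set \<Rightarrow> (pt \<Rightarrow> real) set" where
  "H1 \<Omega> = {f \<in> L2 \<Omega>. \<forall>j. \<exists>g\<in>L2 \<Omega>. has_weak_pd \<Omega> j f g}"

text \<open>A representative of the weak partial derivative; meaningful for \<open>f \<in> H1 \<Omega>\<close> only.\<close>

definition wpd :: "pt set \<Rightarrow> 3 \<Rightarrow> (pt \<Rightarrow> real) \<Rightarrow> pt \<Rightarrow> real" where
  "wpd \<Omega> j f = (SOME g. g \<in> L2 \<Omega> \<and> has_weak_pd \<Omega> j f g)"

definition H1_norm :: "pt set \<Rightarrow> (pt \<Rightarrow> real) \<Rightarrow> real" where
  "H1_norm \<Omega> f = sqrt ((L2_norm \<Omega> f)\<^sup>2 + (\<Sum>j\<in>UNIV. (L2_norm \<Omega> (wpd \<Omega> j f))\<^sup>2))"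

definition H10 :: "pt set \<Rightarrow> (pt \<Rightarrow> real) set" where
  "H10 \<Omega> = {f \<in> H1 \<Omega>. \<forall>\<epsilon>>0. \<exists>\<phi>\<in>Cc_inf \<Omega>. H1_norm \<Omega> (\<lambda>x. f x - \<phi> x) < \<epsilon>}"

definition H10_vec :: "pt set \<Rightarrow> vfield set" where
  "H10_vec \<Omega> = {u. \<forall>i. (\<lambda>x. u x $ i) \<in> H10 \<Omega>}"

definition H1_vec_norm :: "pt set \<Rightarrow> vfield \<Rightarrow> real" where
  "H1_vec_norm \<Omega> u = sqrt (\<Sum>i\<in>UNIV. (H1_norm \<Omega> (\<lambda>x. u x $ i))\<^sup>2)"

definition wgrad :: "pt set \<Rightarrow> vfield \<Rightarrow> mfield" where
  "wgrad \<Omega> u x = (\<chi> i j. wpd \<Omega> j (\<lambda>y. u y $ i) x)"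

definition div_free :: "pt set \<Rightarrow> vfield \<Rightarrow> bool" where
  "div_free \<Omega> u \<longleftrightarrow> (AE x in lebesgue_on \<Omega>. (\<Sum>i\<in>UNIV. wgrad \<Omega> u x $ i $ i) = 0)"

definition V :: "pt set \<Rightarrow> vfield set" where
  "V \<Omega> = {h \<in> H10_vec \<Omega>. div_free \<Omega> h}"

definition V_inner :: "pt set \<Rightarrow> vfield \<Rightarrow> vfield \<Rightarrow> real" where
  "V_inner \<Omega> f g =
     (\<Sum>i\<in>UNIV. \<Sum>j\<in>UNIV. LINT x:\<Omega>|lebesgue. wgrad \<Omega> f x $ i $ j * wgrad \<Omega> g x $ i $ j)"

definition V_norm :: "pt set \<Rightarrow> vfield \<Rightarrow> real" where
  "V_norm \<Omega> f = sqrt (V_inner \<Omega> f f)"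

definition H :: "pt set \<Rightarrow> vfield set" where
  "H \<Omega> = {u \<in> L2 \<Omega>. \<forall>\<epsilon>>0. \<exists>v\<in>V \<Omega>. L2_norm \<Omega> (\<lambda>x. u x - v x) < \<epsilon>}"


section \<open>Functions of time with values in a function space\<close>

text \<open>Here \<open>N\<close> is the (semi)norm of the space \<open>X\<close>.\<close>

definition C0_into ::
  "real set \<Rightarrow> ('a \<Rightarrow> 'b::real_vector) set \<Rightarrow> (('a \<Rightarrow> 'b) \<Rightarrow> real) \<Rightarrow> (real \<Rightarrow> 'a \<Rightarrow> 'b) set" where
  "C0_into I X N =
     {u. \<forall>t\<in>I. u t \<in> X \<and> ((\<lambda>s. N (\<lambda>x. u s x - u t x)) \<longlongrightarrow> 0) (at t within I)}"

text \<open>Bochner integrability on each \<open>[0,T]\<close>: strong measurability (almost everywhere limit of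
  \<open>X\<close>-valued simple functions) and integrability of the norm.\<close>

definition L1loc_into ::
  "('a \<Rightarrow> 'b::real_vector) set \<Rightarrow> (('a \<Rightarrow> 'b) \<Rightarrow> real) \<Rightarrow> (real \<Rightarrow> 'a \<Rightarrow> 'b) set" where
  "L1loc_into X N =
     {u. \<forall>T>0.
        (\<exists>s :: nat \<Rightarrow> real \<Rightarrow> 'a \<Rightarrow> 'b.
           (\<forall>n. simple_function (lebesgue_on {0..T}) (s n) \<and> (\<forall>t\<in>{0..T}. s n t \<in> X)) \<and>
           (AE t in lebesgue_on {0..T}.
              u t \<in> X \<and> (\<lambda>n. N (\<lambda>x. s n t x - u t x)) \<longlonglongrightarrow> 0)) \<and>
        set_integrable lebesgue {0..T} (\<lambda>t. N (u t))}"

definition Lap :: "(real \<Rightarrow> real) set" where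
  "Lap = {f. (\<forall>T>0. set_integrable lebesgue {0..T} f) \<and>
             (\<exists>M>0. set_integrable lebesgue {0..} (\<lambda>t. f t * exp (- M * t)))}"

definition F_space :: "pt set \<Rightarrow> ((real \<Rightarrow> vfield) \<times> (real \<Rightarrow> mfield)) set" where
  "F_space \<Omega> =
     {(u, S). u \<in> C0_into {0..} (H \<Omega>) (L2_norm \<Omega>) \<and>
              u \<in> L1loc_into (V \<Omega>) (V_norm \<Omega>) \<and>
              S \<in> C0_into {0<..} (L2 \<Omega>) (L2_norm \<Omega>) \<and>
              (\<lambda>t. L2_norm \<Omega> (wgrad \<Omega> (u t))) \<in> Lap \<and>
              (\<lambda>t. L2_norm \<Omega> (S t)) \<in> Lap}"


section \<open>The weak problem\<close>

definition weak_momentum ::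
  "pt set \<Rightarrow> vfield \<Rightarrow> (real \<Rightarrow> vfield) \<Rightarrow> (real \<Rightarrow> mfield) \<Rightarrow> vfield \<Rightarrow> (real \<Rightarrow> real) \<Rightarrow> bool" where
  "weak_momentum \<Omega> u0 u S \<theta> \<psi> \<longleftrightarrow>
     \<psi> 0 * (LINT x:\<Omega>|lebesgue. u0 x \<bullet> \<theta> x)
       + (LINT t:{0..}|lebesgue. LINT x:\<Omega>|lebesgue. (u t x \<bullet> \<theta> x) * hderiv \<psi> t)
     = (LINT t:{0..}|lebesgue. LINT x:\<Omega>|lebesgue. (S t x \<bullet> wgrad \<Omega> \<theta> x) * \<psi> t)"

definition weak_constitutive ::
  "real \<Rightarrow> real \<Rightarrow> pt set \<Rightarrow> mfield \<Rightarrow> (real \<Rightarrow> vfield) \<Rightarrow> (real \<Rightarrow> mfield) \<Rightarrow>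
   vfield \<Rightarrow> (real \<Rightarrow> real) \<Rightarrow> 3 \<Rightarrow> bool" where
  "weak_constitutive \<alpha> \<beta> \<Omega> S0 u S a \<psi> i \<longleftrightarrow>
     - (LINT \<tau>:{0..}|lebesgue. LINT x:\<Omega>|lebesgue.
          \<psi> \<tau> / (Gamma (1 - \<alpha>) * \<tau> powr \<alpha>) * (\<Sum>j\<in>UNIV. S0 x $ i $ j * a x $ j))
     - (LINT \<tau>:{0..}|lebesgue. LINT t:{\<tau>..}|lebesgue. LINT x:\<Omega>|lebesgue.
          hderiv \<psi> t / (Gamma (1 - \<alpha>) * \<tau> powr \<alpha>) * (\<Sum>j\<in>UNIV. S (t - \<tau>) x $ i $ j * a x $ j))
     + (LINT t:{0..}|lebesgue. LINT x:\<Omega>|lebesgue.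
          (\<Sum>j\<in>UNIV. S t x $ i $ j * a x $ j) * \<psi> t)
     = - (1 / Gamma (1 - \<beta>)) *
       (LINT t:{0..}|lebesgue. LINT \<tau>:{0..t}|lebesgue. LINT x:\<Omega>|lebesgue.
          \<psi> t / (t - \<tau>) powr \<beta> *
          ((\<Sum>k\<in>UNIV. pd k (\<lambda>y. a y $ k) x) * u \<tau> x $ i
           + (\<Sum>j\<in>UNIV. u \<tau> x $ j * pd i (\<lambda>y. a y $ j) x)))"

definition WF_solution ::
  "real \<Rightarrow> real \<Rightarrow> pt set \<Rightarrow> vfield \<Rightarrow> mfield \<Rightarrow> (real \<Rightarrow> vfield) \<times> (real \<Rightarrow> mfield) \<Rightarrow> bool" where
  "WF_solution \<alpha> \<beta> \<Omega> u0 S0 = (\<lambda>(u, S).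
     u \<in> C0_into {0..} (L2 \<Omega>) (L2_norm \<Omega>) \<and>
     u \<in> L1loc_into (H10_vec \<Omega>) (H1_vec_norm \<Omega>) \<and>
     (AE t in lebesgue_on {0..}. div_free \<Omega> (u t)) \<and>
     S \<in> C0_into {0<..} (L2 \<Omega>) (L2_norm \<Omega>) \<and>
     S \<in> L1loc_into (L2 \<Omega>) (L2_norm \<Omega>) \<and>
     (\<forall>\<theta>\<in>V \<Omega>. \<forall>\<psi>\<in>time_test. weak_momentum \<Omega> u0 u S \<theta> \<psi>) \<and>
     (\<forall>a\<in>Cc_inf_vec \<Omega>. \<forall>\<psi>\<in>time_test. \<forall>i. weak_constitutive \<alpha> \<beta> \<Omega> S0 u S a \<psi> i))"

text \<open>Equality of two pairs as elements of \<open>C\<^sup>0([0,\<infinity>),L\<^sup>2) \<times> C\<^sup>0((0,\<infinity>),L\<^sup>2)\<close>.\<close>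

definition same_pair ::
  "pt set \<Rightarrow> (real \<Rightarrow> vfield) \<times> (real \<Rightarrow> mfield) \<Rightarrow> (real \<Rightarrow> vfield) \<times> (real \<Rightarrow> mfield) \<Rightarrow> bool" where
  "same_pair \<Omega> = (\<lambda>(u, S) (v, R).
     (\<forall>t\<ge>0. AE x in lebesgue_on \<Omega>. u t x = v t x) \<and>
     (\<forall>t>0. AE x in lebesgue_on \<Omega>. S t x = R t x))"

end

theory Submission
  imports Defs
begin

text \<open>
  The difference of two solutions solves the problem with zero data, and the idea is to test its
  Laplace transform with itself. For real \<open>p\<close> beyond the growth rate of both solutions the equations
  become
    \<open>p \<langle>U, \<theta>\<rangle> = - \<langle>\<Sigma>, \<nabla>\<theta>\<rangle>\<close> and \<open>(1 + p k) \<Sigma> = k' (\<nabla>U + \<nabla>U\<^sup>T)\<close>,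
  where \<open>U\<close>, \<open>\<Sigma>\<close> are the transforms of the differences of velocities and stresses, and \<open>k\<close>, \<open>k'\<close>
  are transforms of positive power kernels, hence positive numbers. Eliminating \<open>\<Sigma>\<close> and taking
  \<open>\<theta> = U\<close> gives
    \<open>p (1 + p k) \<parallel>U\<parallel>\<^sup>2 + (k'/2) \<parallel>\<nabla>U + \<nabla>U\<^sup>T\<parallel>\<^sup>2 = 0\<close>,
  so \<open>U = 0\<close> for all large real \<open>p\<close>; by the uniqueness theorem for Laplace transforms (\<open>Lerch\<close>) the
  velocities agree, and then the second equation forces the stresses to agree. The terms of the
  identity have a sign because \<open>p\<close> is real.

  Three points need work. First, \<open>exp (- p t)\<close> is not an admissible test function in time; it is the
  limit of smooth cutoffs, and the memory terms are convolutions whose limits factorise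
  (\<open>convolution_limit\<close>). This yields \<open>momentum_laplace\<close> and \<open>constitutive_laplace\<close>. The latter is
  tested with smooth compactly supported fields only; approximating \<open>\<theta>\<close> in \<open>H\<^sup>1\<^sub>0\<close> by smooth fields
  and using the gradients of these as tests extends it to \<open>\<nabla>\<theta>\<close> for every \<open>\<theta>\<close> in \<open>V\<close>
  (\<open>constitutive_laplace_V\<close>).

  Secondly, \<open>U\<close> is a Bochner integral with values in \<open>V\<close>, a space of representatives with a seminorm.
  In its place, strong measurability provides, for each \<open>\<epsilon> > 0\<close>, a finite combination
  \<open>h\<close> of elements of \<open>V\<close> such that the transform of \<open>l (u t)\<close> differs from \<open>l h\<close> by at most
  \<open>\<epsilon>\<close> times the norm of \<open>l\<close>, for all bounded linear functionals \<open>l\<close> on \<open>V\<close> simultaneously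
  (\<open>approximate_laplace_transform\<close>). Testing with \<open>h\<close> instead of \<open>U\<close> gives \<open>\<parallel>h\<parallel>\<^sup>2 = O(\<epsilon>)\<close>, which is as
  good. The Poincare inequality makes the \<open>L\<^sup>2\<close> inner product with a fixed field such a functional.

  Thirdly, weak gradients are chosen representatives, so their linearity holds almost everywhere by
  the fundamental lemma of the calculus of variations, which is proved from explicit bump functions.
\<close>

section \<open>Square-integrable fields\<close>

text \<open>
  The discriminant argument on its own: the inner product of representatives of \<open>L\<^sup>2\<close> fields is a
  positive semidefinite form, for which Cauchy-Schwarz follows by expanding \<open>\<langle>f + r g, f + r g\<rangle> \<ge> 0\<close>.
\<close>

lemma psd_form_Cauchy_Schwarz:
  fixes a b c :: real
  assumes "\<And>r. 0 \<le> a + 2 * r * b + r\<^sup>2 * c" and c0: "0 \<le> c"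
  shows "\<bar>b\<bar> \<le> sqrt a * sqrt c"
proof -
  have a0: "0 \<le> a" using assms(1)[of 0] by simp
  have "b\<^sup>2 \<le> a * c"
  proof (cases "c = 0")
    case True
    (* A nonnegative affine function of r is constant. *)
    have "b = 0"
    proof (rule ccontr)
      assume "b \<noteq> 0"
      then show False using assms(1)[of "- (a + 1) / (2 * b)"] True by (simp add: field_simps)
    qed
    then show ?thesis using True by simp
  next
    case False
    have "0 \<le> a + 2 * (- b / c) * b + (- b / c)\<^sup>2 * c" by (rule assms)
    then show ?thesis using False c0 by (simp add: field_simps power2_eq_square)
  qed
  then have "sqrt (b\<^sup>2) \<le> sqrt (a * c)" by (rule real_sqrt_le_mono)
  then show ?thesis by (simp add: real_sqrt_mult)
qed

locale measurable_set =
  fixes \<Omega> :: "pt set"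
  assumes \<Omega>: "\<Omega> \<in> sets lebesgue"
begin

abbreviation "ip \<equiv> L2_inner \<Omega>"
abbreviation "norm2 \<equiv> L2_norm \<Omega>"
abbreviation "dist2 f g \<equiv> L2_norm \<Omega> (\<lambda>x. f x - g x)"

lemma set_integrable_iff_on: 
  fixes f :: "pt \<Rightarrow> 'b::{banach, second_countable_topology}"
  shows "set_integrable lebesgue \<Omega> f \<longleftrightarrow> integrable (lebesgue_on \<Omega>) f"
  unfolding set_integrable_def using \<Omega> by (subst integrable_restrict_space) auto

lemma set_integral_eq_on:
  fixes f :: "pt \<Rightarrow> 'b::{banach, second_countable_topology}"
  shows "(LINT x:\<Omega>|lebesgue. f x) = (LINT x|lebesgue_on \<Omega>. f x)"
  unfolding set_lebesgue_integral_def using \<Omega> by (subst integral_restrict_space) auto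

lemma L2_iff:
  fixes f :: "pt \<Rightarrow> 'b::euclidean_space"
  shows "f \<in> L2 \<Omega> \<longleftrightarrow> f \<in> borel_measurable (lebesgue_on \<Omega>) \<and> integrable (lebesgue_on \<Omega>) (\<lambda>x. f x \<bullet> f x)"
  by (auto simp: L2_def set_integrable_iff_on power2_norm_eq_inner)

lemma L2_inner_eq:
  fixes f :: "pt \<Rightarrow> 'b::euclidean_space"
  shows "ip f g = (LINT x|lebesgue_on \<Omega>. f x \<bullet> g x)"
  by (simp add: L2_inner_def set_integral_eq_on)

lemma L2_inner_integrable:
  fixes f :: "pt \<Rightarrow> 'b::euclidean_space"
  assumes "f \<in> L2 \<Omega>" "g \<in> L2 \<Omega>"
  shows "integrable (lebesgue_on \<Omega>) (\<lambda>x. f x \<bullet> g x)"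
proof (rule Bochner_Integration.integrable_bound)
  show "integrable (lebesgue_on \<Omega>) (\<lambda>x. f x \<bullet> f x + g x \<bullet> g x)"
    using assms by (simp add: L2_iff)
  show "(\<lambda>x. f x \<bullet> g x) \<in> borel_measurable (lebesgue_on \<Omega>)"
    using assms by (auto simp: L2_iff)
  have "\<bar>a \<bullet> b\<bar> \<le> a \<bullet> a + b \<bullet> b" for a b :: 'b
  proof -
    have "\<bar>a \<bullet> b\<bar> \<le> norm a * norm b" by (rule Cauchy_Schwarz_ineq2)
    also have "norm a * norm b \<le> (norm a)\<^sup>2 + (norm b)\<^sup>2"
      using sum_squares_bound[of "norm a" "norm b"]
        mult_nonneg_nonneg[OF norm_ge_zero[of a] norm_ge_zero[of b]] by linarith
    finally show ?thesis by (simp add: power2_norm_eq_inner)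
  qed
  then show "AE x in lebesgue_on \<Omega>. norm (f x \<bullet> g x) \<le> norm (f x \<bullet> f x + g x \<bullet> g x)"
    by (auto intro!: AE_I2 order_trans[OF _ abs_ge_self])
qed

lemma L2_add:
  fixes f :: "pt \<Rightarrow> 'b::euclidean_space"
  assumes "f \<in> L2 \<Omega>" "g \<in> L2 \<Omega>"
  shows "(\<lambda>x. f x + g x) \<in> L2 \<Omega>"
  using assms L2_inner_integrable[OF assms] L2_inner_integrable[OF assms(2,1)]
  by (auto simp: L2_iff inner_add_left inner_add_right)

lemma L2_scaleR:
  fixes f :: "pt \<Rightarrow> 'b::euclidean_space"
  assumes "f \<in> L2 \<Omega>"
  shows "(\<lambda>x. c *\<^sub>R f x) \<in> L2 \<Omega>"
  using assms by (auto simp: L2_iff)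

lemma L2_diff:
  fixes f :: "pt \<Rightarrow> 'b::euclidean_space"
  assumes "f \<in> L2 \<Omega>" "g \<in> L2 \<Omega>"
  shows "(\<lambda>x. f x - g x) \<in> L2 \<Omega>"
  using L2_add[OF assms(1) L2_scaleR[OF assms(2), of "-1"]] by simp

lemma L2_zero: "(\<lambda>x. 0 :: 'b::euclidean_space) \<in> L2 \<Omega>"
  by (simp add: L2_iff)

lemma L2_inner_commute: "ip f g = ip g f"
  by (simp add: L2_inner_def inner_commute)

lemma L2_inner_add_left:
  assumes "f \<in> L2 \<Omega>" "g \<in> L2 \<Omega>" "h \<in> L2 \<Omega>"
  shows "ip (\<lambda>x. f x + g x) h = ip f h + ip g h"
  using assms by (simp add: L2_inner_eq inner_add_left L2_inner_integrable)

lemma L2_inner_diff_left: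
  assumes "f \<in> L2 \<Omega>" "g \<in> L2 \<Omega>" "h \<in> L2 \<Omega>"
  shows "ip (\<lambda>x. f x - g x) h = ip f h - ip g h"
  using assms by (simp add: L2_inner_eq inner_diff_left L2_inner_integrable)

lemma L2_inner_diff_right:
  assumes "f \<in> L2 \<Omega>" "g \<in> L2 \<Omega>" "h \<in> L2 \<Omega>"
  shows "ip h (\<lambda>x. f x - g x) = ip h f - ip h g"
  using assms by (simp add: L2_inner_eq inner_diff_right L2_inner_integrable)

lemma L2_inner_scaleR_left: "ip (\<lambda>x. c *\<^sub>R f x) h = c * ip f h"
  by (simp add: L2_inner_eq)

lemma L2_inner_add_right:
  assumes "f \<in> L2 \<Omega>" "g \<in> L2 \<Omega>" "h \<in> L2 \<Omega>"
  shows "ip h (\<lambda>x. f x + g x) = ip h f + ip h g"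
  using assms by (simp add: L2_inner_eq inner_add_right L2_inner_integrable)

lemma L2_inner_scaleR_right: "ip h (\<lambda>x. c *\<^sub>R f x) = c * ip h f"
  by (simp add: L2_inner_eq)

lemma L2_inner_cong:
  assumes "AE x in lebesgue_on \<Omega>. f x = f' x" "AE x in lebesgue_on \<Omega>. g x = g' x"
    and "f \<in> L2 \<Omega>" "f' \<in> L2 \<Omega>" "g \<in> L2 \<Omega>" "g' \<in> L2 \<Omega>"
  shows "ip f g = ip f' g'"
  unfolding L2_inner_eq
  by (rule integral_cong_AE) (use assms in \<open>auto simp: L2_iff\<close>)

lemma L2_inner_self_nonneg: "0 \<le> ip f f"
  by (simp add: L2_inner_eq)

lemma L2_norm_nonneg [simp]: "0 \<le> norm2 f"
  by (simp add: L2_norm_def L2_inner_self_nonneg)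

lemma L2_norm_squared: "(norm2 f)\<^sup>2 = ip f f"
  by (simp add: L2_norm_def L2_inner_self_nonneg)

lemma L2_Cauchy_Schwarz:
  assumes "f \<in> L2 \<Omega>" "g \<in> L2 \<Omega>"
  shows "\<bar>ip f g\<bar> \<le> norm2 f * norm2 g"
  unfolding L2_norm_def
proof (rule psd_form_Cauchy_Schwarz)
  fix r :: real
  have "0 \<le> ip (\<lambda>x. f x + r *\<^sub>R g x) (\<lambda>x. f x + r *\<^sub>R g x)"
    by (rule L2_inner_self_nonneg)
  also have "\<dots> = ip f f + 2 * r * ip f g + r\<^sup>2 * ip g g"
    using assms by (simp add: L2_inner_add_left L2_add L2_scaleR L2_inner_add_right L2_inner_scaleR_left
        L2_inner_scaleR_right L2_inner_commute[of g f] algebra_simps power2_eq_square)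
  finally show "0 \<le> ip f f + 2 * r * ip f g + r\<^sup>2 * ip g g" .
qed (rule L2_inner_self_nonneg)

lemma L2_norm_triangle:
  assumes "f \<in> L2 \<Omega>" "g \<in> L2 \<Omega>"
  shows "norm2 (\<lambda>x. f x + g x) \<le> norm2 f + norm2 g"
proof (rule power2_le_imp_le)
  have "(norm2 (\<lambda>x. f x + g x))\<^sup>2 = ip f f + 2 * ip f g + ip g g"
    using assms by (simp add: L2_norm_squared L2_inner_add_left L2_inner_add_right L2_add
        L2_inner_commute[of g f])
  also have "\<dots> \<le> (norm2 f + norm2 g)\<^sup>2"
    using L2_Cauchy_Schwarz[OF assms] by (simp add: power2_sum L2_norm_squared algebra_simps)
  finally show "(norm2 (\<lambda>x. f x + g x))\<^sup>2 \<le> (norm2 f + norm2 g)\<^sup>2" .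
qed simp

lemma L2_norm_scaleR: "norm2 (\<lambda>x. c *\<^sub>R f x) = \<bar>c\<bar> * norm2 f"
proof -
  have "ip (\<lambda>x. c *\<^sub>R f x) (\<lambda>x. c *\<^sub>R f x) = c\<^sup>2 * ip f f"
    by (simp add: L2_inner_eq power2_eq_square mult.assoc)
  then show ?thesis by (simp add: L2_norm_def real_sqrt_mult)
qed

lemma L2_norm_minus_commute: "dist2 f g = dist2 g f"
  using L2_norm_scaleR[of "-1" "\<lambda>x. g x - f x"] by simp

lemma L2_norm_triangle_diff:
  assumes "f \<in> L2 \<Omega>" "g \<in> L2 \<Omega>"
  shows "norm2 f \<le> norm2 g + dist2 f g"
  using L2_norm_triangle[OF assms(2) L2_diff[OF assms]] by simp

lemma L2_norm_cong:
  assumes "AE x in lebesgue_on \<Omega>. f x = g x" "f \<in> L2 \<Omega>" "g \<in> L2 \<Omega>"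
  shows "norm2 f = norm2 g"
  unfolding L2_norm_def using assms L2_inner_cong by metis

lemma L2_norm_zero_imp_AE:
  fixes f :: "pt \<Rightarrow> 'b::euclidean_space"
  assumes "f \<in> L2 \<Omega>" "norm2 f = 0"
  shows "AE x in lebesgue_on \<Omega>. f x = 0"
proof -
  have "(LINT x|lebesgue_on \<Omega>. f x \<bullet> f x) = 0"
    using assms by (simp add: L2_norm_def L2_inner_eq)
  then have "AE x in lebesgue_on \<Omega>. f x \<bullet> f x = 0"
    using assms by (subst (asm) integral_nonneg_eq_0_iff_AE) (auto simp: L2_iff)
  then show ?thesis by auto
qed

lemma L2_vec_iff:
  fixes f :: "pt \<Rightarrow> 'b::euclidean_space ^ 'n"
  shows "f \<in> L2 \<Omega> \<longleftrightarrow> (\<forall>i. (\<lambda>x. f x $ i) \<in> L2 \<Omega>)"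
proof
  assume f: "f \<in> L2 \<Omega>"
  show "\<forall>i. (\<lambda>x. f x $ i) \<in> L2 \<Omega>"
  proof
    fix i
    have [measurable]: "f \<in> borel_measurable (lebesgue_on \<Omega>)" using f by (simp add: L2_iff)
    have m: "(\<lambda>x. f x $ i) \<in> borel_measurable (lebesgue_on \<Omega>)"
      by (rule borel_measurable_continuous_on[where f="\<lambda>v. v $ i"]) (auto intro!: continuous_intros)
    moreover have "integrable (lebesgue_on \<Omega>) (\<lambda>x. f x $ i \<bullet> f x $ i)"
    proof (rule Bochner_Integration.integrable_bound)
      show "integrable (lebesgue_on \<Omega>) (\<lambda>x. f x \<bullet> f x)" using f by (simp add: L2_iff)
      have "f x $ i \<bullet> f x $ i \<le> f x \<bullet> f x" for x
        unfolding inner_vec_def[of "f x" "f x"] by (rule member_le_sum) auto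
      then show "AE x in lebesgue_on \<Omega>. norm (f x $ i \<bullet> f x $ i) \<le> norm (f x \<bullet> f x)" by auto
    qed (use m in auto)
    ultimately show "(\<lambda>x. f x $ i) \<in> L2 \<Omega>" by (simp add: L2_iff)
  qed
next
  assume f: "\<forall>i. (\<lambda>x. f x $ i) \<in> L2 \<Omega>"
  have "f \<in> borel_measurable (lebesgue_on \<Omega>)"
    unfolding borel_measurable_euclidean_space[where f=f]
  proof
    fix b :: "'b ^ 'n" assume "b \<in> Basis"
    then obtain i c where b: "b = axis i c" by (auto simp: Basis_vec_def)
    have "(\<lambda>x. f x $ i) \<in> borel_measurable (lebesgue_on \<Omega>)" using f by (simp add: L2_iff)
    then have "(\<lambda>x. f x $ i \<bullet> c) \<in> borel_measurable (lebesgue_on \<Omega>)" by simp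
    then show "(\<lambda>x. f x \<bullet> b) \<in> borel_measurable (lebesgue_on \<Omega>)" by (simp add: b inner_axis)
  qed
  then show "f \<in> L2 \<Omega>" using f by (simp add: L2_iff inner_vec_def)
qed

lemma L2_inner_vec:
  fixes f g :: "pt \<Rightarrow> 'b::euclidean_space ^ 'n"
  assumes "f \<in> L2 \<Omega>" "g \<in> L2 \<Omega>"
  shows "ip f g = (\<Sum>i\<in>UNIV. ip (\<lambda>x. f x $ i) (\<lambda>x. g x $ i))"
  using assms by (simp add: L2_inner_eq inner_vec_def L2_vec_iff L2_inner_integrable)

lemma L2_norm_component_le:
  fixes f :: "pt \<Rightarrow> 'b::euclidean_space ^ 'n"
  assumes "f \<in> L2 \<Omega>"
  shows "norm2 (\<lambda>x. f x $ i) \<le> norm2 f"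
  unfolding L2_norm_def L2_inner_vec[OF assms assms]
  by (rule real_sqrt_le_mono, rule member_le_sum) (auto simp: L2_inner_self_nonneg)

end

section \<open>Smooth functions\<close>

text \<open>
  The derivative is a witness rather than a computed function, so closure under products and affine
  substitutions is a plain induction on \<open>k\<close> with the usual differentiation rules.
\<close>

primrec C_real :: "nat \<Rightarrow> (real \<Rightarrow> real) \<Rightarrow> bool" where
  "C_real 0 f \<longleftrightarrow> continuous_on UNIV f"
| "C_real (Suc k) f \<longleftrightarrow> (\<exists>f'. (\<forall>x. (f has_real_derivative f' x) (at x)) \<and> C_real k f')"

lemma C_real_continuous: "C_real k f \<Longrightarrow> continuous_on UNIV f"
  by (cases k) (auto intro: DERIV_continuous_on)

lemma C_real_mono: "C_real (Suc k) f \<Longrightarrow> C_real k f"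
proof (induction k arbitrary: f)
  case 0
  then show ?case using C_real_continuous[OF 0] by simp
next
  case (Suc k)
  then show ?case by (metis C_real.simps(2))
qed

lemma C_real_SucI:
  "(\<And>x. (f has_real_derivative f' x) (at x)) \<Longrightarrow> C_real k f' \<Longrightarrow> C_real (Suc k) f"
  by auto

lemma C_real_const: "C_real k (\<lambda>x. c)"
proof (induction k arbitrary: c)
  case (Suc k)
  show ?case unfolding C_real.simps
    by (rule exI[of _ "\<lambda>x. 0"]) (auto intro!: Suc)
qed simp

lemma C_real_add: "C_real k f \<Longrightarrow> C_real k g \<Longrightarrow> C_real k (\<lambda>x. f x + g x)"
proof (induction k arbitrary: f g)
  case 0
  then show ?case by (auto intro!: continuous_intros)
next
  case (Suc k)
  from Suc.prems obtain f' g' where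
    "\<forall>x. (f has_real_derivative f' x) (at x)" "C_real k f'"
    "\<forall>x. (g has_real_derivative g' x) (at x)" "C_real k g'" by auto
  then show ?case unfolding C_real.simps
    by (intro exI[of _ "\<lambda>x. f' x + g' x"]) (auto intro!: Suc.IH DERIV_add)
qed

lemma C_real_mult: "C_real k f \<Longrightarrow> C_real k g \<Longrightarrow> C_real k (\<lambda>x. f x * g x)"
proof (induction k arbitrary: f g)
  case 0
  then show ?case by (auto intro!: continuous_intros)
next
  case (Suc k)
  from Suc.prems obtain f' g' where *:
    "\<forall>x. (f has_real_derivative f' x) (at x)" "C_real k f'"
    "\<forall>x. (g has_real_derivative g' x) (at x)" "C_real k g'" by auto
  have "C_real k f" "C_real k g" using Suc.prems by (auto intro!: C_real_mono simp del: C_real.simps)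
  with * show ?case unfolding C_real.simps
    by (intro exI[of _ "\<lambda>x. f' x * g x + g' x * f x"]) (auto intro!: Suc.IH C_real_add DERIV_mult)
qed

lemma C_real_affine: "C_real k f \<Longrightarrow> C_real k (\<lambda>x. f (a * x + b))"
proof (induction k arbitrary: f)
  case 0
  then show ?case by (auto intro!: continuous_on_compose2[of UNIV f] continuous_intros)
next
  case (Suc k)
  from Suc.prems obtain f' where f': "\<forall>x. (f has_real_derivative f' x) (at x)" "C_real k f'" by auto
  have "((\<lambda>x. f (a * x + b)) has_real_derivative f' (a * x + b) * a) (at x)" for x
    by (rule DERIV_chain2[OF f'(1)[rule_format]]) (auto intro!: derivative_eq_intros)
  moreover have "C_real k (\<lambda>x. f' (a * x + b) * a)"
    by (rule C_real_mult[OF Suc.IH[OF f'(2)] C_real_const])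
  ultimately show ?case by (rule C_real_SucI)
qed

lemma C_real_exp: "C_real k exp"
proof (induction k)
  case (Suc k)
  then show ?case unfolding C_real.simps using DERIV_exp by blast
qed (auto intro!: continuous_intros)

text \<open>
  The derivative of a member of this family is a linear combination of two others, so smoothness of
  all of them is one induction. The member \<open>flat 0\<close> is the standard smooth function that vanishes on
  the negative half-line; all bumps and cutoffs below are built from it.
\<close>

definition flat :: "nat \<Rightarrow> real \<Rightarrow> real" where
  "flat k x = (if 0 < x then exp (- 1 / x) / x ^ k else 0)"

text \<open>
  As \<open>y = 1/x\<close> tends to infinity, \<open>exp y\<close> outgrows \<open>y ^ k\<close>.
\<close>

lemma flat_tendsto_0: "(flat k \<longlongrightarrow> 0) (at 0)"
proof (rule filterlim_split_at)
  have "eventually (\<lambda>x::real. flat k x = 0) (at_left 0)"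
    by (auto simp: eventually_at_filter flat_def)
  then show "(flat k \<longlongrightarrow> 0) (at_left 0)" by (rule tendsto_eventually)
  have "((\<lambda>x::real. inverse x ^ k / exp (inverse x)) \<longlongrightarrow> 0) (at_right 0)"
    by (rule filterlim_compose[OF tendsto_power_div_exp_0 filterlim_inverse_at_top_right])
  moreover have "eventually (\<lambda>x::real. inverse x ^ k / exp (inverse x) = flat k x) (at_right 0)"
    by (auto simp: eventually_at_filter flat_def exp_minus field_simps)
  ultimately show "(flat k \<longlongrightarrow> 0) (at_right 0)" by (rule Lim_transform_eventually)
qed

lemma DERIV_flat: "(flat k has_real_derivative flat (k + 2) x - real k * flat (k + 1) x) (at x)"
proof -
  consider "x < 0" | "x = 0" | "0 < x" by linarith
  then show ?thesis
  proof cases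
    case 1
    have "((\<lambda>x. 0) has_real_derivative flat (k + 2) x - real k * flat (k + 1) x) (at x)"
      using 1 by (simp add: flat_def)
    then show ?thesis
      by (rule has_field_derivative_transform_within_open[of _ _ _ "{..<0}"]) (use 1 in \<open>auto simp: flat_def\<close>)
  next
    case 2
    (* The difference quotient of flat k at 0 is flat (k + 1). *)
    have "((\<lambda>h. (flat k (0 + h) - flat k 0) / h) \<longlongrightarrow> 0) (at 0)"
      using flat_tendsto_0[of "Suc k"]
      by (rule filterlim_cong[THEN iffD1, rotated 3]) (auto simp: flat_def fun_eq_iff intro!: always_eventually)
    then show ?thesis using 2 by (simp add: DERIV_def flat_def)
  next
    case 3
    have "((\<lambda>x. exp (- 1 / x) / x ^ k) has_real_derivative flat (k + 2) x - real k * flat (k + 1) x) (at x)"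
    proof -
      have 1: "((\<lambda>x. exp (- 1 / x)) has_real_derivative exp (- 1 / x) / x\<^sup>2) (at x)"
        using 3 by (auto intro!: derivative_eq_intros simp: power2_eq_square)
      have "(exp (- 1 / x) / x\<^sup>2 * x ^ k - exp (- 1 / x) * (real k * x ^ (k - Suc 0))) / (x ^ k * x ^ k)
          = flat (k + 2) x - real k * flat (k + 1) x"
        using 3 by (cases k) (auto simp: flat_def field_simps power2_eq_square)
      then show ?thesis
        using DERIV_divide[OF 1 DERIV_pow[of k x UNIV]] 3 by simp
    qed
    then show ?thesis
      by (rule has_field_derivative_transform_within_open[of _ _ _ "{0<..}"]) (use 3 in \<open>auto simp: flat_def\<close>)
  qed
qed

lemma C_real_flat: "C_real n (flat k)"
proof (induction n arbitrary: k)
  case 0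
  then show ?case by (simp, rule DERIV_continuous_on, rule DERIV_flat)
next
  case (Suc n)
  have "C_real n (\<lambda>x. flat (k + 2) x + - real k * flat (k + 1) x)"
    by (intro C_real_add C_real_mult C_real_const Suc)
  then show ?case using DERIV_flat[of k] by (intro C_real_SucI) auto
qed

lemma flat0_bounds: "0 \<le> flat 0 x" "flat 0 x \<le> 1" "0 < x \<Longrightarrow> 0 < flat 0 x"
  by (auto simp: flat_def)

text \<open>
  The derivative within the half-line depends only on the values there, and it is unique because
  no point of the half-line is isolated.
\<close>

lemma hderiv_eq:
  assumes "(f has_real_derivative d) (at t)" "\<And>s. 0 \<le> s \<Longrightarrow> g s = f s" "0 \<le> t"
  shows "hderiv g t = d"
proof -
  have "(f has_vector_derivative d) (at t within {0..})"
    using assms(1) by (simp add: has_real_derivative_iff_has_vector_derivative has_vector_derivative_at_within)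
  then have "(g has_vector_derivative d) (at t within {0..})"
    by (rule has_vector_derivative_transform[rotated 2]) (use assms in auto)
  moreover have "at t within {0..} \<noteq> bot"
  proof -
    have "{0..} \<noteq> {a}" for a :: real 
    proof
      assume a: "{0..} = {a}"
      have "(0::real) \<in> {0..}" "(1::real) \<in> {0..}" by auto
      then show False unfolding a by simp
    qed
    then have "t islimpt {0..}" using assms(3) by (intro connected_imp_perfect) auto
    then show ?thesis by (simp add: trivial_limit_within)
  qed
  ultimately show ?thesis unfolding hderiv_def by (intro vector_derivative_within)
qed

text \<open>
  On the half-line the iterates of \<open>hderiv\<close> are the ordinary higher derivatives. The induction is
  over functions that agree with a smooth one on the half-line only, as the values of \<open>hderiv\<close> at
  negative times are arbitrary.
\<close>

lemma time_testI:
  assumes "\<And>n. C_real n \<psi>" "\<And>t. R \<le> t \<Longrightarrow> \<psi> t = 0"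
  shows "\<psi> \<in> time_test"
proof -
  have "(hderiv ^^ n) g differentiable (at t within {0..})"
    if "\<And>n. C_real n f" "\<And>s. 0 \<le> s \<Longrightarrow> g s = f s" "0 \<le> t" for n f g t
    using that
  proof (induction n arbitrary: f g)
    case 0
    from 0(1)[of 1] obtain f' where "(f has_real_derivative f' t) (at t)" by auto
    then have "f differentiable (at t within {0..})"
      by (auto intro: has_derivative_at_withinI simp: differentiable_def has_field_derivative_def)
    then show ?case
      by (simp, rule differentiable_transform_within[where d=1]) (use 0 in auto)
  next
    case (Suc n)
    from Suc.prems(1)[of 1] obtain f' where f': "\<And>x. (f has_real_derivative f' x) (at x)" by auto
    have "C_real m f'" for m
    proof -
      from Suc.prems(1)[of "Suc m"] obtain f'' where f'': "\<And>x. (f has_real_derivative f'' x) (at x)" "C_real m f''"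
        by auto
      then have "f'' x = f' x" for x using f'[of x] f''(1)[of x] by (rule_tac DERIV_unique)
      then have "f'' = f'" by auto
      then show ?thesis using f'' by simp
    qed
    moreover have "hderiv g s = f' s" if "0 \<le> s" for s
      by (rule hderiv_eq[OF f']) (use Suc.prems that in auto)
    ultimately have "(hderiv ^^ n) (hderiv g) differentiable (at t within {0..})"
      using Suc.prems by (intro Suc.IH) auto
    then show ?case by (simp add: funpow_swap1)
  qed
  then show ?thesis using assms unfolding time_test_def by blast
qed

lemma pd_eq: "(f has_derivative D) (at x) \<Longrightarrow> pd j f x = D (axis j 1)"
  unfolding pd_def by (simp add: frechet_derivative_at[symmetric])

lemma has_pd_derivative: "f differentiable (at x) \<Longrightarrow> (f has_derivative frechet_derivative f (at x)) (at x)"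
  by (simp add: frechet_derivative_works)

lemma pd_add:
  assumes "\<And>x. f differentiable (at x)" "\<And>x. g differentiable (at x)"
  shows "pd j (\<lambda>x. f x + g x) = (\<lambda>x. pd j f x + pd j g x)"
  by (rule ext, subst pd_eq[OF has_derivative_add[OF has_pd_derivative has_pd_derivative]])
     (auto simp: assms pd_def)

lemma pd_mult:
  assumes "\<And>x. f differentiable (at x)" "\<And>x. g differentiable (at x)"
  shows "pd j (\<lambda>x. f x * g x) = (\<lambda>x. f x * pd j g x + pd j f x * g x)"
  by (rule ext, subst pd_eq[OF has_derivative_mult[OF has_pd_derivative has_pd_derivative]])
     (auto simp: assms pd_def)

lemma pd_const: "pd j (\<lambda>x. c) = (\<lambda>x. 0)"
  by (rule ext, subst pd_eq[OF has_derivative_const]) auto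

lemma Ck_continuous: "Ck k f \<Longrightarrow> continuous_on UNIV f"
proof (cases k)
  case (Suc n)
  assume "Ck k f"
  then have "f differentiable (at x)" for x using Suc by simp
  then show ?thesis by (intro continuous_at_imp_continuous_on ballI differentiable_imp_continuous_within)
qed simp

lemma Ck_mono: "Ck (Suc k) f \<Longrightarrow> Ck k f"
proof (induction k arbitrary: f)
  case 0
  from Ck_continuous[OF 0] show ?case by (simp only: Ck.simps)
next
  case (Suc k)
  then show ?case by simp
qed

lemma Ck_const: "Ck k (\<lambda>x. c)"
  by (induction k arbitrary: c) (auto simp: pd_const)

lemma Ck_add: "Ck k f \<Longrightarrow> Ck k g \<Longrightarrow> Ck k (\<lambda>x. f x + g x)"
  by (induction k arbitrary: f g) (auto intro!: continuous_intros simp: pd_add)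

lemma Ck_mult: "Ck k f \<Longrightarrow> Ck k g \<Longrightarrow> Ck k (\<lambda>x. f x * g x)"
proof (induction k arbitrary: f g)
  case 0
  then show ?case by (auto intro!: continuous_intros)
next
  case (Suc k)
  have "Ck k f" "Ck k g" using Suc.prems by (auto intro!: Ck_mono simp del: Ck.simps)
  then show ?case using Suc by (auto simp: pd_mult intro!: Ck_add)
qed

text \<open>
  Smooth functions on space are obtained from smooth functions of one coordinate by products.
\<close>

lemma has_derivative_coord:
  fixes f :: "real \<Rightarrow> real"
  assumes "(f has_real_derivative f') (at (x $ i))"
  shows "((\<lambda>x :: pt. f (x $ i)) has_derivative (\<lambda>h. f' * h $ i)) (at x)"
proof -
  have "((\<lambda>x :: pt. x $ i) has_derivative (\<lambda>h. h $ i)) (at x)"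
    by (rule bounded_linear_imp_has_derivative) (rule bounded_linear_vec_nth)
  then show ?thesis
    using has_derivative_compose[of "\<lambda>x :: pt. x $ i" "\<lambda>h. h $ i" x UNIV f "(*) f'"] assms
    by (simp add: has_field_derivative_def)
qed

lemma Ck_coord: "C_real k f \<Longrightarrow> Ck k (\<lambda>x. f (x $ i))"
proof (induction k arbitrary: f)
  case 0
  then show ?case by (auto intro!: continuous_on_compose2[of UNIV f] continuous_intros)
next
  case (Suc k)
  from Suc.prems obtain f' where f': "\<And>x. (f has_real_derivative f' x) (at x)" "C_real k f'" by auto
  have d: "((\<lambda>x :: pt. f (x $ i)) has_derivative (\<lambda>h. f' (x $ i) * h $ i)) (at x)" for x :: pt
    by (rule has_derivative_coord[OF f'(1)])
  have "pd j (\<lambda>x. f (x $ i)) = (\<lambda>x. f' (x $ i) * (axis j 1 :: pt) $ i)" for j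
    by (rule ext, subst pd_eq[OF d]) auto
  moreover have "(\<lambda>x :: pt. f (x $ i)) differentiable (at x)" for x
    using d by (auto simp: differentiable_def)
  ultimately show ?case using Suc.IH[OF f'(2)] by (auto intro!: Ck_mult Ck_const)
qed

lemma Ck_prod:
  assumes "\<And>i. i \<in> I \<Longrightarrow> Ck k (f i)"
  shows "Ck k (\<lambda>x. \<Prod>i\<in>I. f i x)"
  using assms by (induction I rule: infinite_finite_induct) (auto intro!: Ck_mult Ck_const)

lemma Cc_infD:
  assumes "f \<in> Cc_inf \<Omega>"
  shows "Ck k f" "f differentiable (at x)" "continuous_on UNIV f"
proof -
  show "Ck k f" for k using assms by (auto simp: Cc_inf_def)
  from this[of "Suc 0"] show "f differentiable (at x)" by simp
  from \<open>Ck 0 f\<close> show "continuous_on UNIV f" by simp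
qed

lemma Cc_inf_mult: "f \<in> Cc_inf \<Omega> \<Longrightarrow> (\<And>k. Ck k g) \<Longrightarrow> (\<lambda>x. f x * g x) \<in> Cc_inf \<Omega>"
  unfolding Cc_inf_def by (auto intro!: Ck_mult)

lemma Cc_inf_add: assumes "f \<in> Cc_inf \<Omega>" "g \<in> Cc_inf \<Omega>" shows "(\<lambda>x. f x + g x) \<in> Cc_inf \<Omega>"
proof -
  obtain K L where "compact K" "K \<subseteq> \<Omega>" "\<And>x. x \<notin> K \<Longrightarrow> f x = 0" "compact L" "L \<subseteq> \<Omega>" "\<And>x. x \<notin> L \<Longrightarrow> g x = 0"
    using assms by (auto simp: Cc_inf_def)
  then have "compact (K \<union> L) \<and> K \<union> L \<subseteq> \<Omega> \<and> (\<forall>x. x \<notin> K \<union> L \<longrightarrow> f x + g x = 0)" by auto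
  then show ?thesis using assms unfolding Cc_inf_def by (auto intro!: Ck_add)
qed

lemma pd_eq_0_outside:
  assumes "compact K" "\<And>x. x \<notin> K \<Longrightarrow> f x = 0" "x \<notin> K"
  shows "pd j f x = 0"
proof -
  have "(f has_derivative (\<lambda>h. 0)) (at x)"
    by (rule has_derivative_transform_within_open[of "\<lambda>x. 0" _ _ _ "- K"])
       (use assms in \<open>auto simp: compact_imp_closed\<close>)
  then show ?thesis by (simp add: pd_eq)
qed

lemma Cc_inf_pd: assumes "f \<in> Cc_inf \<Omega>" shows "pd j f \<in> Cc_inf \<Omega>"
proof -
  obtain K where K: "compact K" "K \<subseteq> \<Omega>" "\<And>x. x \<notin> K \<Longrightarrow> f x = 0"
    using assms by (auto simp: Cc_inf_def)
  have "Ck k (pd j f)" for k using Cc_infD(1)[OF assms, of "Suc k"] by simp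
  then show ?thesis using K pd_eq_0_outside[of K f _ j] unfolding Cc_inf_def by auto
qed

text \<open>
  Positive exactly on the open box, and increasing to its indicator as \<open>r\<close> tends to infinity.
\<close>

definition box_bump :: "pt \<Rightarrow> pt \<Rightarrow> real \<Rightarrow> pt \<Rightarrow> real" where
  "box_bump a b r x = (\<Prod>i\<in>UNIV. flat 0 (r * (x $ i - a $ i)) * flat 0 (r * (b $ i - x $ i)))"

lemma box_bump_Cc_inf:
  assumes "cbox a b \<subseteq> \<Omega>" "0 < r"
  shows "box_bump a b r \<in> Cc_inf \<Omega>"
proof -
  have "C_real k (\<lambda>s. flat 0 (r * s + - r * u) * flat 0 (- r * s + r * v))" for k u v
    by (intro C_real_mult C_real_affine C_real_flat)
  then have "Ck k (\<lambda>x. \<Prod>i\<in>UNIV. flat 0 (r * x $ i + - r * a $ i) * flat 0 (- r * x $ i + r * b $ i))" for k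
    by (intro Ck_prod Ck_coord)
  then have "Ck k (box_bump a b r)" for k
    by (simp add: box_bump_def[abs_def] algebra_simps)
  moreover have "box_bump a b r x = 0" if x: "x \<notin> cbox a b" for x
  proof -
    obtain i where "x $ i < a $ i \<or> b $ i < x $ i"
      using x by (auto simp: mem_box_cart not_le)
    then have "flat 0 (r * (x $ i - a $ i)) * flat 0 (r * (b $ i - x $ i)) = 0"
      using assms(2) by (auto simp: flat_def zero_less_mult_iff)
    then show ?thesis unfolding box_bump_def by (intro prod_zero) auto
  qed
  ultimately show ?thesis using assms unfolding Cc_inf_def
    by (auto intro!: exI[of _ "cbox a b"])
qed

lemma box_bump_bounds: "0 \<le> box_bump a b r x" "box_bump a b r x \<le> 1"
  unfolding box_bump_def
  by (auto intro!: prod_nonneg prod_le_1 mult_nonneg_nonneg mult_le_one simp: flat0_bounds)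

lemma flat0_scaled_tendsto:
  "(\<lambda>n. flat 0 (real (Suc n) * s)) \<longlonglongrightarrow> (if 0 < s then 1 else 0)"
proof (cases "0 < s")
  case True
  have "(\<lambda>n. exp (- (1 / s) * inverse (real (Suc n)))) \<longlonglongrightarrow> exp (- (1 / s) * 0)"
    by (intro tendsto_intros LIMSEQ_inverse_real_of_nat)
  moreover have "exp (- (1 / s) * inverse (real (Suc n))) = flat 0 (real (Suc n) * s)" for n
    using True by (simp add: flat_def zero_less_mult_iff field_simps del: of_nat_Suc)
  ultimately show ?thesis using True by simp
next
  case False
  then have "flat 0 (real (Suc n) * s) = 0" for n by (simp add: flat_def zero_less_mult_iff del: of_nat_Suc)
  then show ?thesis using False by simp
qed

lemma box_bump_tendsto: "(\<lambda>n. box_bump a b (real (Suc n)) x) \<longlonglongrightarrow> indicator (box a b) x"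
proof -
  have "(\<lambda>n. box_bump a b (real (Suc n)) x) \<longlonglongrightarrow>
     (\<Prod>i\<in>UNIV. (if 0 < x $ i - a $ i then 1 else 0) * (if 0 < b $ i - x $ i then 1 else 0))"
    unfolding box_bump_def by (intro tendsto_prod tendsto_mult flat0_scaled_tendsto)
  also have "(\<Prod>i\<in>UNIV. (if 0 < x $ i - a $ i then 1 else 0) * (if 0 < b $ i - x $ i then 1 else 0))
     = (indicator (box a b) x :: real)"
    by (auto simp: indicator_def mem_box_cart intro!: prod.neutral prod_zero split: if_splits)
  finally show ?thesis .
qed

section \<open>Integration by parts and the fundamental lemma\<close>

lemma set_integral_supported:
  fixes F :: "pt \<Rightarrow> real"
  assumes "F \<in> borel_measurable borel" "\<And>x. x \<notin> \<Omega> \<Longrightarrow> F x = 0"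
  shows "(LINT x:\<Omega>|lebesgue. F x) = (LINT x|lborel. F x)"
proof -
  have "(\<lambda>x. indicator \<Omega> x *\<^sub>R F x) = F" using assms(2) by (auto simp: indicator_def fun_eq_iff)
  then have "(LINT x:\<Omega>|lebesgue. F x) = (LINT x|lebesgue. F x)"
    by (simp add: set_lebesgue_integral_def)
  also have "\<dots> = (LINT x|lborel. F x)"
    by (rule integral_completion) (use assms in simp)
  finally show ?thesis .
qed

lemma integrable_compact_support:
  fixes F :: "pt \<Rightarrow> real"
  assumes "continuous_on UNIV F" "compact K" "\<And>x. x \<notin> K \<Longrightarrow> F x = 0"
  shows "integrable lborel F"
proof -
  have "(\<lambda>x. indicator K x *\<^sub>R F x) = F" using assms(3) by (auto simp: indicator_def fun_eq_iff)
  then show ?thesis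
    using borel_integrable_compact[of K F] assms continuous_on_subset by fastforce
qed

lemma bounded_compact_support:
  fixes F :: "pt \<Rightarrow> real"
  assumes "continuous_on UNIV F" "compact K" "\<And>x. x \<notin> K \<Longrightarrow> F x = 0"
  obtains B where "0 \<le> B" "\<And>x. \<bar>F x\<bar> \<le> B"
proof -
  have "bounded (F ` K)"
    by (intro compact_imp_bounded compact_continuous_image continuous_on_subset[OF assms(1)] assms) auto
  then obtain B where "\<And>x. x \<in> K \<Longrightarrow> \<bar>F x\<bar> \<le> B" by (auto simp: bounded_iff)
  then have "\<bar>F x\<bar> \<le> max B 0" for x using assms(3)[of x] by (cases "x \<in> K") fastforce+
  then show ?thesis using that[of "max B 0"] by auto
qed

text \<open>
  The difference quotients in direction \<open>j\<close> have integral zero by translation invariance. They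
  converge to the partial derivative and are bounded, by the mean value theorem, by a multiple of the
  indicator of one ball.
\<close>

lemma integral_pd_eq_0:
  assumes "Ck (Suc 0) f" "compact K" "\<And>x. x \<notin> K \<Longrightarrow> f x = 0"
  shows "(LINT x|lborel. pd j f x) = 0"
proof -
  define e :: pt where "e = axis j 1"
  define D where "D n x = (f (x + inverse (real (Suc n)) *\<^sub>R e) - f x) * real (Suc n)" for n x
  have diff: "f differentiable (at x)" for x using assms by simp
  have cf: "continuous_on UNIV f" by (rule Ck_continuous) (rule assms)
  have cpd: "continuous_on UNIV (pd j f)" using assms by simp
  have meas [measurable]: "f \<in> borel_measurable borel" "pd j f \<in> borel_measurable borel"
    using cf cpd by (auto intro: borel_measurable_continuous_onI)
  obtain B where B: "0 \<le> B" "\<And>x. \<bar>pd j f x\<bar> \<le> B"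
    using bounded_compact_support[OF cpd assms(2) pd_eq_0_outside[OF assms(2,3)]] by blast
  obtain R where R: "\<And>x. x \<in> K \<Longrightarrow> norm x \<le> R"
    using compact_imp_bounded[OF assms(2)] by (auto simp: bounded_iff)
  have int_f: "integrable lborel f" by (rule integrable_compact_support[OF cf assms(2,3)])
  have line: "((\<lambda>s. f (x + s *\<^sub>R e)) has_real_derivative pd j f (x + s *\<^sub>R e)) (at s)" for x s
  proof -
    have 1: "((\<lambda>s. x + s *\<^sub>R e) has_derivative (\<lambda>h. h *\<^sub>R e)) (at s)"
      by (auto intro!: derivative_eq_intros)
    have 2: "(f has_derivative frechet_derivative f (at (x + s *\<^sub>R e))) (at (x + s *\<^sub>R e))"
      by (rule has_pd_derivative[OF diff])
    have "((\<lambda>s. f (x + s *\<^sub>R e)) has_derivative (\<lambda>h. frechet_derivative f (at (x + s *\<^sub>R e)) (h *\<^sub>R e))) (at s)"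
      by (rule has_derivative_compose[OF 1 2])
    also have "(\<lambda>h. frechet_derivative f (at (x + s *\<^sub>R e)) (h *\<^sub>R e)) = (*) (pd j f (x + s *\<^sub>R e))"
      using linear_cmul[OF has_derivative_linear[OF 2]] by (auto simp: pd_def e_def)
    finally show ?thesis by (simp add: has_field_derivative_def)
  qed
  have "(LINT x|lborel. D n x) = 0" for n
  proof -
    let ?h = "inverse (real (Suc n)) *\<^sub>R e"
    have i: "integrable lborel (\<lambda>x. f (x + ?h))" "(LINT x|lborel. f (x + ?h)) = (LINT x|lborel. f x)"
      using int_f lborel_distr_plus[of ?h]
      by (subst (asm) (1) lborel_distr_plus[of ?h, symmetric], subst (asm) integrable_distr_eq, simp, simp, simp add: add.commute)
         (subst (2) lborel_distr_plus[of ?h, symmetric], subst integral_distr, simp, simp, simp add: add.commute)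
    show ?thesis unfolding D_def using i int_f by simp
  qed
  moreover have "(\<lambda>n. LINT x|lborel. D n x) \<longlonglongrightarrow> (LINT x|lborel. pd j f x)"
  proof (rule integral_dominated_convergence)
    show "integrable lborel (\<lambda>x :: pt. indicator (cball 0 (R + 1)) x * B :: real)"
      using emeasure_bounded_finite[OF bounded_cball, of "0::pt" "R + 1"]
      by (intro integrable_mult_left integrable_real_indicator) auto
    show "AE x in lborel. (\<lambda>n. D n x) \<longlonglongrightarrow> pd j f x"
    proof (rule AE_I2)
      fix x
      have "((\<lambda>h. (f (x + h *\<^sub>R e) - f x) / h) \<longlongrightarrow> pd j f x) (at 0)"
        using line[of x 0] by (simp add: DERIV_def)
      moreover have "filterlim (\<lambda>n. inverse (real (Suc n))) (at 0) sequentially"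
        using LIMSEQ_inverse_real_of_nat by (auto simp: filterlim_at simp del: of_nat_Suc)
      ultimately have "(\<lambda>n. (f (x + inverse (real (Suc n)) *\<^sub>R e) - f x) / inverse (real (Suc n))) \<longlonglongrightarrow> pd j f x"
        by (rule filterlim_compose)
      then show "(\<lambda>n. D n x) \<longlonglongrightarrow> pd j f x" by (simp add: D_def field_simps del: of_nat_Suc)
    qed
    show "AE x in lborel. norm (D n x) \<le> indicator (cball 0 (R + 1)) x * B" for n
    proof (rule AE_I2)
      fix x
      let ?h = "inverse (real (Suc n))"
      have h: "0 < ?h" "?h \<le> 1" by (auto simp: field_simps)
      show "norm (D n x) \<le> indicator (cball 0 (R + 1)) x * B"
      proof (cases "norm x \<le> R + 1")
        case True
        obtain z where "f (x + ?h *\<^sub>R e) - f (x + 0 *\<^sub>R e) = (?h - 0) * pd j f (x + z *\<^sub>R e)"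
          using MVT2[of 0 ?h "\<lambda>s. f (x + s *\<^sub>R e)" "\<lambda>s. pd j f (x + s *\<^sub>R e)"] line h by blast
        then have "D n x = pd j f (x + z *\<^sub>R e)" by (simp add: D_def field_simps)
        then show ?thesis using B True by simp
      next
        case False
        have "norm (?h *\<^sub>R e) \<le> 1" using h by (simp add: e_def norm_axis_1)
        then have "norm x \<le> norm (x + ?h *\<^sub>R e) + 1"
          using norm_triangle_ineq4[of "x + ?h *\<^sub>R e" "?h *\<^sub>R e"] by simp
        then have "x \<notin> K" "x + ?h *\<^sub>R e \<notin> K" using R[of x] R[of "x + ?h *\<^sub>R e"] False by auto
        then show ?thesis using assms(3) B by (simp add: D_def)
      qed
    qed
  qed (auto simp: D_def)
  ultimately show ?thesis by (simp add: LIMSEQ_const_iff)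
qed

locale bounded_open_set =
  fixes \<Omega> :: "pt set"
  assumes open_\<Omega>: "open \<Omega>" and bounded_\<Omega>: "bounded \<Omega>"

sublocale bounded_open_set \<subseteq> measurable_set
  by unfold_locales (use open_\<Omega> in auto)

context bounded_open_set
begin

abbreviation "grad \<equiv> wgrad \<Omega>"
abbreviation "Vnorm \<equiv> V_norm \<Omega>"
abbreviation "Vdist v w \<equiv> V_norm \<Omega> (\<lambda>x. v x - w x)"

lemma const_L2: "(\<lambda>x. c :: 'b::euclidean_space) \<in> L2 \<Omega>"
proof -
  have "emeasure lebesgue \<Omega> \<noteq> top"
    using fmeasurableD2[OF bounded_set_imp_lmeasurable[OF bounded_\<Omega> \<Omega>]] by simp
  then have "finite_measure (lebesgue_on \<Omega>)"
    using \<Omega> by (auto intro!: finite_measureI simp: emeasure_restrict_space space_restrict_space)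
  then show ?thesis
    unfolding L2_iff by (auto intro: finite_measure.integrable_const)
qed

lemma Cc_inf_support:
  assumes "\<phi> \<in> Cc_inf \<Omega>"
  obtains K where "compact K" "K \<subseteq> \<Omega>" "\<And>x. x \<notin> K \<Longrightarrow> \<phi> x = 0"
  using assms by (auto simp: Cc_inf_def)

lemma Cc_inf_borel: "\<phi> \<in> Cc_inf \<Omega> \<Longrightarrow> \<phi> \<in> borel_measurable borel"
  using Cc_infD(3) by (rule borel_measurable_continuous_onI)

lemma Cc_inf_integrable: "\<phi> \<in> Cc_inf \<Omega> \<Longrightarrow> integrable lborel \<phi>"
  by (metis Cc_inf_support integrable_compact_support Cc_infD(3))

lemma Cc_inf_set_integral:
  assumes "\<phi> \<in> Cc_inf \<Omega>" shows "(LINT x:\<Omega>|lebesgue. \<phi> x) = (LINT x|lborel. \<phi> x)"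
proof (rule set_integral_supported[OF Cc_inf_borel[OF assms]])
  fix x assume "x \<notin> \<Omega>"
  with assms show "\<phi> x = 0" by (auto simp: Cc_inf_def)
qed

lemma Cc_inf_L2:
  assumes "\<phi> \<in> Cc_inf \<Omega>" shows "\<phi> \<in> L2 \<Omega>"
proof -
  have "integrable lborel (\<lambda>x. \<phi> x * \<phi> x)"
    by (rule Cc_inf_integrable, rule Cc_inf_mult[OF assms]) (rule Cc_infD(1)[OF assms])
  then have "integrable lebesgue (\<lambda>x. \<phi> x * \<phi> x)"
    using Cc_inf_borel[OF assms] by (subst integrable_completion) auto
  then have "set_integrable lebesgue \<Omega> (\<lambda>x. \<phi> x * \<phi> x)"
    unfolding set_integrable_def by (intro integrable_mult_indicator \<Omega>)
  moreover have "\<phi> \<in> borel_measurable (lebesgue_on \<Omega>)"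
    using Cc_inf_borel[OF assms] by (intro measurable_restrict_space1 measurable_completion) simp
  ultimately show ?thesis by (simp add: L2_def power2_eq_square)
qed

text \<open>
  Integration by parts: the product of two test functions is a test function, so the integral of its
  derivative vanishes.
\<close>

lemma Cc_inf_has_weak_pd:
  assumes "\<phi> \<in> Cc_inf \<Omega>" shows "has_weak_pd \<Omega> j \<phi> (pd j \<phi>)"
  unfolding has_weak_pd_def
proof
  fix \<eta> assume \<eta>: "\<eta> \<in> Cc_inf \<Omega>"
  have c1: "(\<lambda>x. \<phi> x * pd j \<eta> x) \<in> Cc_inf \<Omega>" and c2: "(\<lambda>x. pd j \<phi> x * \<eta> x) \<in> Cc_inf \<Omega>"
    and c3: "(\<lambda>x. \<phi> x * \<eta> x) \<in> Cc_inf \<Omega>"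
    by (rule Cc_inf_mult[OF assms Cc_infD(1)[OF Cc_inf_pd[OF \<eta>]]]
        Cc_inf_mult[OF Cc_inf_pd[OF assms] Cc_infD(1)[OF \<eta>]]
        Cc_inf_mult[OF assms Cc_infD(1)[OF \<eta>]])+
  obtain K where K: "compact K" "K \<subseteq> \<Omega>" "\<And>x. x \<notin> K \<Longrightarrow> \<phi> x * \<eta> x = 0"
    using Cc_inf_support[OF c3] by blast
  have "(LINT x|lborel. pd j (\<lambda>x. \<phi> x * \<eta> x) x) = 0"
    by (rule integral_pd_eq_0[OF Cc_infD(1)[OF c3] K(1,3)])
  then have "(LINT x|lborel. \<phi> x * pd j \<eta> x) + (LINT x|lborel. pd j \<phi> x * \<eta> x) = 0"
    using Cc_inf_integrable[OF c1] Cc_inf_integrable[OF c2] assms \<eta>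
    by (subst (asm) pd_mult) (auto intro: Cc_infD)
  moreover have "(LINT x:\<Omega>|lebesgue. \<phi> x * pd j \<eta> x) = (LINT x|lborel. \<phi> x * pd j \<eta> x)"
    "(LINT x:\<Omega>|lebesgue. pd j \<phi> x * \<eta> x) = (LINT x|lborel. pd j \<phi> x * \<eta> x)"
    by (rule Cc_inf_set_integral[OF c1] Cc_inf_set_integral[OF c2])+
  ultimately show "(LINT x:\<Omega>|lebesgue. \<phi> x * pd j \<eta> x) = - (LINT x:\<Omega>|lebesgue. pd j \<phi> x * \<eta> x)"
    by linarith
qed

text \<open>
  The positive and the negative part of \<open>G\<close>, restricted to the box, are densities of two finite
  measures. They agree on open boxes, which are stable under intersection and generate the Borel sets,
  so they agree, and so do their densities.
\<close>

lemma AE_eq_0_on_box: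
  fixes G :: "pt \<Rightarrow> real"
  assumes [measurable]: "G \<in> borel_measurable borel" and int: "integrable lborel G"
    and zero: "\<And>a b. cbox a b \<subseteq> \<Omega> \<Longrightarrow> (LINT x|lborel. G x * indicator (box a b) x) = 0"
    and cd: "cbox c d \<subseteq> \<Omega>"
  shows "AE x in lborel. x \<in> box c d \<longrightarrow> G x = 0"
proof -
  define P where "P x = max 0 (G x) * indicator (box c d) x" for x
  define N where "N x = max 0 (- G x) * indicator (box c d) x" for x
  have [measurable]: "P \<in> borel_measurable borel" "N \<in> borel_measurable borel"
    unfolding P_def[abs_def] N_def[abs_def] by measurable
  have bd: "\<bar>P x\<bar> \<le> \<bar>G x\<bar>" "\<bar>N x\<bar> \<le> \<bar>G x\<bar>" for x by (auto simp: P_def N_def indicator_def)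
  have int_P: "integrable lborel (\<lambda>x. P x * indicator X x)" 
    and int_N: "integrable lborel (\<lambda>x. N x * indicator X x)" if [measurable]: "X \<in> sets borel" for X
    using bd by (auto intro!: Bochner_Integration.integrable_bound[OF int] simp: indicator_def)
  have em: "emeasure (density lborel (\<lambda>x. ennreal (F x))) X = ennreal (LINT x|lborel. F x * indicator X x)"
    if [measurable]: "X \<in> sets borel" "F \<in> borel_measurable borel"
      and "\<And>x. 0 \<le> F x" "integrable lborel (\<lambda>x. F x * indicator X x)" for X and F :: "pt \<Rightarrow> real"
    using that by (simp add: emeasure_density nn_integral_eq_integral ennreal_mult'[symmetric] ennreal_indicator[symmetric])
  have nn: "0 \<le> P x" "0 \<le> N x" for x by (auto simp: P_def N_def)
  have "density lborel (\<lambda>x. ennreal (P x)) = density lborel (\<lambda>x. ennreal (N x))"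
  proof (rule measure_eqI_generator_eq)
    let ?E = "range (\<lambda>(a, b). box a b::pt set)"
    show "Int_stable ?E"
      by (auto simp: Int_stable_def box_Int_box)
    show "?E \<subseteq> Pow UNIV" "sets (density lborel (\<lambda>x. ennreal (P x))) = sigma_sets UNIV ?E"
      "sets (density lborel (\<lambda>x. ennreal (N x))) = sigma_sets UNIV ?E"
      by (simp_all add: borel_eq_box)
    let ?A = "\<lambda>n::nat. box (- (real n *\<^sub>R One)) (real n *\<^sub>R One) :: pt set"
    show "range ?A \<subseteq> ?E" "(\<Union>i. ?A i) = UNIV"
      unfolding UN_box_eq_UNIV by auto
    show "emeasure (density lborel (\<lambda>x. ennreal (P x))) (?A i) \<noteq> \<infinity>" for i
      by (subst em) (auto intro: int_P nn)
    show "emeasure (density lborel (\<lambda>x. ennreal (P x))) X = emeasure (density lborel (\<lambda>x. ennreal (N x))) X"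
      if "X \<in> ?E" for X
    proof -
      from that obtain a b where X: "X = box a b" by auto
      obtain a' b' where I: "box a b \<inter> box c d = box a' b'" using box_Int_box by blast
      have [measurable]: "X \<in> sets borel" by (simp add: X)
      have "(LINT x|lborel. P x * indicator X x) - (LINT x|lborel. N x * indicator X x)
          = (LINT x|lborel. P x * indicator X x - N x * indicator X x)"
        by (subst Bochner_Integration.integral_diff) (auto intro: int_P int_N)
      also have "\<dots> = (LINT x|lborel. G x * indicator (box a' b') x)"
        unfolding I[symmetric] X by (rule Bochner_Integration.integral_cong) (auto simp: P_def N_def indicator_def)
      also have "\<dots> = 0"
      proof (cases "box a' b' = {}")
        case False
        then have "cbox a' b' = closure (box a' b')" by simp
        also have "\<dots> \<subseteq> closure (box c d)" by (rule closure_mono) (use I in auto)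
        also have "\<dots> \<subseteq> cbox c d" by (rule closure_minimal) (auto simp: box_subset_cbox)
        finally show ?thesis using cd by (intro zero) auto
      qed simp
      finally show ?thesis by (subst (1 2) em) (auto intro: int_P int_N nn)
    qed
  qed
  then have "AE x in lborel. ennreal (P x) = ennreal (N x)"
    by (subst (asm) finite_density_unique)
      (use int_P[of UNIV] in \<open>auto simp: nn nn_integral_eq_integral\<close>)
  then show ?thesis
    by eventually_elim (auto simp: P_def N_def nn max_def split: if_splits)
qed

text \<open>
  Bumps converge boundedly to indicators of boxes, which reduces the claim to the previous lemma.
  Countably many boxes cover the domain.
\<close>

lemma fundamental_lemma:
  fixes g :: "pt \<Rightarrow> real"
  assumes g: "g \<in> L2 \<Omega>" and zero: "\<And>\<phi>. \<phi> \<in> Cc_inf \<Omega> \<Longrightarrow> (LINT x:\<Omega>|lebesgue. g x * \<phi> x) = 0"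
  shows "AE x in lebesgue_on \<Omega>. g x = 0"
proof -
  have "integrable (lebesgue_on \<Omega>) g"
    using L2_inner_integrable[OF g const_L2[of 1]] by simp
  then have int: "integrable lebesgue (\<lambda>x. indicator \<Omega> x * g x)"
    using set_integrable_iff_on[of g] by (simp add: set_integrable_def)
  (* A Borel representative, because the comparison of measures lives on the Borel sets. *)
  then obtain G where G [measurable]: "G \<in> borel_measurable lborel" and GAE: "AE x in lborel. indicator \<Omega> x * g x = G x"
    using completion_ex_borel_measurable_real borel_measurable_integrable by blast
  have GAE': "AE x in lebesgue. indicator \<Omega> x * g x = G x" using GAE by (rule AE_completion)
  have int_G: "integrable lborel G"
  proof -
    have "integrable lebesgue G"
      using int GAE' G by (subst integrable_cong_AE[symmetric]) (auto intro: measurable_completion)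
    then show ?thesis by (subst (asm) integrable_completion) auto
  qed
  have test: "(LINT x|lborel. G x * \<phi> x) = 0" if "\<phi> \<in> Cc_inf \<Omega>" for \<phi>
  proof -
    have [measurable]: "\<phi> \<in> borel_measurable borel" by (rule Cc_inf_borel[OF that])
    have "(LINT x|lborel. G x * \<phi> x) = (LINT x|lebesgue. G x * \<phi> x)"
      by (rule integral_completion[symmetric]) simp
    also have "\<dots> = (LINT x|lebesgue. indicator \<Omega> x * g x * \<phi> x)"
    proof (rule integral_cong_AE)
      show "AE x in lebesgue. G x * \<phi> x = indicator \<Omega> x * g x * \<phi> x" using GAE' by eventually_elim simp
      show "(\<lambda>x. indicator \<Omega> x * g x * \<phi> x) \<in> borel_measurable lebesgue"
        by (intro borel_measurable_times[OF borel_measurable_integrable[OF int]] measurable_completion) simp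
      show "(\<lambda>x. G x * \<phi> x) \<in> borel_measurable lebesgue" by (rule measurable_completion) simp
    qed
    also have "\<dots> = 0" using zero[OF that] by (simp add: set_lebesgue_integral_def mult.assoc)
    finally show ?thesis .
  qed
  have box: "(LINT x|lborel. G x * indicator (box a b) x) = 0" if "cbox a b \<subseteq> \<Omega>" for a b
  proof -
    have m: "box_bump a b (real (Suc n)) \<in> Cc_inf \<Omega>" for n by (rule box_bump_Cc_inf) (use that in auto)
    have "(\<lambda>n. LINT x|lborel. G x * box_bump a b (real (Suc n)) x) \<longlonglongrightarrow> (LINT x|lborel. G x * indicator (box a b) x)"
    proof (rule integral_dominated_convergence[where w = "\<lambda>x. \<bar>G x\<bar>"])
      show "AE x in lborel. norm (G x * box_bump a b (real (Suc n)) x) \<le> \<bar>G x\<bar>" for n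
        using box_bump_bounds by (auto simp: abs_mult intro!: AE_I2 mult_left_le)
      show "(\<lambda>x. G x * box_bump a b (real (Suc n)) x) \<in> borel_measurable lborel" for n
        using Cc_inf_borel[OF m] by simp
      show "AE x in lborel. (\<lambda>n. G x * box_bump a b (real (Suc n)) x) \<longlonglongrightarrow> G x * indicator (box a b) x"
        by (intro AE_I2 tendsto_mult tendsto_const box_bump_tendsto)
    qed (use int_G in auto)
    then show ?thesis using test[OF m] by (simp add: LIMSEQ_const_iff)
  qed
  define F where "F = {X. \<exists>a b. X = box a b \<and> cbox a b \<subseteq> \<Omega>}"
  have "\<And>X. X \<in> F \<Longrightarrow> open X" by (auto simp: F_def)
  then obtain F' where F': "F' \<subseteq> F" "countable F'" "\<Union>F' = \<Union>F" using Lindelof by metis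
  have cover: "\<Union>F = \<Omega>"
  proof
    show "\<Union>F \<subseteq> \<Omega>" using box_subset_cbox by (fastforce simp: F_def)
    show "\<Omega> \<subseteq> \<Union>F"
    proof
      fix x assume "x \<in> \<Omega>"
      show "x \<in> \<Union>F"
      proof (rule open_contains_cbox[OF open_\<Omega> \<open>x \<in> \<Omega>\<close>])
        fix a b assume "cbox a b \<subseteq> \<Omega>" "x \<in> box a b"
        then show ?thesis by (auto simp: F_def)
      qed
    qed
  qed
  have "AE x in lborel. \<forall>X\<in>F'. x \<in> X \<longrightarrow> G x = 0"
    using F' by (subst AE_ball_countable) (auto simp: F_def intro!: AE_eq_0_on_box[OF _ int_G box])
  then have "AE x in lborel. x \<in> \<Omega> \<longrightarrow> G x = 0"
    by eventually_elim (use F' cover in blast)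
  then have "AE x in lborel. x \<in> \<Omega> \<longrightarrow> g x = 0"
    using GAE by eventually_elim (auto simp: indicator_def)
  then have "AE x in lebesgue. x \<in> \<Omega> \<longrightarrow> g x = 0" by (rule AE_completion)
  then show ?thesis using \<Omega> by (subst AE_restrict_space_iff) auto
qed

end

section \<open>Weak derivatives and the Poincare inequality\<close>

context bounded_open_set
begin

lemma has_weak_pd_iff:
  "has_weak_pd \<Omega> j f g \<longleftrightarrow> (\<forall>\<phi>\<in>Cc_inf \<Omega>. ip f (pd j \<phi>) = - ip g \<phi>)"
  by (simp add: has_weak_pd_def L2_inner_def)

text \<open>
  Everything about the chosen representative \<open>wpd\<close> is derived from this uniqueness.
\<close>

lemma weak_pd_unique:
  assumes "g \<in> L2 \<Omega>" "g' \<in> L2 \<Omega>" "has_weak_pd \<Omega> j f g" "has_weak_pd \<Omega> j f g'"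
  shows "AE x in lebesgue_on \<Omega>. g x = g' x"
proof -
  have "AE x in lebesgue_on \<Omega>. g x - g' x = 0"
  proof (rule fundamental_lemma[OF L2_diff[OF assms(1,2)]])
    fix \<phi> assume \<phi>: "\<phi> \<in> Cc_inf \<Omega>"
    have "ip (\<lambda>x. g x - g' x) \<phi> = 0"
      using assms \<phi> Cc_inf_L2[OF \<phi>] by (simp add: L2_inner_diff_left has_weak_pd_iff)
    then show "(LINT x:\<Omega>|lebesgue. (g x - g' x) * \<phi> x) = 0" by (simp add: L2_inner_def)
  qed
  then show ?thesis by eventually_elim simp
qed

lemma H1D:
  assumes "f \<in> H1 \<Omega>"
  shows "f \<in> L2 \<Omega>" "wpd \<Omega> j f \<in> L2 \<Omega>" "has_weak_pd \<Omega> j f (wpd \<Omega> j f)"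
proof -
  show "f \<in> L2 \<Omega>" using assms by (simp add: H1_def)
  have "\<exists>g. g \<in> L2 \<Omega> \<and> has_weak_pd \<Omega> j f g" using assms by (auto simp: H1_def)
  from someI_ex[OF this] show "wpd \<Omega> j f \<in> L2 \<Omega>" "has_weak_pd \<Omega> j f (wpd \<Omega> j f)"
    unfolding wpd_def by auto
qed

lemma wpd_AE_eq:
  assumes "f \<in> H1 \<Omega>" "g \<in> L2 \<Omega>" "has_weak_pd \<Omega> j f g"
  shows "AE x in lebesgue_on \<Omega>. wpd \<Omega> j f x = g x"
  by (rule weak_pd_unique[OF _ assms(2) _ assms(3)]) (auto intro: H1D assms(1))

lemma has_weak_pd_add:
  assumes "f \<in> L2 \<Omega>" "f' \<in> L2 \<Omega>" "g \<in> L2 \<Omega>" "g' \<in> L2 \<Omega>" "has_weak_pd \<Omega> j f g" "has_weak_pd \<Omega> j f' g'"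
  shows "has_weak_pd \<Omega> j (\<lambda>x. f x + f' x) (\<lambda>x. g x + g' x)"
  using assms by (auto simp: has_weak_pd_iff L2_inner_add_left Cc_inf_L2 Cc_inf_pd)

lemma has_weak_pd_scale:
  assumes "has_weak_pd \<Omega> j f g"
  shows "has_weak_pd \<Omega> j (\<lambda>x. c *\<^sub>R f x) (\<lambda>x. c *\<^sub>R g x)"
  using assms unfolding has_weak_pd_iff L2_inner_scaleR_left by simp

lemma H1_add:
  assumes "f \<in> H1 \<Omega>" "g \<in> H1 \<Omega>"
  shows "(\<lambda>x. f x + g x) \<in> H1 \<Omega>"
    and "AE x in lebesgue_on \<Omega>. wpd \<Omega> j (\<lambda>x. f x + g x) x = wpd \<Omega> j f x + wpd \<Omega> j g x"
proof -
  have *: "(\<lambda>x. wpd \<Omega> j f x + wpd \<Omega> j g x) \<in> L2 \<Omega>"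
    "has_weak_pd \<Omega> j (\<lambda>x. f x + g x) (\<lambda>x. wpd \<Omega> j f x + wpd \<Omega> j g x)" for j
    by (rule L2_add has_weak_pd_add H1D assms)+
  then show "(\<lambda>x. f x + g x) \<in> H1 \<Omega>"
    using L2_add[OF H1D(1)[OF assms(1)] H1D(1)[OF assms(2)]] unfolding H1_def by blast
  then show "AE x in lebesgue_on \<Omega>. wpd \<Omega> j (\<lambda>x. f x + g x) x = wpd \<Omega> j f x + wpd \<Omega> j g x"
    by (rule wpd_AE_eq) (rule *)+
qed

lemma H1_scale:
  assumes "f \<in> H1 \<Omega>"
  shows "(\<lambda>x. c *\<^sub>R f x) \<in> H1 \<Omega>"
    and "AE x in lebesgue_on \<Omega>. wpd \<Omega> j (\<lambda>x. c *\<^sub>R f x) x = c *\<^sub>R wpd \<Omega> j f x"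
proof -
  have *: "(\<lambda>x. c *\<^sub>R wpd \<Omega> j f x) \<in> L2 \<Omega>"
    "has_weak_pd \<Omega> j (\<lambda>x. c *\<^sub>R f x) (\<lambda>x. c *\<^sub>R wpd \<Omega> j f x)" for j
    by (rule L2_scaleR has_weak_pd_scale H1D assms)+
  then show "(\<lambda>x. c *\<^sub>R f x) \<in> H1 \<Omega>"
    using L2_scaleR[OF H1D(1)[OF assms(1)], of c] unfolding H1_def by blast
  then show "AE x in lebesgue_on \<Omega>. wpd \<Omega> j (\<lambda>x. c *\<^sub>R f x) x = c *\<^sub>R wpd \<Omega> j f x"
    by (rule wpd_AE_eq) (rule *)+
qed

lemma Cc_inf_H1:
  assumes "\<phi> \<in> Cc_inf \<Omega>"
  shows "\<phi> \<in> H1 \<Omega>" "AE x in lebesgue_on \<Omega>. wpd \<Omega> j \<phi> x = pd j \<phi> x"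
proof -
  have *: "has_weak_pd \<Omega> j \<phi> (pd j \<phi>)" "pd j \<phi> \<in> L2 \<Omega>" for j
    using Cc_inf_has_weak_pd[OF assms] Cc_inf_L2[OF Cc_inf_pd[OF assms]] by auto
  then show "\<phi> \<in> H1 \<Omega>" using Cc_inf_L2[OF assms] by (auto simp: H1_def)
  then show "AE x in lebesgue_on \<Omega>. wpd \<Omega> j \<phi> x = pd j \<phi> x"
    by (rule wpd_AE_eq) (rule *)+
qed

lemma H1_diff_Cc_inf:
  assumes "f \<in> H1 \<Omega>" "\<phi> \<in> Cc_inf \<Omega>"
  shows "(\<lambda>x. f x - \<phi> x) \<in> H1 \<Omega>"
    and "norm2 (wpd \<Omega> j (\<lambda>x. f x - \<phi> x)) = norm2 (\<lambda>x. wpd \<Omega> j f x - pd j \<phi> x)"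
proof -
  note s = H1_scale[OF Cc_inf_H1(1)[OF assms(2)], where c = "-1"]
  have e: "(\<lambda>x. f x - \<phi> x) = (\<lambda>x. f x + (-1) *\<^sub>R \<phi> x)" by simp
  show h: "(\<lambda>x. f x - \<phi> x) \<in> H1 \<Omega>" unfolding e by (rule H1_add[OF assms(1) s(1)])
  have "AE x in lebesgue_on \<Omega>. wpd \<Omega> j (\<lambda>x. f x - \<phi> x) x = wpd \<Omega> j f x - pd j \<phi> x"
    unfolding e using H1_add(2)[OF assms(1) s(1), of j] s(2)[of j] Cc_inf_H1(2)[OF assms(2), of j]
    by eventually_elim simp
  then show "norm2 (wpd \<Omega> j (\<lambda>x. f x - \<phi> x)) = norm2 (\<lambda>x. wpd \<Omega> j f x - pd j \<phi> x)"
    by (rule L2_norm_cong)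
       (auto intro: H1D[OF h] L2_diff H1D[OF assms(1)] Cc_inf_L2 Cc_inf_pd assms)
qed

lemma H1_norm_bounds:
  "norm2 f \<le> H1_norm \<Omega> f" "norm2 (wpd \<Omega> j f) \<le> H1_norm \<Omega> f"
  unfolding H1_norm_def
proof -
  let ?s = "\<Sum>j\<in>UNIV. (norm2 (wpd \<Omega> j f))\<^sup>2"
  have "(norm2 (wpd \<Omega> j f))\<^sup>2 \<le> ?s" by (rule member_le_sum) auto
  moreover have "0 \<le> ?s" by (rule sum_nonneg) auto
  ultimately show "norm2 f \<le> sqrt ((norm2 f)\<^sup>2 + ?s)"
    "norm2 (wpd \<Omega> j f) \<le> sqrt ((norm2 f)\<^sup>2 + ?s)"
    by (auto intro!: real_le_rsqrt simp: add_increasing)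
qed

text \<open>
  In this form the closure of the test functions is visibly a linear space: the \<open>H\<^sup>1\<close> norm of a
  difference involves the representative chosen for the derivative of the difference, while here the
  representative for \<open>f\<close> itself is compared with classical derivatives.
\<close>

lemma H10_iff:
  "f \<in> H10 \<Omega> \<longleftrightarrow> f \<in> H1 \<Omega> \<and> (\<exists>\<phi>. (\<forall>n. \<phi> n \<in> Cc_inf \<Omega>) \<and>
     (\<lambda>n::nat. dist2 f (\<phi> n)) \<longlonglongrightarrow> 0 \<and>
     (\<forall>j. (\<lambda>n. norm2 (\<lambda>x. wpd \<Omega> j f x - pd j (\<phi> n) x)) \<longlonglongrightarrow> 0))"
  (is "?l \<longleftrightarrow> ?r")
proof
  assume f: ?l
  then have H1: "f \<in> H1 \<Omega>" by (simp add: H10_def)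
  have "\<forall>n. \<exists>\<phi>\<in>Cc_inf \<Omega>. H1_norm \<Omega> (\<lambda>x. f x - \<phi> x) < inverse (real (Suc n))"
    using f unfolding H10_def by (auto simp del: of_nat_Suc)
  then obtain \<phi> where \<phi>: "\<And>n. \<phi> n \<in> Cc_inf \<Omega>" "\<And>n. H1_norm \<Omega> (\<lambda>x. f x - \<phi> n x) < inverse (real (Suc n))"
    by metis
  have "(\<lambda>n. dist2 f (\<phi> n)) \<longlonglongrightarrow> 0"
    by (rule tendsto_sandwich[OF _ _ tendsto_const LIMSEQ_inverse_real_of_nat])
       (auto intro!: always_eventually order_trans[OF H1_norm_bounds(1) less_imp_le[OF \<phi>(2)]]
         L2_norm_nonneg simp del: of_nat_Suc)
  moreover have "(\<lambda>n. norm2 (\<lambda>x. wpd \<Omega> j f x - pd j (\<phi> n) x)) \<longlonglongrightarrow> 0" for j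
    unfolding H1_diff_Cc_inf(2)[OF H1 \<phi>(1), symmetric]
    by (rule tendsto_sandwich[OF _ _ tendsto_const LIMSEQ_inverse_real_of_nat])
       (auto intro!: always_eventually order_trans[OF H1_norm_bounds(2) less_imp_le[OF \<phi>(2)]]
         L2_norm_nonneg simp del: of_nat_Suc)
  ultimately show ?r using H1 \<phi>(1) by blast
next
  assume ?r
  then obtain \<phi> where H1: "f \<in> H1 \<Omega>" and \<phi>: "\<And>n. \<phi> n \<in> Cc_inf \<Omega>"
    and l: "(\<lambda>n. dist2 f (\<phi> n)) \<longlonglongrightarrow> 0"
      "\<And>j. (\<lambda>n. norm2 (\<lambda>x. wpd \<Omega> j f x - pd j (\<phi> n) x)) \<longlonglongrightarrow> 0" by blast
  have "(\<lambda>n. H1_norm \<Omega> (\<lambda>x. f x - \<phi> n x)) \<longlonglongrightarrow> sqrt (0\<^sup>2 + (\<Sum>j\<in>(UNIV :: 3 set). 0\<^sup>2))"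
    unfolding H1_norm_def H1_diff_Cc_inf(2)[OF H1 \<phi>] by (intro tendsto_intros l)
  then have lim: "(\<lambda>n. H1_norm \<Omega> (\<lambda>x. f x - \<phi> n x)) \<longlonglongrightarrow> 0" by simp
  show ?l unfolding H10_def
  proof (intro CollectI conjI allI impI H1)
    fix \<epsilon> :: real assume "\<epsilon> > 0"
    from order_tendstoD(2)[OF lim this] obtain n where "H1_norm \<Omega> (\<lambda>x. f x - \<phi> n x) < \<epsilon>"
      by (auto simp: eventually_sequentially)
    then show "\<exists>\<phi>\<in>Cc_inf \<Omega>. H1_norm \<Omega> (\<lambda>x. f x - \<phi> x) < \<epsilon>" using \<phi> by blast
  qed
qed

lemma H10_add:
  assumes "f \<in> H10 \<Omega>" "g \<in> H10 \<Omega>"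
  shows "(\<lambda>x. f x + g x) \<in> H10 \<Omega>"
proof -
  from assms obtain \<phi> \<psi> where f: "f \<in> H1 \<Omega>" and \<phi>: "\<And>n. \<phi> n \<in> Cc_inf \<Omega>"
    and lf: "(\<lambda>n. dist2 f (\<phi> n)) \<longlonglongrightarrow> 0"
      "\<And>j. (\<lambda>n. norm2 (\<lambda>x. wpd \<Omega> j f x - pd j (\<phi> n) x)) \<longlonglongrightarrow> 0"
    and g: "g \<in> H1 \<Omega>" and \<psi>: "\<And>n. \<psi> n \<in> Cc_inf \<Omega>"
    and lg: "(\<lambda>n. dist2 g (\<psi> n)) \<longlonglongrightarrow> 0"
      "\<And>j. (\<lambda>n. norm2 (\<lambda>x. wpd \<Omega> j g x - pd j (\<psi> n) x)) \<longlonglongrightarrow> 0"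
    unfolding H10_iff by blast
  have L2: "f \<in> L2 \<Omega>" "g \<in> L2 \<Omega>" "\<phi> n \<in> L2 \<Omega>" "\<psi> n \<in> L2 \<Omega>" "wpd \<Omega> j f \<in> L2 \<Omega>" "wpd \<Omega> j g \<in> L2 \<Omega>"
    "pd j (\<phi> n) \<in> L2 \<Omega>" "pd j (\<psi> n) \<in> L2 \<Omega>" for j n
    by (auto intro: H1D[OF f] H1D[OF g] Cc_inf_L2 \<phi> \<psi> Cc_inf_pd)
  have sum: "(\<lambda>n. norm2 (\<lambda>x. (F x + G x) - (P n x + Q n x))) \<longlonglongrightarrow> 0"
    if "F \<in> L2 \<Omega>" "G \<in> L2 \<Omega>" "\<And>n. P n \<in> L2 \<Omega>" "\<And>n. Q n \<in> L2 \<Omega>"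
      "(\<lambda>n. dist2 F (P n)) \<longlonglongrightarrow> 0" "(\<lambda>n. dist2 G (Q n)) \<longlonglongrightarrow> 0"
    for F G :: "pt \<Rightarrow> real" and P Q :: "nat \<Rightarrow> pt \<Rightarrow> real"
  proof (rule tendsto_sandwich[OF _ _ tendsto_const])
    show "(\<lambda>n. dist2 F (P n) + dist2 G (Q n)) \<longlonglongrightarrow> 0"
      using tendsto_add[OF that(5,6)] by simp
    have "norm2 (\<lambda>x. (F x + G x) - (P n x + Q n x))
       \<le> dist2 F (P n) + dist2 G (Q n)" for n
      using L2_norm_triangle[OF L2_diff[OF that(1) that(3)] L2_diff[OF that(2) that(4)], of n n]
      by (simp add: algebra_simps)
    then show "\<forall>\<^sub>F n in sequentially. norm2 (\<lambda>x. (F x + G x) - (P n x + Q n x))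
       \<le> dist2 F (P n) + dist2 G (Q n)" by simp
  qed (simp add: L2_norm_nonneg)
  show ?thesis unfolding H10_iff
  proof (intro conjI exI allI)
    show H: "(\<lambda>x. f x + g x) \<in> H1 \<Omega>" by (rule H1_add[OF f g])
    show "(\<lambda>x. \<phi> n x + \<psi> n x) \<in> Cc_inf \<Omega>" for n by (rule Cc_inf_add[OF \<phi> \<psi>])
    show "(\<lambda>n. norm2 (\<lambda>x. f x + g x - (\<phi> n x + \<psi> n x))) \<longlonglongrightarrow> 0"
      by (rule sum) (rule L2 lf lg)+
    show "(\<lambda>n. norm2 (\<lambda>x. wpd \<Omega> j (\<lambda>x. f x + g x) x - pd j (\<lambda>x. \<phi> n x + \<psi> n x) x)) \<longlonglongrightarrow> 0" for j
    proof -
      have "norm2 (\<lambda>x. wpd \<Omega> j (\<lambda>x. f x + g x) x - pd j (\<lambda>x. \<phi> n x + \<psi> n x) x)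
        = norm2 (\<lambda>x. (wpd \<Omega> j f x + wpd \<Omega> j g x) - (pd j (\<phi> n) x + pd j (\<psi> n) x))" for n
        unfolding pd_add[OF Cc_infD(2)[OF \<phi>] Cc_infD(2)[OF \<psi>]]
      proof (rule L2_norm_cong)
        show "AE x in lebesgue_on \<Omega>. wpd \<Omega> j (\<lambda>x. f x + g x) x - (pd j (\<phi> n) x + pd j (\<psi> n) x)
           = (wpd \<Omega> j f x + wpd \<Omega> j g x) - (pd j (\<phi> n) x + pd j (\<psi> n) x)"
          using H1_add(2)[OF f g] by eventually_elim simp
      qed (intro L2_diff L2_add L2 H1D[OF H])+
      then show ?thesis using sum[OF L2(5,6,7,8) lf(2) lg(2)] by simp
    qed
  qed
qed

lemma H10_scale:
  assumes "f \<in> H10 \<Omega>"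
  shows "(\<lambda>x. c *\<^sub>R f x) \<in> H10 \<Omega>"
proof -
  from assms obtain \<phi> where f: "f \<in> H1 \<Omega>" and \<phi>: "\<And>n. \<phi> n \<in> Cc_inf \<Omega>"
    and l: "(\<lambda>n. dist2 f (\<phi> n)) \<longlonglongrightarrow> 0"
      "\<And>j. (\<lambda>n. norm2 (\<lambda>x. wpd \<Omega> j f x - pd j (\<phi> n) x)) \<longlonglongrightarrow> 0"
    unfolding H10_iff by blast
  have c: "(\<lambda>x. c *\<^sub>R \<phi> n x) \<in> Cc_inf \<Omega>" for n
    using Cc_inf_mult[OF \<phi>[of n] Ck_const[of _ c]] by (simp add: mult.commute)
  have pdc: "pd j (\<lambda>x. c *\<^sub>R \<phi> n x) = (\<lambda>x. c *\<^sub>R pd j (\<phi> n) x)" for j n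
    using pd_mult[of "\<lambda>x. c" "\<phi> n" j] Cc_infD(2)[OF \<phi>] by (simp add: pd_const)
  show ?thesis unfolding H10_iff
  proof (intro conjI exI allI)
    show H: "(\<lambda>x. c *\<^sub>R f x) \<in> H1 \<Omega>" by (rule H1_scale[OF f])
    show "(\<lambda>x. c *\<^sub>R \<phi> n x) \<in> Cc_inf \<Omega>" for n by (rule c)
    show "(\<lambda>n. norm2 (\<lambda>x. c *\<^sub>R f x - c *\<^sub>R \<phi> n x)) \<longlonglongrightarrow> 0"
      unfolding scaleR_diff_right[symmetric] L2_norm_scaleR
      using tendsto_mult[OF tendsto_const l(1), of "\<bar>c\<bar>"] by simp
    show "(\<lambda>n. norm2 (\<lambda>x. wpd \<Omega> j (\<lambda>x. c *\<^sub>R f x) x - pd j (\<lambda>x. c *\<^sub>R \<phi> n x) x)) \<longlonglongrightarrow> 0" for j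
    proof -
      have "norm2 (\<lambda>x. wpd \<Omega> j (\<lambda>x. c *\<^sub>R f x) x - pd j (\<lambda>x. c *\<^sub>R \<phi> n x) x)
        = norm2 (\<lambda>x. c *\<^sub>R (wpd \<Omega> j f x - pd j (\<phi> n) x))" for n
        unfolding pdc
      proof (rule L2_norm_cong)
        show "AE x in lebesgue_on \<Omega>. wpd \<Omega> j (\<lambda>x. c *\<^sub>R f x) x - c *\<^sub>R pd j (\<phi> n) x
           = c *\<^sub>R (wpd \<Omega> j f x - pd j (\<phi> n) x)"
          using H1_scale(2)[OF f, of j c] by eventually_elim (simp add: algebra_simps)
      qed (intro L2_diff L2_scaleR H1D[OF H] H1D[OF f] Cc_inf_L2 Cc_inf_pd \<phi>)+
      then show ?thesis unfolding L2_norm_scaleR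
        using tendsto_mult[OF tendsto_const l(2), of "\<bar>c\<bar>" j] by simp
    qed
  qed
qed

text \<open>
  Test the weak derivative of \<open>\<phi>\<close> with \<open>x\<^sub>j \<phi>\<close>. The result is
  \<open>\<parallel>\<phi>\<parallel>\<^sup>2 = - 2 \<langle>\<partial>\<^sub>j \<phi>, x\<^sub>j \<phi>\<rangle>\<close>, and \<open>x\<^sub>j\<close> is bounded by \<open>R\<close> on the domain.
\<close>

lemma Poincare_Cc_inf:
  assumes \<phi>: "\<phi> \<in> Cc_inf \<Omega>" and R: "\<And>x. x \<in> \<Omega> \<Longrightarrow> norm x \<le> R"
  shows "norm2 \<phi> \<le> 2 * R * norm2 (pd j \<phi>)"
proof (cases "norm2 \<phi> = 0")
  case True
  show ?thesis
  proof (cases "\<Omega> = {}")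
    case True
    then show ?thesis by (simp add: L2_norm_def L2_inner_def set_lebesgue_integral_def)
  next
    case False
    then obtain x where "x \<in> \<Omega>" by auto
    then have "0 \<le> R" using R[of x] norm_ge_zero[of x] by linarith
    then show ?thesis using True L2_norm_nonneg[of "pd j \<phi>"] by simp
  qed
next
  case False
  let ?x = "\<lambda>x :: pt. x $ j"
  have Cx: "Ck k ?x" for k
  proof -
    have "C_real k (\<lambda>s. s)"
      by (cases k) (auto intro!: continuous_intros exI[of _ "\<lambda>_. 1"] C_real_const derivative_eq_intros)
    from Ck_coord[OF this] show ?thesis .
  qed
  have pdx: "pd j ?x = (\<lambda>x. 1)"
    by (rule ext, subst pd_eq[OF bounded_linear_imp_has_derivative[OF bounded_linear_vec_nth]]) simp
  have difx: "?x differentiable (at x)" for x using Cx[of "Suc 0"] by simp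
  have xphi: "(\<lambda>x. \<phi> x * x $ j) \<in> Cc_inf \<Omega>" by (rule Cc_inf_mult[OF \<phi> Cx])
  have pd_xphi: "pd j (\<lambda>x. \<phi> x * x $ j) = (\<lambda>x. \<phi> x + pd j \<phi> x * x $ j)"
    by (simp add: pd_mult[OF Cc_infD(2)[OF \<phi>] difx] pdx)
  have "ip \<phi> (\<lambda>x. \<phi> x + pd j \<phi> x * x $ j) = - ip (pd j \<phi>) (\<lambda>x. \<phi> x * x $ j)"
    using Cc_inf_has_weak_pd[OF \<phi>, of j] xphi unfolding has_weak_pd_iff pd_xphi[symmetric] by blast
  moreover have "ip \<phi> (\<lambda>x. \<phi> x + pd j \<phi> x * x $ j)
     = ip \<phi> \<phi> + ip \<phi> (\<lambda>x. pd j \<phi> x * x $ j)"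
    by (intro L2_inner_add_right Cc_inf_L2 \<phi> Cc_inf_mult[OF Cc_inf_pd[OF \<phi>] Cx])
  moreover have "ip \<phi> (\<lambda>x. pd j \<phi> x * x $ j) = ip (pd j \<phi>) (\<lambda>x. \<phi> x * x $ j)"
    unfolding L2_inner_def by (rule arg_cong[where f="\<lambda>F. set_lebesgue_integral _ _ F"]) auto
  ultimately have "(norm2 \<phi>)\<^sup>2 = - 2 * ip (pd j \<phi>) (\<lambda>x. \<phi> x * x $ j)"
    by (simp add: L2_norm_squared)
  also have "\<dots> \<le> 2 * (norm2 (pd j \<phi>) * norm2 (\<lambda>x. \<phi> x * x $ j))"
    using L2_Cauchy_Schwarz[OF Cc_inf_L2[OF Cc_inf_pd[OF \<phi>, of j]] Cc_inf_L2[OF xphi]] by linarith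
  also have "\<dots> \<le> 2 * (norm2 (pd j \<phi>) * (R * norm2 \<phi>))"
  proof -
    have ne: "\<Omega> \<noteq> {}" using False by (auto simp: L2_norm_def L2_inner_def set_lebesgue_integral_def)
    then obtain x where "x \<in> \<Omega>" by auto
    then have R0: "0 \<le> R" using R[of x] norm_ge_zero[of x] by linarith
    have "ip (\<lambda>x. \<phi> x * x $ j) (\<lambda>x. \<phi> x * x $ j) \<le> ip (\<lambda>x. R *\<^sub>R \<phi> x) (\<lambda>x. R *\<^sub>R \<phi> x)"
      unfolding L2_inner_eq
    proof (rule integral_mono)
      show "integrable (lebesgue_on \<Omega>) (\<lambda>x. (\<phi> x * x $ j) \<bullet> (\<phi> x * x $ j))"
        by (rule L2_inner_integrable[OF Cc_inf_L2[OF xphi] Cc_inf_L2[OF xphi]])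
      show "integrable (lebesgue_on \<Omega>) (\<lambda>x. R *\<^sub>R \<phi> x \<bullet> R *\<^sub>R \<phi> x)"
        by (rule L2_inner_integrable[OF L2_scaleR[OF Cc_inf_L2[OF \<phi>]] L2_scaleR[OF Cc_inf_L2[OF \<phi>]]])
      fix x assume "x \<in> space (lebesgue_on \<Omega>)"
      then have "\<bar>x $ j\<bar> \<le> R" using R[of x] component_le_norm_cart[of x j] by (simp add: space_restrict_space)
      then have "(x $ j)\<^sup>2 \<le> R\<^sup>2" using R0 by (simp add: abs_le_square_iff[symmetric])
      then have "(\<phi> x)\<^sup>2 * (x $ j)\<^sup>2 \<le> (\<phi> x)\<^sup>2 * R\<^sup>2" by (intro mult_left_mono) auto
      then show "(\<phi> x * x $ j) \<bullet> (\<phi> x * x $ j) \<le> R *\<^sub>R \<phi> x \<bullet> R *\<^sub>R \<phi> x"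
        by (simp add: power2_eq_square algebra_simps)
    qed
    then have "norm2 (\<lambda>x. \<phi> x * x $ j) \<le> norm2 (\<lambda>x. R *\<^sub>R \<phi> x)"
      unfolding L2_norm_def by (rule real_sqrt_le_mono)
    then have "norm2 (\<lambda>x. \<phi> x * x $ j) \<le> R * norm2 \<phi>"
      unfolding L2_norm_scaleR using R0 by simp
    then show ?thesis using L2_norm_nonneg by (intro mult_left_mono) auto
  qed
  finally have "norm2 \<phi> * norm2 \<phi> \<le> (2 * R * norm2 (pd j \<phi>)) * norm2 \<phi>"
    by (simp add: power2_eq_square algebra_simps)
  moreover have "0 < norm2 \<phi>" using False L2_norm_nonneg[of \<phi>] by linarith
  ultimately show ?thesis by simp
qed

lemma Poincare_H10:
  assumes f: "f \<in> H10 \<Omega>" and R: "\<And>x. x \<in> \<Omega> \<Longrightarrow> norm x \<le> R"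
  shows "norm2 f \<le> 2 * R * norm2 (wpd \<Omega> j f)"
proof -
  from f obtain \<phi> where f: "f \<in> H1 \<Omega>" and \<phi>: "\<And>n. \<phi> n \<in> Cc_inf \<Omega>"
    and l: "(\<lambda>n. dist2 f (\<phi> n)) \<longlonglongrightarrow> 0"
      "\<And>j. (\<lambda>n. norm2 (\<lambda>x. wpd \<Omega> j f x - pd j (\<phi> n) x)) \<longlonglongrightarrow> 0"
    unfolding H10_iff by blast
  have lim: "(\<lambda>n. norm2 (F n)) \<longlonglongrightarrow> norm2 G"
    if L: "G \<in> L2 \<Omega>" "\<And>n. F n \<in> L2 \<Omega>" "(\<lambda>n. dist2 G (F n)) \<longlonglongrightarrow> 0"
    for F :: "nat \<Rightarrow> pt \<Rightarrow> real" and G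
  proof (rule LIM_zero_cancel, rule Lim_null_comparison[OF always_eventually that(3)], rule allI)
    fix n
    show "norm (norm2 (F n) - norm2 G) \<le> dist2 G (F n)"
      using L2_norm_triangle_diff[OF L(1) L(2), of n] L2_norm_triangle_diff[OF L(2) L(1), of n]
        L2_norm_minus_commute[of "F n" G] by auto
  qed
  show ?thesis
  proof (rule LIMSEQ_le)
    show "(\<lambda>n. norm2 (\<phi> n)) \<longlonglongrightarrow> norm2 f"
      by (rule lim) (auto intro: H1D[OF f] Cc_inf_L2 \<phi> l)
    show "(\<lambda>n. 2 * R * norm2 (pd j (\<phi> n))) \<longlonglongrightarrow> 2 * R * norm2 (wpd \<Omega> j f)"
      by (intro tendsto_intros lim) (auto intro: H1D[OF f] Cc_inf_L2 Cc_inf_pd \<phi> l)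
    show "\<exists>N. \<forall>n\<ge>N. norm2 (\<phi> n) \<le> 2 * R * norm2 (pd j (\<phi> n))"
      using Poincare_Cc_inf[OF \<phi> R] by blast
  qed
qed

end

section \<open>Laplace transforms\<close>

text \<open>
  Iterated integrals are computed on the product of Borel measures, so integrals against Lebesgue
  measure are rewritten with a Borel integrand. One exceptional point \<open>c\<close> is allowed, since a stress
  is unspecified at time \<open>0\<close>; under a convolution this point moves to \<open>t = \<tau>\<close>.
\<close>

lemma set_integral_lborel:
  fixes f f' :: "real \<Rightarrow> real"
  assumes [measurable]: "f' \<in> borel_measurable borel"
    and "\<And>t. t \<in> A \<Longrightarrow> t \<noteq> c \<Longrightarrow> f t = f' t" "\<And>t. t \<notin> A \<Longrightarrow> t \<noteq> c \<Longrightarrow> f' t = 0"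
  shows "(LINT t:A|lebesgue. f t) = (LINT t|lborel. f' t)"
    and "set_integrable lebesgue A f \<longleftrightarrow> integrable lborel f'"
proof -
  have eq: "indicator A t *\<^sub>R f t = f' t" if "t \<noteq> c" for t
    using assms(2,3)[OF _ that] by (auto simp: indicator_def)
  have "(LINT t|lebesgue. indicator A t *\<^sub>R f t) = (LINT t|lebesgue. f' t)"
    by (rule integral_discrete_difference[of "{c}"]) (use eq in auto)
  then show "(LINT t:A|lebesgue. f t) = (LINT t|lborel. f' t)"
    unfolding set_lebesgue_integral_def by (simp add: integral_completion)
  have "integrable lebesgue (\<lambda>t. indicator A t *\<^sub>R f t) \<longleftrightarrow> integrable lebesgue f'"
    by (rule integrable_discrete_difference[of "{c}"]) (use eq in auto)
  then show "set_integrable lebesgue A f \<longleftrightarrow> integrable lborel f'"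
    unfolding set_integrable_def by (simp add: integrable_completion)
qed

definition laplace :: "(real \<Rightarrow> real) \<Rightarrow> real \<Rightarrow> real" where
  "laplace f p = (LINT t:{0..}|lebesgue. f t * exp (- p * t))"

definition laplaceable :: "(real \<Rightarrow> real) \<Rightarrow> real \<Rightarrow> bool" where
  "laplaceable f p \<longleftrightarrow> set_integrable lebesgue {0..} (\<lambda>t. f t * exp (- p * t))"

text \<open>
  A function that is continuous at positive times only becomes Borel measurable on the line when
  extended by \<open>0\<close>; its transform does not notice.
\<close>

definition pos_part_time :: "(real \<Rightarrow> real) \<Rightarrow> real \<Rightarrow> real" where
  "pos_part_time f t = (if 0 < t then f t else 0)"

lemma pos_part_time_borel:
  assumes "continuous_on {0<..} f" shows "pos_part_time f \<in> borel_measurable borel"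
proof -
  have "pos_part_time f = (\<lambda>t. indicator {0<..} t *\<^sub>R f t)"
    by (auto simp: pos_part_time_def fun_eq_iff)
  then show ?thesis using borel_measurable_continuous_on_indicator[of "{0<..}" f] assms by simp
qed

lemma laplace_lborel:
  assumes "pos_part_time f \<in> borel_measurable borel"
  shows "laplace f p = (LINT t|lborel. pos_part_time f t * exp (- p * t))"
    and "laplaceable f p \<longleftrightarrow> integrable lborel (\<lambda>t. pos_part_time f t * exp (- p * t))"
proof -
  have [measurable]: "pos_part_time f \<in> borel_measurable borel" by fact
  have m: "(\<lambda>t. pos_part_time f t * exp (- p * t)) \<in> borel_measurable borel" by measurable
  show "laplace f p = (LINT t|lborel. pos_part_time f t * exp (- p * t))"
    unfolding laplace_def by (rule set_integral_lborel(1)[OF m, where c=0]) (auto simp: pos_part_time_def)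
  show "laplaceable f p \<longleftrightarrow> integrable lborel (\<lambda>t. pos_part_time f t * exp (- p * t))"
    unfolding laplaceable_def by (rule set_integral_lborel(2)[OF m, where c=0]) (auto simp: pos_part_time_def)
qed

lemma integrable_product_lborel:
  fixes f g :: "real \<Rightarrow> real"
  assumes f: "integrable lborel f" and g: "integrable lborel g"
  shows "integrable (lborel \<Otimes>\<^sub>M lborel) (\<lambda>(x, y). f x * g y)"
    and "(LINT z|(lborel \<Otimes>\<^sub>M lborel). (case z of (x, y) \<Rightarrow> f x * g y)) = (LINT x|lborel. f x) * (LINT y|lborel. g y)"
proof -
  have [measurable]: "f \<in> borel_measurable borel" "g \<in> borel_measurable borel"
    using f g by auto
  show 1: "integrable (lborel \<Otimes>\<^sub>M lborel) (\<lambda>(x, y). f x * g y)"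
  proof (rule lborel_pair.Fubini_integrable)
    show "integrable lborel (\<lambda>x. LINT y|lborel. norm (case (x, y) of (x, y) \<Rightarrow> f x * g y))"
      using f g by (simp add: abs_mult)
    show "AE x in lborel. integrable lborel (\<lambda>y. case (x, y) of (x, y) \<Rightarrow> f x * g y)"
      using g by simp
  qed measurable
  show "(LINT z|(lborel \<Otimes>\<^sub>M lborel). (case z of (x, y) \<Rightarrow> f x * g y)) = (LINT x|lborel. f x) * (LINT y|lborel. g y)"
    by (subst lborel_pair.integral_fst[OF 1, symmetric]) simp
qed

text \<open>
  What the passage from cutoff exponentials to \<open>c exp (- p t)\<close> requires of the test functions. The
  cutoff exponentials are an instance with \<open>c = 1\<close>, their derivatives one with \<open>c = - p\<close>.
\<close>

locale exp_approximation =
  fixes p C c :: real and g :: "nat \<Rightarrow> real \<Rightarrow> real"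
  assumes g_borel [measurable]: "\<And>n. g n \<in> borel_measurable borel"
    and g_bound: "\<And>n t. 0 \<le> t \<Longrightarrow> \<bar>g n t\<bar> \<le> C * exp (- p * t)"
    and g_lim: "\<And>t. 0 \<le> t \<Longrightarrow> (\<lambda>n. g n t) \<longlonglongrightarrow> c * exp (- p * t)"
begin

lemma single_limit:
  assumes f: "laplaceable f p"
  shows "(\<lambda>n. LINT t:{0..}|lebesgue. f t * g n t) \<longlonglongrightarrow> c * laplace f p"
proof -
  have int: "integrable lebesgue (\<lambda>t. indicator {0..} t * (f t * exp (- p * t)))"
    using f by (simp add: laplaceable_def set_integrable_def)
  have m: "(\<lambda>t. g n t * exp (p * t)) \<in> borel_measurable lebesgue" for n
    by (rule measurable_completion) measurable
  have mg: "(\<lambda>t. indicator {0..} t * (f t * g n t)) \<in> borel_measurable lebesgue" for n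
  proof -
    have "(\<lambda>t. indicator {0..} t * (f t * exp (- p * t)) * (g n t * exp (p * t))) \<in> borel_measurable lebesgue"
      by (rule borel_measurable_times[OF borel_measurable_integrable[OF int] m])
    also have "(\<lambda>t. indicator {0..} t * (f t * exp (- p * t)) * (g n t * exp (p * t))) = (\<lambda>t. indicator {0..} t * (f t * g n t))"
      by (auto simp: fun_eq_iff exp_minus field_simps)
    finally show ?thesis .
  qed
  have "(\<lambda>n. LINT t|lebesgue. indicator {0..} t * (f t * g n t)) \<longlonglongrightarrow> (LINT t|lebesgue. c * (indicator {0..} t * (f t * exp (- p * t))))"
  proof (rule integral_dominated_convergence)
    show "integrable lebesgue (\<lambda>t. C * \<bar>indicator {0..} t * (f t * exp (- p * t))\<bar>)"
      using int by (intro integrable_mult_right integrable_abs)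
    show "AE t in lebesgue. (\<lambda>n. indicator {0..} t * (f t * g n t)) \<longlonglongrightarrow> c * (indicator {0..} t * (f t * exp (- p * t)))"
    proof (rule AE_I2)
      fix t
      have "0 \<le> t \<Longrightarrow> (\<lambda>n. f t * g n t) \<longlonglongrightarrow> f t * (c * exp (- p * t))"
        by (intro tendsto_mult tendsto_const g_lim)
      then show "(\<lambda>n. indicator {0..} t * (f t * g n t)) \<longlonglongrightarrow> c * (indicator {0..} t * (f t * exp (- p * t)))"
        by (cases "0 \<le> t") (simp_all add: mult.left_commute)
    qed
    show "AE t in lebesgue. norm (indicator {0..} t * (f t * g n t)) \<le> C * \<bar>indicator {0..} t * (f t * exp (- p * t))\<bar>" for n
    proof (rule AE_I2)
      fix t
      show "norm (indicator {0..} t * (f t * g n t)) \<le> C * \<bar>indicator {0..} t * (f t * exp (- p * t))\<bar>"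
        using mult_left_mono[OF g_bound[of t n], of "\<bar>f t\<bar>"]
        by (cases "0 \<le> t") (simp_all add: abs_mult algebra_simps)
    qed
  qed (use mg int in auto)
  then show ?thesis by (simp add: set_lebesgue_integral_def laplace_def)
qed

text \<open>
  Since \<open>exp (- p (x + y))\<close> is a product, the integrand is dominated by the product of two integrable
  functions of one variable, and the limit integral factorises.
\<close>

lemma double_limit:
  assumes [measurable]: "K \<in> borel_measurable borel" "s \<in> borel_measurable borel"
    and zero: "\<And>t. t \<le> 0 \<Longrightarrow> K t = 0" "\<And>t. t \<le> 0 \<Longrightarrow> s t = 0"
    and int: "integrable lborel (\<lambda>t. K t * exp (- p * t))" "integrable lborel (\<lambda>t. s t * exp (- p * t))"
  shows "integrable (lborel \<Otimes>\<^sub>M lborel) (\<lambda>(x, y). K x * g n (x + y) * s y)"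
    and "(\<lambda>n. LINT x|lborel. LINT y|lborel. K x * g n (x + y) * s y)
       \<longlonglongrightarrow> c * (LINT t|lborel. K t * exp (- p * t)) * (LINT t|lborel. s t * exp (- p * t))"
proof -
  let ?M = "lborel \<Otimes>\<^sub>M lborel :: (real \<times> real) measure"
  define w where "w = (\<lambda>(x, y). C * (\<bar>K x * exp (- p * x)\<bar> * \<bar>s y * exp (- p * y)\<bar>))"
  have w: "integrable ?M w"
    unfolding w_def using integrable_mult_right[OF integrable_product_lborel(1)[OF integrable_abs[OF int(1)] integrable_abs[OF int(2)]], of C]
    by (simp add: case_prod_beta')
  have bound: "norm (case z of (x, y) \<Rightarrow> K x * g n (x + y) * s y) \<le> w z" for z n
  proof (cases z)
    case (Pair x y)
    show ?thesis
    proof (cases "0 < x \<and> 0 < y")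
      case True
      then have "\<bar>g n (x + y)\<bar> \<le> C * (exp (- p * x) * exp (- p * y))"
        using g_bound[of "x + y" n] by (simp add: exp_add[symmetric] algebra_simps)
      from mult_left_mono[OF this, of "\<bar>K x\<bar> * \<bar>s y\<bar>"] show ?thesis
        by (simp add: Pair w_def abs_mult algebra_simps)
    next
      case False
      then have "x \<le> 0 \<or> y \<le> 0" by linarith
        then have "K x = 0 \<or> s y = 0" using zero by blast
      then show ?thesis by (auto simp: Pair w_def)
    qed
  qed
  have meas: "(\<lambda>(x, y). K x * g n (x + y) * s y) \<in> borel_measurable ?M" for n
    by measurable
  show int: "integrable ?M (\<lambda>(x, y). K x * g n (x + y) * s y)" for n
    by (rule Bochner_Integration.integrable_bound[OF w meas]) (use bound in \<open>auto intro!: AE_I2 order_trans[OF _ abs_ge_self] simp: case_prod_beta'\<close>)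
  have "(\<lambda>n. LINT z|?M. (case z of (x, y) \<Rightarrow> K x * g n (x + y) * s y))
      \<longlonglongrightarrow> (LINT z|?M. c * (case z of (x, y) \<Rightarrow> (K x * exp (- p * x)) * (s y * exp (- p * y))))"
  proof (rule integral_dominated_convergence[OF _ _ w])
    show "AE z in ?M. (\<lambda>n. case z of (x, y) \<Rightarrow> K x * g n (x + y) * s y)
        \<longlonglongrightarrow> c * (case z of (x, y) \<Rightarrow> (K x * exp (- p * x)) * (s y * exp (- p * y)))"
    proof (rule AE_I2)
      fix z :: "real \<times> real"
      obtain x y where z: "z = (x, y)" by force
      show "(\<lambda>n. case z of (x, y) \<Rightarrow> K x * g n (x + y) * s y)
        \<longlonglongrightarrow> c * (case z of (x, y) \<Rightarrow> (K x * exp (- p * x)) * (s y * exp (- p * y)))"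
      proof (cases "0 < x \<and> 0 < y")
        case True
        then have "(\<lambda>n. K x * g n (x + y) * s y) \<longlonglongrightarrow> K x * (c * exp (- p * (x + y))) * s y"
          by (intro tendsto_mult tendsto_const g_lim) auto
        then show ?thesis by (simp add: z exp_add[symmetric] algebra_simps)
      next
        case False
        then have "x \<le> 0 \<or> y \<le> 0" by linarith
        then have "K x = 0 \<or> s y = 0" using zero by blast
        then show ?thesis by (auto simp: z)
      qed
    qed
  qed (use bound meas in auto)
  moreover have "(LINT x|lborel. LINT y|lborel. K x * g n (x + y) * s y)
      = (LINT z|?M. (case z of (x, y) \<Rightarrow> K x * g n (x + y) * s y))" for n
    by (rule lborel_pair.integral_fst[OF int])
  moreover have "(LINT z|?M. c * (case z of (x, y) \<Rightarrow> (K x * exp (- p * x)) * (s y * exp (- p * y))))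
      = c * (LINT t|lborel. K t * exp (- p * t)) * (LINT t|lborel. s t * exp (- p * t))"
    unfolding integral_mult_right_zero integrable_product_lborel(2)[OF assms(5,6)] by (rule mult.assoc[symmetric])
  ultimately show "(\<lambda>n. LINT x|lborel. LINT y|lborel. K x * g n (x + y) * s y)
       \<longlonglongrightarrow> c * (LINT t|lborel. K t * exp (- p * t)) * (LINT t|lborel. s t * exp (- p * t))"
    by (simp only:)
qed

text \<open>
  The two memory terms of the constitutive law integrate over the wedge \<open>t \<ge> x\<close> in opposite orders.
  Substituting \<open>t = x + y\<close> turns both into integrals over the quadrant, the second after an exchange
  of integrations.
\<close>

lemma convolution_limit:
  assumes K [measurable]: "pos_part_time K \<in> borel_measurable borel" and s [measurable]: "pos_part_time s \<in> borel_measurable borel"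
    and "laplaceable K p" "laplaceable s p" and K0: "K 0 = 0"
    and G: "\<And>n t. 0 \<le> t \<Longrightarrow> G n t = g n t"
  shows "(\<lambda>n. LINT x:{0..}|lebesgue. LINT t:{x..}|lebesgue. G n t * K x * s (t - x))
       \<longlonglongrightarrow> c * laplace K p * laplace s p"
    and "(\<lambda>n. LINT t:{0..}|lebesgue. LINT x:{0..t}|lebesgue. G n t * K (t - x) * s x)
       \<longlonglongrightarrow> c * laplace K p * laplace s p"
proof -
  let ?K = "pos_part_time K" and ?s = "pos_part_time s"
  have zero: "\<And>t. t \<le> 0 \<Longrightarrow> ?K t = 0" "\<And>t. t \<le> 0 \<Longrightarrow> ?s t = 0"
    by (auto simp: pos_part_time_def)
  note int = assms(3,4)[unfolded laplace_lborel(2)[OF K] laplace_lborel(2)[OF s]]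
  note lim1 = double_limit[OF K s zero int]
  note lim2 = double_limit[OF s K zero(2,1) int(2,1)]
  have "(LINT x:{0..}|lebesgue. LINT t:{x..}|lebesgue. G n t * K x * s (t - x))
      = (LINT x|lborel. LINT y|lborel. ?K x * g n (x + y) * ?s y)" for n
  proof (rule set_integral_lborel(1)[where c=0])
    show "(\<lambda>x. LINT y|lborel. ?K x * g n (x + y) * ?s y) \<in> borel_measurable borel"
      by measurable
    fix x :: real
    assume x: "x \<noteq> 0"
    { assume "x \<in> {0..}"
      with x have x0: "0 < x" by simp
      have "(LINT t:{x..}|lebesgue. G n t * K x * s (t - x)) = (LINT t|lborel. ?K x * g n t * ?s (t - x))"
      proof (rule set_integral_lborel(1)[where c=x])
        show "(\<lambda>t. ?K x * g n t * ?s (t - x)) \<in> borel_measurable borel" by measurable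
      qed (use x0 G in \<open>auto simp: pos_part_time_def\<close>)
      also have "\<dots> = (LINT y|lborel. ?K x * g n (x + y) * ?s y)"
        by (subst lborel_integral_real_affine[where c=1 and t=x]) auto
      finally show "(LINT t:{x..}|lebesgue. G n t * K x * s (t - x)) = (LINT y|lborel. ?K x * g n (x + y) * ?s y)" . }
    { assume "x \<notin> {0..}"
      then show "(LINT y|lborel. ?K x * g n (x + y) * ?s y) = 0" by (simp add: pos_part_time_def) }
  qed
  then show "(\<lambda>n. LINT x:{0..}|lebesgue. LINT t:{x..}|lebesgue. G n t * K x * s (t - x))
       \<longlonglongrightarrow> c * laplace K p * laplace s p"
    using lim1(2) by (simp add: laplace_lborel(1)[OF K] laplace_lborel(1)[OF s])
  have "(LINT t:{0..}|lebesgue. LINT x:{0..t}|lebesgue. G n t * K (t - x) * s x)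
      = (LINT x|lborel. LINT y|lborel. ?s x * g n (x + y) * ?K y)" for n
  proof -
    have shift: "(\<lambda>y. ?s x * g n (x + y) * ?K y) = (\<lambda>y. (\<lambda>t. ?s x * g n t * ?K (t - x)) (x + 1 * y))" for x
      by simp
    have H: "integrable (lborel \<Otimes>\<^sub>M lborel) (\<lambda>(x, t). ?s x * g n t * ?K (t - x))"
    proof (rule lborel_pair.Fubini_integrable)
      show "(\<lambda>(x, t). ?s x * g n t * ?K (t - x)) \<in> borel_measurable (lborel \<Otimes>\<^sub>M lborel)" by measurable
      have "integrable lborel (\<lambda>x. LINT y|lborel. norm (?s x * g n (x + y) * ?K y))"
        using lborel_pair.integrable_fst[of "\<lambda>x y. norm (?s x * g n (x + y) * ?K y)"] integrable_norm[OF lim2(1)[of n]]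
        by (simp add: case_prod_beta')
      moreover have "(LINT y|lborel. norm (?s x * g n (x + y) * ?K y)) = (LINT t|lborel. norm (?s x * g n t * ?K (t - x)))" for x
        by (subst (2) lborel_integral_real_affine[where c=1 and t=x]) auto
      ultimately show "integrable lborel (\<lambda>x. LINT t|lborel. norm (case (x, t) of (x, t) \<Rightarrow> ?s x * g n t * ?K (t - x)))"
        by simp
      have "AE x in lborel. integrable lborel (\<lambda>y. ?s x * g n (x + y) * ?K y)"
        by (rule lborel_pair.AE_integrable_fst[OF lim2(1)])
      then show "AE x in lborel. integrable lborel (\<lambda>t. case (x, t) of (x, t) \<Rightarrow> ?s x * g n t * ?K (t - x))"
        unfolding shift by (subst (asm) lborel_integrable_real_affine_iff) auto
    qed
    have "(LINT t:{0..}|lebesgue. LINT x:{0..t}|lebesgue. G n t * K (t - x) * s x)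
        = (LINT t|lborel. LINT x|lborel. ?s x * g n t * ?K (t - x))"
    proof (rule set_integral_lborel(1)[where c=0])
      show "(\<lambda>t. LINT x|lborel. ?s x * g n t * ?K (t - x)) \<in> borel_measurable borel"
        by measurable
      fix t :: real
      assume t: "t \<noteq> 0"
      { assume "t \<in> {0..}"
        with t have t0: "0 < t" by simp
        show "(LINT x:{0..t}|lebesgue. G n t * K (t - x) * s x) = (LINT x|lborel. ?s x * g n t * ?K (t - x))"
        proof (rule set_integral_lborel(1)[where c=0])
          show "(\<lambda>x. ?s x * g n t * ?K (t - x)) \<in> borel_measurable borel" by measurable
        qed (use t0 G K0 in \<open>auto simp: pos_part_time_def\<close>) }
      { assume "t \<notin> {0..}"
        then have "(\<lambda>x. ?s x * g n t * ?K (t - x)) = (\<lambda>x. 0)" by (auto simp: pos_part_time_def)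
        then show "(LINT x|lborel. ?s x * g n t * ?K (t - x)) = 0" by simp }
    qed
    also have "\<dots> = (LINT x|lborel. LINT t|lborel. ?s x * g n t * ?K (t - x))"
      by (rule lborel_pair.Fubini_integral[OF H])
    also have "\<dots> = (LINT x|lborel. LINT y|lborel. ?s x * g n (x + y) * ?K y)"
    proof (rule Bochner_Integration.integral_cong[OF refl])
      fix x
      show "(LINT t|lborel. ?s x * g n t * ?K (t - x)) = (LINT y|lborel. ?s x * g n (x + y) * ?K y)"
        by (subst lborel_integral_real_affine[where c=1 and t=x]) auto
    qed
    finally show ?thesis .
  qed
  then show "(\<lambda>n. LINT t:{0..}|lebesgue. LINT x:{0..t}|lebesgue. G n t * K (t - x) * s x)
       \<longlonglongrightarrow> c * laplace K p * laplace s p"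
    using lim2(2) by (simp add: laplace_lborel(1)[OF K] laplace_lborel(1)[OF s] mult_ac)
qed

end

text \<open>
  The factor \<open>exp 1\<close> normalises the cutoff to be \<open>1\<close> at time \<open>0\<close>, where the initial velocity enters.
\<close>

definition exp_cutoff :: "real \<Rightarrow> nat \<Rightarrow> real \<Rightarrow> real" where
  "exp_cutoff p n t = exp (- p * t) * (exp 1 * flat 0 (1 - t / real (Suc n)))"

definition exp_cutoff' :: "real \<Rightarrow> nat \<Rightarrow> real \<Rightarrow> real" where
  "exp_cutoff' p n t = exp (- p * t) * (- p * (exp 1 * flat 0 (1 - t / real (Suc n)))
      - exp 1 * flat 2 (1 - t / real (Suc n)) / real (Suc n))"

lemma exp_cutoff_time_test: "exp_cutoff p n \<in> time_test"
proof (rule time_testI[where R="real (Suc n)"])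
  fix k
  have "C_real k (\<lambda>t. exp (- p * t + 0) * (exp 1 * flat 0 ((- 1 / real (Suc n)) * t + 1)))"
    by (rule C_real_mult[OF C_real_affine[OF C_real_exp] C_real_mult[OF C_real_const C_real_affine[OF C_real_flat]]])
  then show "C_real k (exp_cutoff p n)"
    by (simp add: exp_cutoff_def[abs_def] algebra_simps del: of_nat_Suc)
qed (simp add: exp_cutoff_def flat_def field_simps)

lemma hderiv_exp_cutoff:
  assumes "0 \<le> t" shows "hderiv (exp_cutoff p n) t = exp_cutoff' p n t"
proof (rule hderiv_eq)
  have 1: "(flat 0 has_real_derivative flat 2 (1 - t / real (Suc n))) (at (1 - t / real (Suc n)))"
    using DERIV_flat[of 0] by (simp add: numeral_2_eq_2)
  have 2: "((\<lambda>t. 1 - t / real (Suc n)) has_real_derivative - 1 / real (Suc n)) (at t)"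
    by (auto intro!: derivative_eq_intros simp del: of_nat_Suc)
  have 3: "((\<lambda>t. exp (- p * t)) has_real_derivative exp (- p * t) * - p) (at t)"
    by (auto intro!: derivative_eq_intros)
  show "(exp_cutoff p n has_real_derivative exp_cutoff' p n t) (at t)"
    unfolding exp_cutoff_def[abs_def] exp_cutoff'_def
    by (rule DERIV_cong[OF DERIV_mult[OF 3 DERIV_cmult[OF DERIV_chain2[OF 1 2]]]])
       (simp add: algebra_simps del: of_nat_Suc)
qed (use assms in auto)

lemma flat0_one: "exp 1 * flat 0 1 = 1"
  by (simp add: flat_def exp_minus)

lemma cutoff_arg_tendsto: "(\<lambda>n. 1 - t / real (Suc n)) \<longlonglongrightarrow> 1"
proof -
  have "(\<lambda>n. 1 - t * inverse (real (Suc n))) \<longlonglongrightarrow> 1 - t * 0"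
    by (intro tendsto_intros LIMSEQ_inverse_real_of_nat)
  then show ?thesis by (simp add: divide_inverse)
qed

lemma flat_tendsto: "x \<longlonglongrightarrow> l \<Longrightarrow> (\<lambda>n. flat k (x n)) \<longlonglongrightarrow> flat k l"
  using C_real_continuous[OF C_real_flat[of 0 k]] continuous_on_tendsto_compose[of UNIV "flat k" x l sequentially]
  by auto

lemma flat_borel [measurable]: "flat k \<in> borel_measurable borel"
  using C_real_continuous[OF C_real_flat[of 0 k]] by (rule borel_measurable_continuous_onI)

lemma exp_cutoff_approx:
  shows "exp_approximation p (exp 1) 1 (exp_cutoff p)"
proof
  fix n
  show "exp_cutoff p n \<in> borel_measurable borel" unfolding exp_cutoff_def[abs_def] by measurable
  fix t :: real
  have "exp 1 * flat 0 (1 - t / real (Suc n)) \<le> exp 1 * 1"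
    by (intro mult_left_mono flat0_bounds) auto
  then have "exp (- p * t) * (exp 1 * flat 0 (1 - t / real (Suc n))) \<le> exp (- p * t) * exp 1"
    by (intro mult_left_mono) auto
  then show "\<bar>exp_cutoff p n t\<bar> \<le> exp 1 * exp (- p * t)"
    by (simp add: exp_cutoff_def abs_mult flat0_bounds mult.commute del: of_nat_Suc)
next
  fix t :: real
  have "(\<lambda>n. exp_cutoff p n t) \<longlonglongrightarrow> exp (- p * t) * (exp 1 * flat 0 1)"
    unfolding exp_cutoff_def by (intro tendsto_intros flat_tendsto cutoff_arg_tendsto)
  then show "(\<lambda>n. exp_cutoff p n t) \<longlonglongrightarrow> 1 * exp (- p * t)" by (simp add: flat0_one)
qed

lemma exp_cutoff'_approx:
  obtains C where "exp_approximation p C (- p) (exp_cutoff' p)"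
proof -
  have "bounded (flat 2 ` {0..1})"
    by (intro compact_imp_bounded compact_continuous_image continuous_on_subset[OF C_real_continuous[OF C_real_flat[of 0 2]]]) auto
  then obtain B where B: "\<forall>x\<in>{0..1}. \<bar>flat 2 x\<bar> \<le> B" by (auto simp: bounded_iff)
  then have B': "\<bar>flat 2 x\<bar> \<le> max B 0" if "x \<le> 1" for x
  proof (cases "0 \<le> x")
    case True
    then have "\<bar>flat 2 x\<bar> \<le> B" using B that by auto
    then show ?thesis by simp
  qed (simp add: flat_def)
  have "exp_approximation p (\<bar>p\<bar> * exp 1 + exp 1 * max B 0) (- p) (exp_cutoff' p)"
  proof
    fix n
    show "exp_cutoff' p n \<in> borel_measurable borel" unfolding exp_cutoff'_def[abs_def] by measurable
    fix t :: real assume t: "0 \<le> t"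
    let ?x = "1 - t / real (Suc n)"
    have "\<bar>exp_cutoff' p n t\<bar> = exp (- p * t) * \<bar>- p * (exp 1 * flat 0 ?x) - exp 1 * flat 2 ?x / real (Suc n)\<bar>"
      by (simp add: exp_cutoff'_def abs_mult del: of_nat_Suc)
    also have "\<bar>- p * (exp 1 * flat 0 ?x) - exp 1 * flat 2 ?x / real (Suc n)\<bar>
        \<le> \<bar>p\<bar> * (exp 1 * \<bar>flat 0 ?x\<bar>) + exp 1 * \<bar>flat 2 ?x\<bar> / real (Suc n)"
      by (rule order_trans[OF abs_triangle_ineq4]) (simp add: abs_mult del: of_nat_Suc)
    also have "\<dots> \<le> \<bar>p\<bar> * (exp 1 * 1) + exp 1 * max B 0 / 1"
      using t by (intro add_mono mult_left_mono frac_le mult_nonneg_nonneg B') (auto simp: flat0_bounds)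
    finally show "\<bar>exp_cutoff' p n t\<bar> \<le> (\<bar>p\<bar> * exp 1 + exp 1 * max B 0) * exp (- p * t)"
      by (simp add: mult.commute)
  next
    fix t :: real
    have "(\<lambda>n. exp (- p * t) * (- p * (exp 1 * flat 0 (1 - t / real (Suc n)))
      - exp 1 * flat 2 (1 - t / real (Suc n)) * inverse (real (Suc n))))
      \<longlonglongrightarrow> exp (- p * t) * (- p * (exp 1 * flat 0 1) - exp 1 * flat 2 1 * 0)"
      by (intro tendsto_intros flat_tendsto cutoff_arg_tendsto LIMSEQ_inverse_real_of_nat)
    then show "(\<lambda>n. exp_cutoff' p n t) \<longlonglongrightarrow> - p * exp (- p * t)"
      by (simp add: exp_cutoff'_def flat0_one divide_inverse mult.commute)
  qed
  then show ?thesis using that by blast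
qed

text \<open>
  Finiteness comes from comparison with the Gamma integral at \<open>p = 1\<close>, positivity
  from the contribution of the interval \<open>[1, 2]\<close>.
\<close>

lemma power_kernel:
  assumes a: "0 < a" "a < 1" and p: "1 \<le> p"
  shows "pos_part_time (\<lambda>t. 1 / t powr a) \<in> borel_measurable borel"
    and "laplaceable (\<lambda>t. 1 / t powr a) p" and "0 < laplace (\<lambda>t. 1 / t powr a) p"
proof -
  let ?k = "\<lambda>t::real. 1 / t powr a"
  show m [measurable]: "pos_part_time ?k \<in> borel_measurable borel"
    by (rule pos_part_time_borel) (auto intro!: continuous_intros)
  have g: "integrable lborel (\<lambda>t. indicator {0..} t * t powr (1 - a - 1) / exp t)"
  proof (rule integrableI_nonneg)
    show "(\<integral>\<^sup>+ t. ennreal (indicator {0..} t * t powr (1 - a - 1) / exp t) \<partial>lborel) < \<infinity>"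
      using a by (subst Gamma_conv_nn_integral_real[symmetric]) auto
  qed (auto simp: indicator_def)
  show l: "laplaceable ?k p"
    unfolding laplace_lborel(2)[OF m]
  proof (rule Bochner_Integration.integrable_bound[OF g])
    show "AE t in lborel. norm (pos_part_time ?k t * exp (- p * t)) \<le> norm (indicator {0..} t * t powr (1 - a - 1) / exp t)"
    proof (rule AE_I2)
      fix t :: real
      show "norm (pos_part_time ?k t * exp (- p * t)) \<le> norm (indicator {0..} t * t powr (1 - a - 1) / exp t)"
      proof (cases "0 < t")
        case True
        then have "exp (- p * t) \<le> exp (- t)" using p by simp
        then have "t powr (- a) * exp (- p * t) \<le> t powr (- a) * exp (- t)" by (intro mult_left_mono) auto
        then show ?thesis using True by (simp add: pos_part_time_def powr_minus_divide exp_minus divide_inverse)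
      qed (simp add: pos_part_time_def)
    qed
  qed simp
  have "(LINT t|lborel. indicator {1..2::real} t * (exp (- p * 2) / 2 powr a) :: real) \<le> (LINT t|lborel. pos_part_time ?k t * exp (- p * t))"
  proof (rule integral_mono)
    show "integrable lborel (\<lambda>t. pos_part_time ?k t * exp (- p * t))"
      using l unfolding laplace_lborel(2)[OF m] .
    show "integrable lborel (\<lambda>t::real. indicator {1..2} t * (exp (- p * 2) / 2 powr a) :: real)" by simp
    fix t :: real
    show "indicator {1..2} t * (exp (- p * 2) / 2 powr a) \<le> pos_part_time ?k t * exp (- p * t)"
    proof (cases "t \<in> {1..2}")
      case True
      then have "exp (- p * 2) / 2 powr a \<le> exp (- p * t) / t powr a"
        using a p by (intro frac_le powr_mono2) auto
      then show ?thesis using True by (simp add: pos_part_time_def)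
    qed (simp add: pos_part_time_def)
  qed
  moreover have "0 < (LINT t|lborel. indicator {1..2::real} t * (exp (- p * 2) / 2 powr a) :: real)" by simp
  ultimately show "0 < laplace ?k p" unfolding laplace_lborel(1)[OF m] by linarith
qed

lemma laplaceable_mono:
  assumes "laplaceable f p" "p \<le> q" shows "laplaceable f q"
proof -
  have int: "integrable lebesgue (\<lambda>t. indicator {0..} t * (f t * exp (- p * t)))"
    using assms(1) by (simp add: laplaceable_def set_integrable_def)
  have e: "indicator {0..} t * (f t * exp (- q * t)) = exp (- (q - p) * t) * (indicator {0..} t * (f t * exp (- p * t)))" for t
    by (simp add: exp_add[symmetric] algebra_simps)
  have "integrable lebesgue (\<lambda>t. indicator {0..} t * (f t * exp (- q * t)))"
  proof (rule Bochner_Integration.integrable_bound[OF int])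
    show "(\<lambda>t. indicator {0..} t * (f t * exp (- q * t))) \<in> borel_measurable lebesgue"
      unfolding e by (intro borel_measurable_times[OF measurable_completion borel_measurable_integrable[OF int]]) measurable
    show "AE t in lebesgue. norm (indicator {0..} t * (f t * exp (- q * t))) \<le> norm (indicator {0..} t * (f t * exp (- p * t)))"
    proof (rule AE_I2)
      fix t :: real
      have "0 \<le> t \<Longrightarrow> exp (- q * t) \<le> exp (- p * t)" using assms(2) by (simp add: mult_right_mono)
      then show "norm (indicator {0..} t * (f t * exp (- q * t))) \<le> norm (indicator {0..} t * (f t * exp (- p * t)))"
        by (cases "0 \<le> t") (auto simp: abs_mult intro: mult_left_mono)
    qed
  qed
  then show ?thesis by (simp add: laplaceable_def set_integrable_def)
qed

text \<open>
  With \<open>y = exp (- t)\<close>, the values of the transform at \<open>M, M + 1, \<dots>\<close> are the moments of a finite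
  signed measure on \<open>[0, 1]\<close>. As they vanish, Weierstrass approximation shows that the integral of
  every continuous function of \<open>y\<close> vanishes. A tent function concentrated near \<open>exp (- t0)\<close> on which
  \<open>f\<close> has constant sign then gives a contradiction.
\<close>

lemma Lerch:
  assumes cont: "continuous_on {0<..} f" and lap: "laplaceable f M" and zero: "\<And>p. M \<le> p \<Longrightarrow> laplace f p = 0"
    and t0: "0 < t0"
  shows "f t0 = 0"
proof (rule ccontr)
  assume ne: "f t0 \<noteq> 0"
  let ?f = "pos_part_time f"
  have m [measurable]: "?f \<in> borel_measurable borel" by (rule pos_part_time_borel[OF cont])
  define g where "g t = ?f t * exp (- M * t)" for t
  have g: "integrable lborel g" using lap unfolding laplace_lborel(2)[OF m] g_def .
  have g_neg: "g t = 0" if "t \<le> 0" for t using that by (simp add: g_def pos_part_time_def)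
  have [measurable]: "g \<in> borel_measurable borel" using g by auto
  have bnd: "integrable lborel (\<lambda>t. g t * q (exp (- t)))"
    if [measurable]: "q \<in> borel_measurable borel" and B: "\<And>x. 0 \<le> x \<Longrightarrow> x \<le> 1 \<Longrightarrow> \<bar>q x\<bar> \<le> B" for q B
  proof (rule Bochner_Integration.integrable_bound[OF integrable_mult_left[OF g, of B]])
    have "\<bar>g t\<bar> * \<bar>q (exp (- t))\<bar> \<le> \<bar>g t\<bar> * \<bar>B\<bar>" for t
      using B[of "exp (- t)"] g_neg[of t] by (cases "t \<le> 0") (auto intro!: mult_left_mono)
    then show "AE t in lborel. norm (g t * q (exp (- t))) \<le> norm (g t * B)" by (auto simp: abs_mult)
  qed measurable
  have mono: "(LINT t|lborel. g t * exp (- t) ^ k) = 0" for k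
  proof -
    have "g t * exp (- t) ^ k = ?f t * exp (- (M + real k) * t)" for t
      by (simp add: g_def exp_of_nat_mult[symmetric] exp_add[symmetric] algebra_simps)
    then show ?thesis using zero[of "M + real k"] by (simp add: laplace_lborel(1)[OF m])
  qed
  have poly: "(LINT t|lborel. g t * (\<Sum>i\<le>n. a i * exp (- t) ^ i)) = 0" for a :: "nat \<Rightarrow> real" and n
  proof -
    have i: "integrable lborel (\<lambda>t. g t * exp (- t) ^ k)" for k
      by (rule bnd[of "\<lambda>x. x ^ k" 1]) (auto simp: abs_mult power_le_one)
    have "(LINT t|lborel. g t * (\<Sum>i\<le>n. a i * exp (- t) ^ i)) = (LINT t|lborel. (\<Sum>i\<le>n. a i * (g t * exp (- t) ^ i)))"
      by (simp add: sum_distrib_left mult.left_commute)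
    also have "\<dots> = (\<Sum>i\<le>n. a i * (LINT t|lborel. g t * exp (- t) ^ i))"
      by (subst Bochner_Integration.integral_sum) (use i in auto)
    finally show ?thesis by (simp add: mono)
  qed
  define q0 where "q0 d y = max 0 (d - \<bar>y - exp (- t0)\<bar>)" for d y :: real
  have cq0: "continuous_on A (q0 d)" for A d unfolding q0_def[abs_def] by (intro continuous_intros)
  then have [measurable]: "q0 d \<in> borel_measurable borel" for d by (intro borel_measurable_continuous_onI)
  have q0_bound: "\<bar>q0 d y\<bar> \<le> \<bar>d\<bar>" for d y by (auto simp: q0_def)
  have int_q0: "integrable lborel (\<lambda>t. g t * q0 d (exp (- t)))" for d
    by (rule bnd[of _ "\<bar>d\<bar>"]) (use q0_bound in auto)
  have zero_q0: "(LINT t|lborel. g t * q0 d (exp (- t))) = 0" for d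
  proof -
    let ?I = "LINT t|lborel. g t * q0 d (exp (- t))" and ?N = "LINT t|lborel. \<bar>g t\<bar>"
    have "\<bar>?I\<bar> \<le> e * ?N" if e: "0 < e" for e
    proof -
      obtain h where h: "real_polynomial_function h" "\<And>x. x \<in> {0..1} \<Longrightarrow> \<bar>q0 d x - h x\<bar> < e"
        by (rule Stone_Weierstrass_real_polynomial_function[OF compact_Icc[of 0 1] cq0[of _ d] e]) (rule that)
      then obtain a n where hp: "h = (\<lambda>x. \<Sum>i\<le>n. a i * x ^ i)" by (auto simp: real_polynomial_function_iff_sum)
      have [measurable]: "h \<in> borel_measurable borel" unfolding hp by measurable
      have hb: "\<bar>h x\<bar> \<le> \<bar>d\<bar> + e" if "0 \<le> x" "x \<le> 1" for x
        using h(2)[of x] q0_bound[of d x] that by auto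
      have ih: "integrable lborel (\<lambda>t. g t * h (exp (- t)))" by (rule bnd[of h "\<bar>d\<bar> + e"]) (use hb in auto)
      have "(LINT t|lborel. g t * h (exp (- t))) = 0" unfolding hp by (rule poly)
      then have "?I = (LINT t|lborel. g t * q0 d (exp (- t)) - g t * h (exp (- t)))"
        using int_q0 ih by simp
      also have "\<bar>\<dots>\<bar> \<le> (LINT t|lborel. \<bar>g t * q0 d (exp (- t)) - g t * h (exp (- t))\<bar>)"
        by (rule integral_abs_bound)
      also have "\<dots> \<le> (LINT t|lborel. e * \<bar>g t\<bar>)"
      proof (rule integral_mono)
        show "integrable lborel (\<lambda>t. \<bar>g t * q0 d (exp (- t)) - g t * h (exp (- t))\<bar>)"
          using int_q0 ih by (intro integrable_abs Bochner_Integration.integrable_diff)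
        show "integrable lborel (\<lambda>t. e * \<bar>g t\<bar>)" using g by simp
        fix t
        have "\<bar>g t\<bar> * \<bar>q0 d (exp (- t)) - h (exp (- t))\<bar> \<le> \<bar>g t\<bar> * e"
          using h(2)[of "exp (- t)"] g_neg[of t] by (cases "t \<le> 0") (auto intro!: mult_left_mono)
        then show "\<bar>g t * q0 d (exp (- t)) - g t * h (exp (- t))\<bar> \<le> e * \<bar>g t\<bar>"
          by (simp add: abs_mult[symmetric] right_diff_distrib mult.commute[of e])
      qed
      finally show ?thesis by simp
    qed
    then have ev: "\<forall>\<^sub>F e in at_right 0. \<bar>?I\<bar> \<le> e * ?N"
      by (intro eventually_at_rightI[of 0 1]) auto
    have "((\<lambda>e. e * ?N) \<longlongrightarrow> 0 * ?N) (at_right 0)"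
      by (rule tendsto_mult_right, rule tendsto_ident_at)
    from tendsto_lowerbound[OF this ev] have "\<bar>?I\<bar> \<le> 0 * ?N" by simp
    then show ?thesis by simp
  qed
  have "isCont f t0" using cont t0 by (simp add: continuous_on_eq_continuous_at)
  then obtain r where r: "0 < r" "\<And>t. \<bar>t - t0\<bar> < r \<Longrightarrow> \<bar>f t - f t0\<bar> < \<bar>f t0\<bar> / 2"
    using ne unfolding continuous_at_eps_delta dist_real_def by (metis half_gt_zero zero_less_abs_iff)
  define r' where "r' = min r t0"
  have r': "0 < r'" using r t0 by (simp add: r'_def)
  (* The largest tent whose support stays within distance r' of t0 in the variable t. *)
  define d where "d = min (exp (- (t0 - r')) - exp (- t0)) (exp (- t0) - exp (- (t0 + r')))"
  have d: "0 < d" using r' by (simp add: d_def)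
  have supp: "\<bar>t - t0\<bar> < r'" if "q0 d (exp (- t)) \<noteq> 0" for t
  proof -
    have "\<bar>exp (- t) - exp (- t0)\<bar> < d" using that by (auto simp: q0_def max_def split: if_splits)
    moreover have "d \<le> exp (- (t0 - r')) - exp (- t0)" "d \<le> exp (- t0) - exp (- (t0 + r'))"
      unfolding d_def by (rule min.cobounded1, rule min.cobounded2)
    ultimately have "exp (- t) < exp (- (t0 - r'))" "exp (- (t0 + r')) < exp (- t)" by linarith+
    then show ?thesis by auto
  qed
  let ?h = "\<lambda>t. sgn (f t0) * (g t * q0 d (exp (- t)))"
  have sg: "\<bar>f t0\<bar> / 2 < sgn (f t0) * f t" if "\<bar>t - t0\<bar> < r'" for t
    using r(2)[of t] that ne by (auto simp: r'_def sgn_if abs_if split: if_splits)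
  have nonneg: "0 \<le> ?h t" for t
  proof (cases "q0 d (exp (- t)) = 0")
    case False
    then have "\<bar>t - t0\<bar> < r'" by (rule supp)
    then have pos: "0 < sgn (f t0) * f t" and "0 < t" using sg[of t] ne by (auto simp: r'_def)
    have "0 \<le> exp (- M * t) * q0 d (exp (- t))" by (simp add: q0_def)
    then have "0 \<le> (sgn (f t0) * f t) * (exp (- M * t) * q0 d (exp (- t)))"
      by (rule mult_nonneg_nonneg[OF less_imp_le[OF pos]])
    then show ?thesis using \<open>0 < t\<close> by (simp add: g_def pos_part_time_def algebra_simps)
  qed simp
  have "(LINT t|lborel. ?h t) = 0" using zero_q0[of d] by simp
  then have "AE t in lborel. ?h t = 0"
    using int_q0[of d] nonneg by (subst (asm) integral_nonneg_eq_0_iff_AE) auto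
  moreover have "isCont ?h t0"
  proof -
    have "continuous_on {0<..} (\<lambda>t. sgn (f t0) * (f t * exp (- M * t) * q0 d (exp (- t))))"
      unfolding q0_def by (intro continuous_intros cont)
    also have "?this \<longleftrightarrow> continuous_on {0<..} ?h"
      by (rule continuous_on_cong) (auto simp: g_def pos_part_time_def)
    finally show ?thesis using t0 by (simp add: continuous_on_eq_continuous_at)
  qed
  moreover have "?h t0 \<noteq> 0" using ne d t0 by (simp add: g_def pos_part_time_def q0_def sgn_if)
  ultimately show False
  proof -
    assume ae: "AE t in lborel. ?h t = 0" and c: "isCont ?h t0" and n: "?h t0 \<noteq> 0"
    obtain \<delta> where \<delta>: "0 < \<delta>" "\<And>t. \<bar>t - t0\<bar> < \<delta> \<Longrightarrow> ?h t \<noteq> 0"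
      using continuous_at_avoid[OF c n] by (auto simp: dist_real_def abs_minus_commute)
    have "t \<notin> {t0 - \<delta> <..< t0 + \<delta>}" if h0: "?h t = 0" for t
    proof
      assume "t \<in> {t0 - \<delta> <..< t0 + \<delta>}"
      then have "\<bar>t - t0\<bar> < \<delta>" by auto
      from \<delta>(2)[OF this] h0 show False by blast
    qed
    note away = this
    have "AE t in lborel. t \<notin> {t0 - \<delta> <..< t0 + \<delta>}"
      using ae by eventually_elim (rule away)
    then have "emeasure lborel {t0 - \<delta> <..< t0 + \<delta>} = 0"
      by (subst (asm) AE_iff_measurable[of "{t0 - \<delta> <..< t0 + \<delta>}"]) auto
    then show False using \<delta> by simp
  qed
qed

section \<open>Solenoidal vector fields\<close>

context bounded_open_set
begin

lemma H10_H1: "f \<in> H10 \<Omega> \<Longrightarrow> f \<in> H1 \<Omega>"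
  by (simp add: H10_def)

lemma H10_vecD:
  assumes "u \<in> H10_vec \<Omega>"
  shows "(\<lambda>x. u x $ i) \<in> H1 \<Omega>" "u \<in> L2 \<Omega>" "grad u \<in> L2 \<Omega>"
proof -
  show H1: "(\<lambda>x. u x $ i) \<in> H1 \<Omega>" for i using assms by (auto simp: H10_vec_def intro: H10_H1)
  show "u \<in> L2 \<Omega>" by (simp add: L2_vec_iff H1D(1)[OF H1])
  have "(\<lambda>x. grad u x $ i $ j) \<in> L2 \<Omega>" for i j
    using H1D(2)[OF H1] by (simp add: wgrad_def)
  then show "grad u \<in> L2 \<Omega>" by (simp add: L2_vec_iff)
qed

lemma wgrad_add:
  assumes "u \<in> H10_vec \<Omega>" "v \<in> H10_vec \<Omega>"
  shows "AE x in lebesgue_on \<Omega>. grad (\<lambda>x. u x + v x) x = grad u x + grad v x"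
proof -
  have "AE x in lebesgue_on \<Omega>. \<forall>i\<in>UNIV. \<forall>j\<in>UNIV. wpd \<Omega> j (\<lambda>x. u x $ i + v x $ i) x = wpd \<Omega> j (\<lambda>x. u x $ i) x + wpd \<Omega> j (\<lambda>x. v x $ i) x"
    by (intro AE_finite_allI H1_add(2) H10_vecD(1) assms) auto
  then show ?thesis by eventually_elim (simp add: wgrad_def vec_eq_iff)
qed

lemma wgrad_scale:
  assumes "u \<in> H10_vec \<Omega>"
  shows "AE x in lebesgue_on \<Omega>. grad (\<lambda>x. c *\<^sub>R u x) x = c *\<^sub>R grad u x"
proof -
  have "AE x in lebesgue_on \<Omega>. \<forall>i\<in>UNIV. \<forall>j\<in>UNIV. wpd \<Omega> j (\<lambda>x. c *\<^sub>R u x $ i) x = c *\<^sub>R wpd \<Omega> j (\<lambda>x. u x $ i) x"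
    by (intro AE_finite_allI H1_scale(2) H10_vecD(1) assms) auto
  then show ?thesis by eventually_elim (simp add: wgrad_def vec_eq_iff)
qed

lemma V_H10_vec: "u \<in> V \<Omega> \<Longrightarrow> u \<in> H10_vec \<Omega>"
  by (simp add: V_def)

lemma V_add:
  assumes "u \<in> V \<Omega>" "v \<in> V \<Omega>" shows "(\<lambda>x. u x + v x) \<in> V \<Omega>"
proof -
  have "(\<lambda>x. u x + v x) \<in> H10_vec \<Omega>"
    using assms by (auto simp: V_def H10_vec_def intro: H10_add)
  moreover have "div_free \<Omega> (\<lambda>x. u x + v x)"
  proof -
    have "AE x in lebesgue_on \<Omega>. (\<Sum>i\<in>UNIV. grad u x $ i $ i) = 0" "AE x in lebesgue_on \<Omega>. (\<Sum>i\<in>UNIV. grad v x $ i $ i) = 0"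
      using assms by (auto simp: V_def div_free_def)
    then show ?thesis unfolding div_free_def using wgrad_add[OF assms[THEN V_H10_vec]]
      by eventually_elim (simp add: sum.distrib)
  qed
  ultimately show ?thesis by (simp add: V_def)
qed

lemma V_scale:
  assumes "u \<in> V \<Omega>" shows "(\<lambda>x. c *\<^sub>R u x) \<in> V \<Omega>"
proof -
  have "(\<lambda>x. c *\<^sub>R u x) \<in> H10_vec \<Omega>"
    using assms H10_scale[of "\<lambda>x. u x $ i" c for i] by (auto simp: V_def H10_vec_def)
  moreover have "div_free \<Omega> (\<lambda>x. c *\<^sub>R u x)"
  proof -
    have "AE x in lebesgue_on \<Omega>. (\<Sum>i\<in>UNIV. grad u x $ i $ i) = 0"
      using assms by (auto simp: V_def div_free_def)
    then show ?thesis unfolding div_free_def using wgrad_scale[OF assms[THEN V_H10_vec], of c]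
      by eventually_elim (simp add: sum_distrib_left[symmetric])
  qed
  ultimately show ?thesis by (simp add: V_def)
qed

lemma V_zero: "(\<lambda>x. 0) \<in> V \<Omega>"
proof -
  have "(\<lambda>x::pt. 0::real) \<in> Cc_inf \<Omega>" by (auto simp: Cc_inf_def intro!: Ck_const exI[of _ "{}"])
  then have "(\<lambda>x::pt. 0::real) \<in> H10 \<Omega>"
    unfolding H10_iff using Cc_inf_H1(1)
  proof (intro conjI exI[of _ "\<lambda>n x. 0"] allI)
    fix j
    assume 0: "(\<lambda>x::pt. 0::real) \<in> Cc_inf \<Omega>"
    have "norm2 (\<lambda>x. wpd \<Omega> j (\<lambda>x. 0) x - pd j (\<lambda>x. 0) x) = norm2 (\<lambda>x. 0 :: real)"
    proof (rule L2_norm_cong)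
      show "AE x in lebesgue_on \<Omega>. wpd \<Omega> j (\<lambda>x. 0) x - pd j (\<lambda>x. 0) x = 0"
        using Cc_inf_H1(2)[OF 0, of j] by eventually_elim simp
    qed (intro L2_diff L2_zero H1D[OF Cc_inf_H1(1)[OF 0]] Cc_inf_L2 Cc_inf_pd 0)+
    then show "(\<lambda>n. norm2 (\<lambda>x. wpd \<Omega> j (\<lambda>x. 0) x - pd j (\<lambda>x. 0) x)) \<longlonglongrightarrow> 0"
      by (simp add: L2_norm_def L2_inner_eq)
  qed (auto simp: L2_norm_def L2_inner_eq)
  then have 0: "(\<lambda>x. 0) \<in> H10_vec \<Omega>" by (simp add: H10_vec_def)
  have "div_free \<Omega> (\<lambda>x. 0)"
    unfolding div_free_def using wgrad_scale[OF 0, of 0] by eventually_elim simp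
  with 0 show ?thesis by (simp add: V_def)
qed

lemma V_sum:
  assumes "finite A" "\<And>y. y \<in> A \<Longrightarrow> f y \<in> V \<Omega>"
  shows "(\<lambda>x. \<Sum>y\<in>A. f y x) \<in> V \<Omega>"
  using assms by (induction A rule: finite_induct) (auto intro: V_zero V_add)

lemma V_diff:
  assumes "u \<in> V \<Omega>" "v \<in> V \<Omega>" shows "(\<lambda>x. u x - v x) \<in> V \<Omega>"
  using V_add[OF assms(1) V_scale[OF assms(2), of "-1"]] by simp

lemma V_norm_eq: "u \<in> V \<Omega> \<Longrightarrow> Vnorm u = norm2 (grad u)"
  using H10_vecD(3)[OF V_H10_vec, of u]
  by (simp add: V_norm_def V_inner_def L2_norm_def L2_inner_vec L2_vec_iff) (simp add: L2_inner_def)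

lemma V_norm_nonneg: "0 \<le> Vnorm u"
  unfolding V_norm_def V_inner_def
  by (auto intro!: sum_nonneg integral_nonneg_AE simp: set_lebesgue_integral_def)

lemma V_norm_triangle:
  assumes "u \<in> V \<Omega>" "v \<in> V \<Omega>"
  shows "Vnorm (\<lambda>x. u x + v x) \<le> Vnorm u + Vnorm v"
proof -
  note L = H10_vecD(3)[OF V_H10_vec]
  have "Vnorm (\<lambda>x. u x + v x) = norm2 (\<lambda>x. grad u x + grad v x)"
    unfolding V_norm_eq[OF V_add[OF assms]]
    by (rule L2_norm_cong[OF wgrad_add]) (auto intro!: V_H10_vec assms L V_add L2_add)
  then show ?thesis using L2_norm_triangle[OF L[OF assms(1)] L[OF assms(2)]] by (simp add: V_norm_eq assms)
qed

lemma V_norm_scale: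
  assumes "u \<in> V \<Omega>" shows "Vnorm (\<lambda>x. c *\<^sub>R u x) = \<bar>c\<bar> * Vnorm u"
proof -
  note L = H10_vecD(3)[OF V_H10_vec]
  have "Vnorm (\<lambda>x. c *\<^sub>R u x) = norm2 (\<lambda>x. c *\<^sub>R grad u x)"
    unfolding V_norm_eq[OF V_scale[OF assms]]
    by (rule L2_norm_cong[OF wgrad_scale]) (auto intro!: V_H10_vec assms L V_scale L2_scaleR)
  then show ?thesis by (simp add: V_norm_eq assms L2_norm_scaleR)
qed

lemma V_norm_zero: "Vnorm (\<lambda>x. 0) = 0"
  using V_norm_scale[OF V_zero, of 0] by simp

lemma V_norm_minus_commute:
  assumes "u \<in> V \<Omega>" "v \<in> V \<Omega>" shows "Vdist u v = Vdist v u"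
  using V_norm_scale[OF V_diff[OF assms(2,1)], of "-1"] by simp

lemma V_norm_triangle_diff:
  assumes "u \<in> V \<Omega>" "v \<in> V \<Omega>"
  shows "Vdist u v \<le> Vnorm u + Vnorm v"
  using V_norm_triangle[OF assms(1) V_scale[OF assms(2), of "-1"]] V_norm_scale[OF assms(2), of "-1"] by simp

lemma V_norm_triangle_sub:
  assumes "u \<in> V \<Omega>" "v \<in> V \<Omega>" "w \<in> V \<Omega>"
  shows "Vdist u w \<le> Vdist u v + Vdist v w"
  using V_norm_triangle[OF V_diff[OF assms(1,2)] V_diff[OF assms(2,3)]] by simp

text \<open>
  By this inequality pairing with an \<open>L\<^sup>2\<close> field is a bounded functional for the gradient norm, in
  which a velocity is strongly measurable and has a Laplace transform.
\<close>

lemma Poincare_V: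
  obtains C where "0 \<le> C" "\<And>u. u \<in> V \<Omega> \<Longrightarrow> norm2 u \<le> C * Vnorm u"
proof -
  obtain R0 where R0: "\<And>x. x \<in> \<Omega> \<Longrightarrow> norm x \<le> R0" using bounded_\<Omega> by (auto simp: bounded_iff)
  define R where "R = max R0 0"
  have R: "\<And>x. x \<in> \<Omega> \<Longrightarrow> norm x \<le> R" "0 \<le> R" using R0 by (fastforce simp: R_def)+
  have "norm2 u \<le> (3 * (2 * R)) * Vnorm u" if u: "u \<in> V \<Omega>" for u
  proof -
    have "norm2 (\<lambda>x. u x $ i) \<le> 2 * R * Vnorm u" for i
    proof -
      have "(\<lambda>x. u x $ i) \<in> H10 \<Omega>" using u by (auto simp: V_def H10_vec_def)
      then have "norm2 (\<lambda>x. u x $ i) \<le> 2 * R * norm2 (wpd \<Omega> 1 (\<lambda>x. u x $ i))"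
        by (rule Poincare_H10[OF _ R(1)])
      also have "\<dots> \<le> 2 * R * Vnorm u"
      proof (rule mult_left_mono)
        have g: "grad u \<in> L2 \<Omega>" by (rule H10_vecD(3)[OF V_H10_vec[OF u]])
        then have "norm2 (\<lambda>x. grad u x $ i $ 1) \<le> norm2 (\<lambda>x. grad u x $ i)"
          by (intro L2_norm_component_le) (simp add: L2_vec_iff)
        also have "\<dots> \<le> norm2 (grad u)" by (rule L2_norm_component_le[OF g])
        finally show "norm2 (wpd \<Omega> 1 (\<lambda>x. u x $ i)) \<le> Vnorm u"
          by (simp add: V_norm_eq u) (simp add: wgrad_def)
      qed (use R in auto)
      finally show ?thesis .
    qed
    note comp = this
    have u2: "u \<in> L2 \<Omega>" by (rule H10_vecD(2)[OF V_H10_vec[OF u]])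
    have "norm2 u = L2_set (\<lambda>i. norm2 (\<lambda>x. u x $ i)) UNIV"
      by (simp add: L2_set_def L2_norm_squared) (simp add: L2_norm_def L2_inner_vec u2)
    also have "\<dots> \<le> (\<Sum>i\<in>UNIV. norm2 (\<lambda>x. u x $ i))" by (rule L2_set_le_sum) simp
    also have "\<dots> \<le> (\<Sum>i\<in>(UNIV :: 3 set). 2 * R * Vnorm u)" by (rule sum_mono) (rule comp)
    finally show ?thesis by simp
  qed
  then show ?thesis using that[of "3 * (2 * R)"] R(2) by simp
qed

text \<open>
  Twice the symmetric gradient.
\<close>

definition sgrad :: "vfield \<Rightarrow> mfield" where
  "sgrad u x = grad u x + transpose (grad u x)"

lemma inner_transpose: "transpose (A :: real^3^3) \<bullet> transpose B = A \<bullet> B"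
  unfolding inner_vec_def transpose_def by (simp, subst sum.swap) simp

lemma transpose_L2:
  assumes "A \<in> L2 \<Omega>" shows "(\<lambda>x. transpose (A x) :: real^3^3) \<in> L2 \<Omega>"
  using assms by (simp add: L2_vec_iff transpose_def)

lemma L2_norm_transpose: "norm2 (\<lambda>x. transpose (A x) :: real^3^3) = norm2 A"
  by (simp add: L2_norm_def L2_inner_eq inner_transpose)

lemma sgrad_L2: "u \<in> V \<Omega> \<Longrightarrow> sgrad u \<in> L2 \<Omega>"
  unfolding sgrad_def[abs_def] by (intro L2_add transpose_L2 H10_vecD(3) V_H10_vec)

text \<open>
  \<open>2 (A + A\<^sup>T) : A = \<bar>A + A\<^sup>T\<bar>\<^sup>2\<close>, since transposition is an isometry.
\<close>

lemma sgrad_coercive: assumes "u \<in> V \<Omega>" shows "0 \<le> ip (sgrad u) (grad u)"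
proof -
  have "2 * ((A + transpose A) \<bullet> A) = (A + transpose A) \<bullet> (A + transpose A)" for A :: "real^3^3"
    using inner_transpose[of A A] by (simp add: inner_add_left inner_add_right inner_commute)
  then have "0 \<le> (A + transpose A) \<bullet> A" for A :: "real^3^3"
    by (metis inner_ge_zero zero_le_mult_iff zero_less_numeral not_less)
  then show ?thesis by (simp add: L2_inner_eq sgrad_def)
qed

text \<open>
  A bounded linear functional on \<open>V\<close> for the gradient norm, with an explicit bound. An approximate
  Laplace transform is tested with functionals that depend on it, so they are quantified.
\<close>

definition V_functional :: "(vfield \<Rightarrow> real) \<Rightarrow> real \<Rightarrow> bool" where
  "V_functional l C \<longleftrightarrow> 0 \<le> C \<and> (\<forall>u\<in>V \<Omega>. \<forall>v\<in>V \<Omega>. l (\<lambda>x. u x + v x) = l u + l v) \<and>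
     (\<forall>c. \<forall>u\<in>V \<Omega>. l (\<lambda>x. c *\<^sub>R u x) = c * l u) \<and> (\<forall>u\<in>V \<Omega>. \<bar>l u\<bar> \<le> C * Vnorm u)"

lemma V_functional_wgrad:
  assumes A: "A \<in> L2 \<Omega>"
  shows "V_functional (\<lambda>u. ip (grad u) A) (norm2 A)"
  unfolding V_functional_def
proof (intro conjI ballI allI)
  note L = H10_vecD(3)[OF V_H10_vec]
  fix u v assume u: "u \<in> V \<Omega>" and v: "v \<in> V \<Omega>"
  have "ip (grad (\<lambda>x. u x + v x)) A = ip (\<lambda>x. grad u x + grad v x) A"
    by (rule L2_inner_cong[OF wgrad_add]) (auto intro!: V_H10_vec u v A L V_add L2_add)
  then show "ip (grad (\<lambda>x. u x + v x)) A = ip (grad u) A + ip (grad v) A"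
    by (simp add: L2_inner_add_left L u v A)
next
  note L = H10_vecD(3)[OF V_H10_vec]
  fix c u assume u: "u \<in> V \<Omega>"
  have "ip (grad (\<lambda>x. c *\<^sub>R u x)) A = ip (\<lambda>x. c *\<^sub>R grad u x) A"
    by (rule L2_inner_cong[OF wgrad_scale]) (auto intro!: V_H10_vec u A L V_scale L2_scaleR)
  then show "ip (grad (\<lambda>x. c *\<^sub>R u x)) A = c * ip (grad u) A"
    by (simp add: L2_inner_scaleR_left)
next
  fix u assume u: "u \<in> V \<Omega>"
  show "\<bar>ip (grad u) A\<bar> \<le> norm2 A * Vnorm u"
    using L2_Cauchy_Schwarz[OF H10_vecD(3)[OF V_H10_vec[OF u]] A] by (simp add: V_norm_eq[OF u] mult.commute)
qed simp

lemma sgrad_inner: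
  assumes u: "u \<in> V \<Omega>" and A: "A \<in> L2 \<Omega>"
  shows "ip (sgrad u) A = ip (grad u) (\<lambda>x. A x + transpose (A x))"
proof -
  have g: "grad u \<in> L2 \<Omega>" by (rule H10_vecD(3)[OF V_H10_vec[OF u]])
  have "transpose (grad u x) \<bullet> A x = grad u x \<bullet> transpose (A x)" for x
    using inner_transpose[of "grad u x" "transpose (A x)"] by simp
  then show ?thesis unfolding sgrad_def[abs_def]
    by (simp add: L2_inner_eq inner_add_left inner_add_right)
qed

lemma V_functional_sgrad:
  assumes A: "A \<in> L2 \<Omega>"
  shows "V_functional (\<lambda>u. ip (sgrad u) A) (2 * norm2 A)"
proof -
  have A': "(\<lambda>x. A x + transpose (A x)) \<in> L2 \<Omega>" by (intro L2_add A transpose_L2)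
  have n: "norm2 (\<lambda>x. A x + transpose (A x)) \<le> 2 * norm2 A"
    using L2_norm_triangle[OF A transpose_L2[OF A]] by (simp add: L2_norm_transpose)
  show ?thesis using V_functional_wgrad[OF A'] unfolding V_functional_def
    by (auto simp: sgrad_inner A V_add V_scale intro: order_trans[OF _ mult_right_mono[OF n V_norm_nonneg]])
qed

lemma V_functional_L2:
  assumes C: "0 \<le> C" "\<And>u. u \<in> V \<Omega> \<Longrightarrow> norm2 u \<le> C * Vnorm u" and f: "f \<in> L2 \<Omega>"
  shows "V_functional (\<lambda>u. ip u f) (C * norm2 f)"
  unfolding V_functional_def
proof (intro conjI ballI allI)
  note L = H10_vecD(2)[OF V_H10_vec]
  fix u assume u: "u \<in> V \<Omega>"
  show "ip (\<lambda>x. u x + v x) f = ip u f + ip v f" if "v \<in> V \<Omega>" for v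
    by (intro L2_inner_add_left L u that f)
  show "ip (\<lambda>x. c *\<^sub>R u x) f = c * ip u f" for c by (rule L2_inner_scaleR_left)
  have "\<bar>ip u f\<bar> \<le> norm2 u * norm2 f" by (rule L2_Cauchy_Schwarz[OF L[OF u] f])
  also have "\<dots> \<le> (C * Vnorm u) * norm2 f" by (intro mult_right_mono C(2) u) simp
  finally show "\<bar>ip u f\<bar> \<le> C * norm2 f * Vnorm u" by (simp add: mult_ac)
qed (use C in simp)

end

section \<open>Approximate Laplace transforms in V\<close>

text \<open>
  Lebesgue measure is complete, so limits almost everywhere suffice for measurability.
\<close>

lemma borel_measurable_AE_limit:
  fixes f :: "nat \<Rightarrow> real \<Rightarrow> real"
  assumes f [measurable]: "\<And>n. f n \<in> borel_measurable lebesgue" and lim: "AE t in lebesgue. (\<lambda>n. f n t) \<longlonglongrightarrow> g t"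
  shows "g \<in> borel_measurable lebesgue"
proof (rule borel_measurable_AE)
  show "(\<lambda>t. lim (\<lambda>n. f n t)) \<in> borel_measurable lebesgue" by measurable
  show "AE t in lebesgue. lim (\<lambda>n. f n t) = g t" using lim by eventually_elim (rule limI)
qed

lemma simple_function_extend:
  assumes s: "simple_function (lebesgue_on A) s" and A: "A \<in> sets lebesgue"
  shows "simple_function lebesgue (\<lambda>t. if t \<in> A then s t else z)"
  unfolding simple_function_def
proof (intro conjI ballI)
  let ?f = "\<lambda>t. if t \<in> A then s t else z"
  have fin: "finite (s ` A)" using s by (simp add: simple_function_def space_restrict_space)
  show "finite (?f ` space lebesgue)"
    by (rule finite_subset[of _ "insert z (s ` A)"]) (use fin in auto)
  fix y
  have "s -` {y} \<inter> A \<in> sets lebesgue"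
  proof (cases "y \<in> s ` A")
    case True
    then have "s -` {y} \<inter> A \<in> sets (lebesgue_on A)" using s by (auto simp: simple_function_def space_restrict_space)
    then show ?thesis using A by (simp add: sets_restrict_space_iff)
  next
    case False
    then have "s -` {y} \<inter> A = {}" by auto
    then show ?thesis by simp
  qed
  moreover have "?f -` {y} \<inter> space lebesgue = (s -` {y} \<inter> A) \<union> (if y = z then - A else {})"
    by (cases "y = z") (auto split: if_splits)
  moreover have "- A \<in> sets lebesgue" using A sets.compl_sets[OF A] by (simp add: Compl_eq_Diff_UNIV)
  ultimately show "?f -` {y} \<inter> space lebesgue \<in> sets lebesgue" by (auto split: if_splits)
qed

context bounded_open_set
begin

lemma V_functionalD:
  assumes "V_functional l C"
  shows "0 \<le> C" "u \<in> V \<Omega> \<Longrightarrow> v \<in> V \<Omega> \<Longrightarrow> l (\<lambda>x. u x + v x) = l u + l v"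
    "u \<in> V \<Omega> \<Longrightarrow> l (\<lambda>x. c *\<^sub>R u x) = c * l u" "u \<in> V \<Omega> \<Longrightarrow> \<bar>l u\<bar> \<le> C * Vnorm u"
  using assms unfolding V_functional_def by auto

lemma V_functional_zero: "V_functional l C \<Longrightarrow> l (\<lambda>x. 0) = 0"
  unfolding V_functional_def using V_zero V_norm_zero by fastforce

lemma V_functional_sum:
  assumes l: "V_functional l C" and "finite A" "\<And>y. y \<in> A \<Longrightarrow> y \<in> V \<Omega>"
  shows "l (\<lambda>x. \<Sum>y\<in>A. c y *\<^sub>R y x) = (\<Sum>y\<in>A. c y * l y)"
  using assms(2,3)
proof (induction A rule: finite_induct)
  case empty
  then show ?case by (simp add: V_functional_zero[OF l])
next
  case (insert y A)
  have "l (\<lambda>x. c y *\<^sub>R y x + (\<Sum>y\<in>A. c y *\<^sub>R y x)) = l (\<lambda>x. c y *\<^sub>R y x) + l (\<lambda>x. \<Sum>y\<in>A. c y *\<^sub>R y x)"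
    by (rule V_functionalD(2)[OF l]) (use insert in \<open>auto intro!: V_scale V_sum\<close>)
  moreover have "l (\<lambda>x. c y *\<^sub>R y x) = c y * l y" using l insert by (auto simp: V_functional_def)
  ultimately show ?case using insert by simp
qed

lemma V_functional_diff:
  assumes l: "V_functional l C" and "u \<in> V \<Omega>" "v \<in> V \<Omega>"
  shows "l (\<lambda>x. u x - v x) = l u - l v" "\<bar>l u - l v\<bar> \<le> C * Vdist u v"
proof -
  have "l (\<lambda>x. u x + (-1) *\<^sub>R v x) = l u + l (\<lambda>x. (-1) *\<^sub>R v x)" "l (\<lambda>x. (-1) *\<^sub>R v x) = - 1 * l v"
    by (rule V_functionalD[OF l] assms V_scale)+
  then show 1: "l (\<lambda>x. u x - v x) = l u - l v" by simp
  show "\<bar>l u - l v\<bar> \<le> C * Vdist u v"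
    using l V_diff[OF assms(2,3)] unfolding 1[symmetric] V_functional_def by blast
qed

text \<open>
  Extending the approximants by zero outside \<open>[0, T]\<close> keeps them simple and makes them \<open>V\<close>-valued at
  all times.
\<close>

lemma L1loc_V_simple:
  assumes u: "u \<in> L1loc_into (V \<Omega>) (Vnorm)" and T: "0 < T"
  obtains S where "\<And>n::nat. simple_function lebesgue (S n)" "\<And>n t. S n t \<in> V \<Omega>"
    "AE t in lebesgue. t \<in> {0..T} \<longrightarrow> (\<lambda>n. Vdist (S n t) (u t)) \<longlonglongrightarrow> 0"
proof -
  from u T obtain s :: "nat \<Rightarrow> real \<Rightarrow> vfield" where
    s: "\<And>n. simple_function (lebesgue_on {0..T}) (s n)" "\<And>n t. t \<in> {0..T} \<Longrightarrow> s n t \<in> V \<Omega>"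
    and ae: "AE t in lebesgue_on {0..T}. u t \<in> V \<Omega> \<and> (\<lambda>n. Vdist (s n t) (u t)) \<longlonglongrightarrow> 0"
    unfolding L1loc_into_def by blast
  show ?thesis
  proof
    show "simple_function lebesgue (\<lambda>t. if t \<in> {0..T} then s n t else (\<lambda>x. 0))" for n
      by (rule simple_function_extend[OF s(1)]) simp
    show "(if t \<in> {0..T} then s n t else (\<lambda>x. 0)) \<in> V \<Omega>" for n t using s(2) V_zero by simp
    have "AE t in lebesgue. t \<in> {0..T} \<longrightarrow> u t \<in> V \<Omega> \<and> (\<lambda>n. Vdist (s n t) (u t)) \<longlonglongrightarrow> 0"
      using ae by (subst (asm) AE_restrict_space_iff) auto
    then show "AE t in lebesgue. t \<in> {0..T} \<longrightarrow> (\<lambda>n. Vnorm (\<lambda>x. (if t \<in> {0..T} then s n t else (\<lambda>x. 0)) x - u t x)) \<longlonglongrightarrow> 0"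
      by eventually_elim auto
  qed
qed

lemma L1loc_V_AE:
  assumes u: "u \<in> L1loc_into (V \<Omega>) (Vnorm)"
  shows "AE t in lebesgue. 0 \<le> t \<longrightarrow> u t \<in> V \<Omega>"
proof -
  have "AE t in lebesgue. t \<in> {0..real (Suc n)} \<longrightarrow> u t \<in> V \<Omega>" for n
  proof -
    from u have "0 < real (Suc n) \<Longrightarrow> \<exists>s. (AE t in lebesgue_on {0..real (Suc n)}. u t \<in> V \<Omega> \<and> (\<lambda>n. Vdist (s n t) (u t)) \<longlonglongrightarrow> 0)"
      unfolding L1loc_into_def by blast
    then have "AE t in lebesgue_on {0..real (Suc n)}. u t \<in> V \<Omega>" by auto
    then show ?thesis by (subst (asm) AE_restrict_space_iff) auto
  qed
  then have "AE t in lebesgue. \<forall>n. t \<in> {0..real (Suc n)} \<longrightarrow> u t \<in> V \<Omega>" by (subst AE_all_countable) blast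
  then show ?thesis
  proof eventually_elim
    fix t assume a: "\<forall>n. t \<in> {0..real (Suc n)} \<longrightarrow> u t \<in> V \<Omega>"
    obtain n where "t \<le> real n" using real_arch_simple by blast
    then show "0 \<le> t \<longrightarrow> u t \<in> V \<Omega>" using a[rule_format, of n] by auto
  qed
qed

text \<open>
  Strong measurability implies weak measurability, first on \<open>[0, k + 1]\<close> and then on the half-line.
\<close>

lemma functional_measurable:
  assumes u: "u \<in> L1loc_into (V \<Omega>) (Vnorm)" and l: "V_functional l C"
  shows "(\<lambda>t. indicator {0..} t * l (u t)) \<in> borel_measurable lebesgue"
proof (rule borel_measurable_AE_limit)
  note uV = L1loc_V_AE[OF u]
  fix k
  show "(\<lambda>t. indicator {0..real (Suc k)} t * l (u t)) \<in> borel_measurable lebesgue"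
  proof -
    obtain S where S: "\<And>n::nat. simple_function lebesgue (S n)" "\<And>n t. S n t \<in> V \<Omega>"
      "AE t in lebesgue. t \<in> {0..real (Suc k)} \<longrightarrow> (\<lambda>n. Vdist (S n t) (u t)) \<longlonglongrightarrow> 0"
      by (rule L1loc_V_simple[OF u, of "real (Suc k)"]) (auto simp del: of_nat_Suc)
    show ?thesis
    proof (rule borel_measurable_AE_limit)
      have "simple_function lebesgue (\<lambda>t. l (S n t))" for n by (rule simple_function_compose1[OF S(1)])
      then have [measurable]: "(\<lambda>t. l (S n t)) \<in> borel_measurable lebesgue" for n by (rule borel_measurable_simple_function)
      show "(\<lambda>t. indicator {0..real (Suc k)} t * l (S n t)) \<in> borel_measurable lebesgue" for n
        by (intro borel_measurable_times borel_measurable_indicator) auto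
      show "AE t in lebesgue. (\<lambda>n. indicator {0..real (Suc k)} t * l (S n t)) \<longlonglongrightarrow> indicator {0..real (Suc k)} t * l (u t)"
        using S(3) uV
      proof eventually_elim
        fix t assume c: "t \<in> {0..real (Suc k)} \<longrightarrow> (\<lambda>n. Vdist (S n t) (u t)) \<longlonglongrightarrow> 0" and v: "0 \<le> t \<longrightarrow> u t \<in> V \<Omega>"
        show "(\<lambda>n. indicator {0..real (Suc k)} t * l (S n t)) \<longlonglongrightarrow> indicator {0..real (Suc k)} t * l (u t)"
        proof (cases "t \<in> {0..real (Suc k)}")
          case True
          then have uV: "u t \<in> V \<Omega>" and cc: "(\<lambda>n. Vdist (S n t) (u t)) \<longlonglongrightarrow> 0" using c v by auto
          have "(\<lambda>n. l (S n t)) \<longlonglongrightarrow> l (u t)"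
          proof (rule LIM_zero_cancel, rule Lim_null_comparison)
            show "(\<lambda>n. C * Vdist (S n t) (u t)) \<longlonglongrightarrow> 0"
              using tendsto_mult_left[OF cc, of C] by simp
            show "\<forall>\<^sub>F n in sequentially. norm (l (S n t) - l (u t)) \<le> C * Vdist (S n t) (u t)"
              using V_functional_diff(2)[OF l S(2) uV] by simp
          qed
          then show ?thesis using True by simp
        qed simp
      qed
    qed
  qed
next
  show "AE t in lebesgue. (\<lambda>k. indicator {0..real (Suc k)} t * l (u t)) \<longlonglongrightarrow> indicator {0..} t * l (u t)"
  proof (rule AE_I2)
    fix t :: real
    obtain n where n: "t \<le> real n" using real_arch_simple by blast
    have "\<forall>\<^sub>F k in sequentially. indicator {0..real (Suc k)} t * l (u t) = indicator {0..} t * l (u t)"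
      using eventually_ge_at_top[of n] by eventually_elim (use n in \<open>auto simp: indicator_def\<close>)
    then show "(\<lambda>k. indicator {0..real (Suc k)} t * l (u t)) \<longlonglongrightarrow> indicator {0..} t * l (u t)"
      by (rule tendsto_eventually)
  qed
qed

lemma functional_laplaceable:
  assumes u: "u \<in> L1loc_into (V \<Omega>) (Vnorm)" and l: "V_functional l C"
    and lap: "laplaceable (\<lambda>t. Vnorm (u t)) p"
  shows "laplaceable (\<lambda>t. l (u t)) p"
  unfolding laplaceable_def set_integrable_def
proof (rule Bochner_Integration.integrable_bound)
  show "integrable lebesgue (\<lambda>t. C * (indicator {0..} t *\<^sub>R (Vnorm (u t) * exp (- p * t))))"
    using lap unfolding laplaceable_def set_integrable_def by (rule integrable_mult_right)
  have "(\<lambda>t. exp (- p * t)) \<in> borel_measurable lebesgue" by (rule measurable_completion) measurable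
  from borel_measurable_times[OF functional_measurable[OF u l] this]
  show "(\<lambda>t. indicator {0..} t *\<^sub>R (l (u t) * exp (- p * t))) \<in> borel_measurable lebesgue"
    by (simp add: mult.assoc)
  show "AE t in lebesgue. norm (indicator {0..} t *\<^sub>R (l (u t) * exp (- p * t))) \<le> norm (C * (indicator {0..} t *\<^sub>R (Vnorm (u t) * exp (- p * t))))"
    using L1loc_V_AE[OF u]
  proof eventually_elim
    fix t assume v: "0 \<le> t \<longrightarrow> u t \<in> V \<Omega>"
    show "norm (indicator {0..} t *\<^sub>R (l (u t) * exp (- p * t))) \<le> norm (C * (indicator {0..} t *\<^sub>R (Vnorm (u t) * exp (- p * t))))"
    proof (cases "0 \<le> t")
      case True
      then have "\<bar>l (u t)\<bar> \<le> C * Vnorm (u t)" "0 \<le> C" using l v by (auto simp: V_functional_def)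
      then show ?thesis using True V_norm_nonneg[of "u t"] by (simp add: abs_mult mult.assoc[symmetric])
    qed simp
  qed
qed

text \<open>
  The field \<open>h\<close> is the Laplace transform of a simple \<open>V\<close>-valued function \<open>G n\<close> whose weighted distance to \<open>u\<close>
  is below \<open>e\<close>, and this distance controls all functionals at once. The approximants provided by strong
  measurability come without a bound; discarding their values where they exceed twice the norm of \<open>u\<close>
  makes dominated convergence applicable without affecting the limit.
\<close>

lemma approximate_laplace_transform:
  assumes u: "u \<in> L1loc_into (V \<Omega>) (Vnorm)" and lap: "laplaceable (\<lambda>t. Vnorm (u t)) p" and e: "0 < e"
  obtains h where "h \<in> V \<Omega>"
    "\<And>l C. V_functional l C \<Longrightarrow> \<bar>laplace (\<lambda>t. l (u t)) p - l h\<bar> \<le> C * e"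
proof -
  note uV = L1loc_V_AE[OF u]
  define w where "w t = indicator {0..} t * (Vnorm (u t) * exp (- p * t))" for t
  have w: "integrable lebesgue w" using lap by (simp add: w_def[abs_def] laplaceable_def set_integrable_def)
  have w0: "0 \<le> w t" for t by (simp add: w_def V_norm_nonneg)
  have exp_meas [measurable]: "(\<lambda>t. exp (q * t)) \<in> borel_measurable lebesgue" for q :: real
    by (rule measurable_completion) measurable
  have "(\<lambda>n. LINT t|lebesgue. indicator {real n<..} t * w t) \<longlonglongrightarrow> (LINT t|(lebesgue :: real measure). 0)"
  proof (rule integral_dominated_convergence[OF _ _ w])
    show "AE t in lebesgue. (\<lambda>n. indicator {real n<..} t * w t) \<longlonglongrightarrow> 0"
    proof (rule AE_I2)
      fix t :: real
      obtain n where n: "t \<le> real n" using real_arch_simple by blast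
      have "\<forall>\<^sub>F k in sequentially. indicator {real k<..} t * w t = 0"
        using eventually_ge_at_top[of n] by eventually_elim (use n in \<open>auto simp: indicator_def\<close>)
      then show "(\<lambda>k. indicator {real k<..} t * w t) \<longlonglongrightarrow> 0" by (rule tendsto_eventually)
    qed
    show "AE t in lebesgue. norm (indicator {real n<..} t * w t) \<le> w t" for n
      using w0 by (intro AE_I2) (simp add: indicator_def)
    show "(\<lambda>t. indicator {real n<..} t * w t) \<in> borel_measurable lebesgue" for n
      using w by (intro borel_measurable_times borel_measurable_indicator borel_measurable_integrable) auto
  qed simp
  then have "\<forall>\<^sub>F n in sequentially. (LINT t|lebesgue. indicator {real n<..} t * w t) < e"
    using e by (auto dest: order_tendstoD)
  then obtain n0 where "\<And>n. n0 \<le> n \<Longrightarrow> (LINT t|lebesgue. indicator {real n<..} t * w t) < e"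
    by (auto simp: eventually_sequentially)
  from this[of "Suc n0"] obtain T :: real where T: "0 < T" and tail: "(LINT t|lebesgue. indicator {T<..} t * w t) < e"
    by (metis le_SucI le_refl of_nat_0_less_iff zero_less_Suc)
  obtain S where S: "\<And>n::nat. simple_function lebesgue (S n)" "\<And>n t. S n t \<in> V \<Omega>"
    and conv: "AE t in lebesgue. t \<in> {0..T} \<longrightarrow> (\<lambda>n. Vdist (S n t) (u t)) \<longlonglongrightarrow> 0"
    using L1loc_V_simple[OF u T] by blast
  define P where "P n t \<longleftrightarrow> t \<in> {0..T} \<and> Vnorm (S n t) \<le> 2 * (w t * exp (p * t))" for n t
  have Pw: "w t * exp (p * t) = Vnorm (u t)" if "0 \<le> t" for t
    using that by (simp add: w_def mult.assoc exp_add[symmetric])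
  define G where "G n t = (if P n t then S n t else (\<lambda>x. 0))" for n t
  have GV: "G n t \<in> V \<Omega>" for n t by (simp add: G_def S(2) V_zero)
  have G0: "G n t = (\<lambda>x. 0)" if "t \<notin> {0..T}" for n t using that by (auto simp: G_def P_def)
  have simple_G: "simple_function lebesgue (G n)" for n
    unfolding G_def[abs_def]
  proof (rule simple_function_If[OF S(1) simple_function_const])
    have [measurable]: "(\<lambda>t. Vnorm (S n t)) \<in> borel_measurable lebesgue"
      by (rule borel_measurable_simple_function[OF simple_function_compose1[OF S(1)]])
    have [measurable]: "w \<in> borel_measurable lebesgue" using w by auto
    have [measurable]: "{0..T} \<in> sets lebesgue" by simp
    show "{t \<in> space lebesgue. P n t} \<in> sets lebesgue" unfolding P_def by measurable
  qed
  (* The weighted distance; beyond T, where G n vanishes, it equals w. *)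
  define E where "E n t = indicator {0..} t * (Vdist (G n t) (u t) * exp (- p * t))" for n t
  have E_meas: "E n \<in> borel_measurable lebesgue" for n
  proof -
    have d: "(\<lambda>t. indicator {0..T} t * Vdist (G n t) (u t)) \<in> borel_measurable lebesgue"
    proof (rule borel_measurable_AE_limit)
      fix m
      have "simple_function lebesgue (\<lambda>t. Vdist (G n t) (S m t))"
        by (rule simple_function_compose2[OF simple_G S(1), of "\<lambda>a b. Vdist a b"])
      then have "(\<lambda>t. Vdist (G n t) (S m t)) \<in> borel_measurable lebesgue"
        by (rule borel_measurable_simple_function)
      then show "(\<lambda>t. indicator {0..T} t * Vdist (G n t) (S m t)) \<in> borel_measurable lebesgue"
        by (intro borel_measurable_times borel_measurable_indicator) auto
    next
      show "AE t in lebesgue. (\<lambda>m. indicator {0..T} t * Vdist (G n t) (S m t)) \<longlonglongrightarrow> indicator {0..T} t * Vdist (G n t) (u t)"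
        using conv uV
      proof eventually_elim
        fix t assume c: "t \<in> {0..T} \<longrightarrow> (\<lambda>n. Vdist (S n t) (u t)) \<longlonglongrightarrow> 0" and v: "0 \<le> t \<longrightarrow> u t \<in> V \<Omega>"
        show "(\<lambda>m. indicator {0..T} t * Vdist (G n t) (S m t)) \<longlonglongrightarrow> indicator {0..T} t * Vdist (G n t) (u t)"
        proof (cases "t \<in> {0..T}")
          case True
          then have uV: "u t \<in> V \<Omega>" and cc: "(\<lambda>n. Vdist (S n t) (u t)) \<longlonglongrightarrow> 0" using c v by auto
          have "(\<lambda>m. Vdist (G n t) (S m t)) \<longlonglongrightarrow> Vdist (G n t) (u t)"
          proof (rule LIM_zero_cancel, rule Lim_null_comparison[OF always_eventually cc], rule allI)
            fix m
            show "norm (Vdist (G n t) (S m t) - Vdist (G n t) (u t)) \<le> Vdist (S m t) (u t)"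
              using V_norm_triangle_sub[OF GV[of n t] S(2)[of m t] uV] V_norm_triangle_sub[OF GV[of n t] uV S(2)[of m t]]
                V_norm_minus_commute[OF S(2)[of m t] uV] by auto
          qed
          then show ?thesis using True by simp
        qed simp
      qed
    qed
    have w': "(\<lambda>t. indicator {T<..} t * w t) \<in> borel_measurable lebesgue"
      using w by (intro borel_measurable_times borel_measurable_indicator borel_measurable_integrable) auto
    have "(\<lambda>t. indicator {0..T} t * Vdist (G n t) (u t) * exp (- p * t) + indicator {T<..} t * w t) \<in> borel_measurable lebesgue"
      by (intro borel_measurable_add borel_measurable_times d w' exp_meas)
    then show ?thesis
    proof (rule borel_measurable_AE)
      show "AE t in lebesgue. indicator {0..T} t * Vdist (G n t) (u t) * exp (- p * t) + indicator {T<..} t * w t = E n t"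
        using uV
      proof eventually_elim
        fix t assume v: "0 \<le> t \<longrightarrow> u t \<in> V \<Omega>"
        show "indicator {0..T} t * Vdist (G n t) (u t) * exp (- p * t) + indicator {T<..} t * w t = E n t"
        proof (cases "T < t")
          case True
          then have "u t \<in> V \<Omega>" using v T by auto
          then show ?thesis using True T V_norm_minus_commute[OF V_zero, of "u t"]
            by (simp add: E_def w_def G0)
        qed (auto simp: E_def w_def indicator_def)
      qed
    qed
  qed
  have E_bound: "AE t in lebesgue. norm (E n t) \<le> 3 * w t" for n
    using uV
  proof eventually_elim
    fix t assume v: "0 \<le> t \<longrightarrow> u t \<in> V \<Omega>"
    show "norm (E n t) \<le> 3 * w t"
    proof (cases "0 \<le> t")
      case True
      then have uV: "u t \<in> V \<Omega>" using v by simp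
      have "Vnorm (G n t) \<le> 2 * Vnorm (u t)"
        using Pw[OF True] by (auto simp: G_def P_def V_norm_zero V_norm_nonneg)
      then have "Vdist (G n t) (u t) \<le> 3 * Vnorm (u t)"
        using V_norm_triangle_diff[OF GV uV, of n t] by linarith
      from mult_right_mono[OF this, of "exp (- p * t)"] show ?thesis
        using True by (simp add: E_def w_def abs_mult V_norm_nonneg)
    qed (simp add: E_def w_def)
  qed
  have "(\<lambda>n. LINT t|lebesgue. E n t) \<longlonglongrightarrow> (LINT t|lebesgue. indicator {T<..} t * w t)"
  proof (rule integral_dominated_convergence[OF _ E_meas _ _ E_bound])
    show "integrable lebesgue (\<lambda>t. 3 * w t)" using w by simp
    show "(\<lambda>t. indicator {T<..} t * w t) \<in> borel_measurable lebesgue"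
      using w by (intro borel_measurable_times borel_measurable_indicator borel_measurable_integrable) auto
    show "AE t in lebesgue. (\<lambda>n. E n t) \<longlonglongrightarrow> indicator {T<..} t * w t"
      using conv uV
    proof eventually_elim
      fix t assume c: "t \<in> {0..T} \<longrightarrow> (\<lambda>n. Vdist (S n t) (u t)) \<longlonglongrightarrow> 0" and v: "0 \<le> t \<longrightarrow> u t \<in> V \<Omega>"
      consider "t < 0" | "T < t" | "t \<in> {0..T}" by fastforce
      then show "(\<lambda>n. E n t) \<longlonglongrightarrow> indicator {T<..} t * w t"
      proof cases
        case 2
        then have "u t \<in> V \<Omega>" using v T by auto
        then show ?thesis using 2 T V_norm_minus_commute[OF V_zero, of "u t"]
          by (simp add: E_def w_def G0)
      next
        case 3
        then have uV: "u t \<in> V \<Omega>" and cc: "(\<lambda>n. Vdist (S n t) (u t)) \<longlonglongrightarrow> 0" and t0: "0 \<le> t" using c v by auto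
        have "\<forall>\<^sub>F n in sequentially. Vdist (G n t) (u t) \<le> Vdist (S n t) (u t)"
        (* Where u vanishes, cutting off only helps; elsewhere the cutoff is eventually inactive. *)
        proof (cases "Vnorm (u t) = 0")
          case True
          then have "Vdist (G n t) (u t) \<le> Vdist (S n t) (u t)" for n
            using V_norm_triangle_diff[OF V_zero uV] V_norm_nonneg V_norm_zero
            by (auto simp: G_def intro: order_trans)
          then show ?thesis by simp
        next
          case False
          then have "0 < Vnorm (u t)" using V_norm_nonneg[of "u t"] by linarith
          from order_tendstoD(2)[OF cc this] show ?thesis
          proof eventually_elim
            fix n assume "Vdist (S n t) (u t) < Vnorm (u t)"
            moreover have "Vnorm (S n t) \<le> Vnorm (u t) + Vdist (S n t) (u t)"
              using V_norm_triangle[OF uV V_diff[OF S(2)[of n t] uV]] by simp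
            ultimately have "P n t" using 3 Pw[OF t0] by (simp add: P_def)
            then show "Vdist (G n t) (u t) \<le> Vdist (S n t) (u t)" by (simp add: G_def)
          qed
        qed
        then have "(\<lambda>n. Vdist (G n t) (u t)) \<longlonglongrightarrow> 0"
          by (intro Lim_null_comparison[OF _ cc]) (auto simp: V_norm_nonneg)
        then have "(\<lambda>n. Vdist (G n t) (u t) * exp (- p * t)) \<longlonglongrightarrow> 0 * exp (- p * t)"
          by (rule tendsto_mult_right)
        then show ?thesis using 3 by (simp add: E_def)
      qed (simp add: E_def w_def)
    qed
  qed
  then have "\<forall>\<^sub>F n in sequentially. (LINT t|lebesgue. E n t) < e" using tail by (auto dest: order_tendstoD)
  then obtain n where n: "(LINT t|lebesgue. E n t) < e" by (auto simp: eventually_sequentially)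
  have E_int: "integrable lebesgue (E n)"
    by (rule Bochner_Integration.integrable_bound[OF integrable_mult_right[OF w, of 3] E_meas])
       (use E_bound[of n] in \<open>eventually_elim, use w0 in auto\<close>)
  define R where "R = range (G n)"
  have R: "finite R" "\<And>y. y \<in> R \<Longrightarrow> y \<in> V \<Omega>"
    using simple_functionD(1)[OF simple_G[of n]] GV by (auto simp: R_def)
  (* The Laplace weight of the set on which the simple function takes the value y. *)
  define k where "k y t = indicator {0..T} t * exp (- p * t) * indicator (G n -` {y}) t" for y and t :: real
  have sets_G: "G n -` {y} \<in> sets lebesgue" for y
    using simple_functionD(2)[OF simple_G[of n], of "{y}"] by simp
  have k_int: "integrable lebesgue (k y)" for y
  proof (rule Bochner_Integration.integrable_bound)
    show "integrable lebesgue (\<lambda>t. indicator {0..T} t * exp (\<bar>p\<bar> * T))" by (intro integrable_mult_left integrable_real_indicator) (auto simp: emeasure_lborel_Icc_eq)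
    show "k y \<in> borel_measurable lebesgue" unfolding k_def[abs_def]
      by (intro borel_measurable_times borel_measurable_indicator exp_meas sets_G) auto
    show "AE t in lebesgue. norm (k y t) \<le> norm (indicator {0..T} t * exp (\<bar>p\<bar> * T))"
    proof (rule AE_I2)
      fix t :: real
      have "exp (- p * t) \<le> exp (\<bar>p\<bar> * T)" if "0 \<le> t" "t \<le> T"
      proof -
        have "- p * t \<le> \<bar>p\<bar> * t" using that by (intro mult_right_mono) auto
        also have "\<dots> \<le> \<bar>p\<bar> * T" using that by (intro mult_left_mono) auto
        finally show ?thesis by simp
      qed
      then show "norm (k y t) \<le> norm (indicator {0..T} t * exp (\<bar>p\<bar> * T))"
        by (auto simp: k_def indicator_def)
    qed
  qed
  define h where "h = (\<lambda>x. \<Sum>y\<in>R. (LINT t|lebesgue. k y t) *\<^sub>R y x)"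
  show ?thesis
  proof
    show "h \<in> V \<Omega>" unfolding h_def by (intro V_sum R V_scale)
    fix l C assume l: "V_functional l C"
    have C: "0 \<le> C" using l by (simp add: V_functional_def)
    have lG: "indicator {0..} t * (l (G n t) * exp (- p * t)) = (\<Sum>y\<in>R. l y * k y t)" for t
    proof -
      have "(\<Sum>y\<in>R. l y * k y t) = (\<Sum>y\<in>R. if y = G n t then l y * (indicator {0..T} t * exp (- p * t)) else 0)"
        by (rule sum.cong) (auto simp: k_def indicator_def)
      also have "\<dots> = l (G n t) * (indicator {0..T} t * exp (- p * t))" using R(1) by (simp add: R_def)
      also have "\<dots> = indicator {0..} t * (l (G n t) * exp (- p * t))"
        using G0[of t n] V_functional_zero[OF l] by (cases "t \<in> {0..T}") (auto simp: indicator_def)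
      finally show ?thesis ..
    qed
    have intG: "integrable lebesgue (\<lambda>t. indicator {0..} t * (l (G n t) * exp (- p * t)))"
      unfolding lG by (intro Bochner_Integration.integrable_sum integrable_mult_right k_int)
    have lh: "(LINT t|lebesgue. indicator {0..} t * (l (G n t) * exp (- p * t))) = l h"
    proof -
      have "l h = (\<Sum>y\<in>R. (LINT t|lebesgue. k y t) * l y)" unfolding h_def by (rule V_functional_sum[OF l R])
      then show ?thesis
        unfolding lG by (subst Bochner_Integration.integral_sum) (auto intro: k_int simp: mult.commute)
    qed
    have intu: "integrable lebesgue (\<lambda>t. indicator {0..} t * (l (u t) * exp (- p * t)))"
      using functional_laplaceable[OF u l lap] by (simp add: laplaceable_def set_integrable_def)
    have eq: "laplace (\<lambda>t. l (u t)) p - l h = (LINT t|lebesgue. indicator {0..} t * (l (u t) * exp (- p * t)) - indicator {0..} t * (l (G n t) * exp (- p * t)))"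
      unfolding Bochner_Integration.integral_diff[OF intu intG] lh by (simp add: laplace_def set_lebesgue_integral_def)
    have "\<bar>laplace (\<lambda>t. l (u t)) p - l h\<bar> \<le> (LINT t|lebesgue. \<bar>indicator {0..} t * (l (u t) * exp (- p * t)) - indicator {0..} t * (l (G n t) * exp (- p * t))\<bar>)"
      unfolding eq by (rule integral_abs_bound)
    also have "\<dots> \<le> (LINT t|lebesgue. C * E n t)"
    proof (rule integral_mono_AE)
      show "integrable lebesgue (\<lambda>t. C * E n t)" using E_int by simp
      show "AE t in lebesgue. \<bar>indicator {0..} t * (l (u t) * exp (- p * t)) - indicator {0..} t * (l (G n t) * exp (- p * t))\<bar> \<le> C * E n t"
        using uV
      proof eventually_elim
        fix t assume v: "0 \<le> t \<longrightarrow> u t \<in> V \<Omega>"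
        show "\<bar>indicator {0..} t * (l (u t) * exp (- p * t)) - indicator {0..} t * (l (G n t) * exp (- p * t))\<bar> \<le> C * E n t"
        proof (cases "0 \<le> t")
          case True
          then have "\<bar>l (G n t) - l (u t)\<bar> \<le> C * Vdist (G n t) (u t)"
            using V_functional_diff(2)[OF l GV] v by blast
          from mult_right_mono[OF this, of "exp (- p * t)"]
          have "\<bar>l (u t) - l (G n t)\<bar> * exp (- p * t) \<le> C * (Vdist (G n t) (u t) * exp (- p * t))"
            by (simp add: abs_minus_commute mult.assoc)
          moreover have "\<bar>l (u t) * exp (- p * t) - l (G n t) * exp (- p * t)\<bar> = \<bar>l (u t) - l (G n t)\<bar> * exp (- p * t)"
            by (simp add: left_diff_distrib[symmetric] abs_mult)
          ultimately show ?thesis using True by (simp add: E_def)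
        qed (simp add: E_def)
      qed
    qed (use intu intG in auto)
    also have "\<dots> \<le> C * e" using n C by (simp add: mult_left_mono)
    finally show "\<bar>laplace (\<lambda>t. l (u t)) p - l h\<bar> \<le> C * e" .
  qed
qed

end

section \<open>The Laplace-transformed weak problem\<close>

lemma laplace_cmult: "laplace (\<lambda>t. c * f t) p = c * laplace f p"
  by (simp add: laplace_def set_lebesgue_integral_def mult.assoc mult.left_commute[of _ c])

lemma laplaceable_cmult: "laplaceable f p \<Longrightarrow> laplaceable (\<lambda>t. c * f t) p"
  using set_integrable_mult_right[of c lebesgue "{0..}" "\<lambda>t. f t * exp (- p * t)"]
  by (simp add: laplaceable_def mult.assoc)

lemma laplaceable_add: "laplaceable f p \<Longrightarrow> laplaceable g p \<Longrightarrow> laplaceable (\<lambda>t. f t + g t) p"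
  unfolding laplaceable_def by (simp add: distrib_right)

lemma laplace_add: "laplaceable f p \<Longrightarrow> laplaceable g p \<Longrightarrow> laplace (\<lambda>t. f t + g t) p = laplace f p + laplace g p"
  unfolding laplaceable_def laplace_def by (simp add: distrib_right)

lemma laplaceable_diff: "laplaceable f p \<Longrightarrow> laplaceable g p \<Longrightarrow> laplaceable (\<lambda>t. f t - g t) p"
  unfolding laplaceable_def by (simp add: left_diff_distrib)

lemma laplace_diff: "laplaceable f p \<Longrightarrow> laplaceable g p \<Longrightarrow> laplace (\<lambda>t. f t - g t) p = laplace f p - laplace g p"
  unfolding laplaceable_def laplace_def by (simp add: left_diff_distrib)

lemma laplaceable_sum: "finite I \<Longrightarrow> (\<And>i. i \<in> I \<Longrightarrow> laplaceable (f i) p) \<Longrightarrow> laplaceable (\<lambda>t. \<Sum>i\<in>I. f i t) p"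
proof (induction I rule: finite_induct)
  case empty
  then show ?case by (simp add: laplaceable_def set_integrable_def)
qed (simp add: laplaceable_add)

lemma laplace_sum: "finite I \<Longrightarrow> (\<And>i. i \<in> I \<Longrightarrow> laplaceable (f i) p) \<Longrightarrow> laplace (\<lambda>t. \<Sum>i\<in>I. f i t) p = (\<Sum>i\<in>I. laplace (f i) p)"
proof (induction I rule: finite_induct)
  case empty
  then show ?case by (simp add: laplace_def set_lebesgue_integral_def)
qed (simp add: laplace_add laplaceable_sum)

lemma laplace_cong_AE:
  assumes f: "laplaceable f p" and eq: "AE t in lebesgue. 0 \<le> t \<longrightarrow> f t = g t"
  shows "laplaceable g p" "laplace f p = laplace g p"
proof -
  have int: "integrable lebesgue (\<lambda>t. indicator {0..} t *\<^sub>R (f t * exp (- p * t)))"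
    using f by (simp add: laplaceable_def set_integrable_def)
  have ae: "AE t in lebesgue. indicator {0..} t *\<^sub>R (f t * exp (- p * t)) = indicator {0..} t *\<^sub>R (g t * exp (- p * t))"
    using eq by eventually_elim (auto simp: indicator_def)
  have m: "(\<lambda>t. indicator {0..} t *\<^sub>R (g t * exp (- p * t))) \<in> borel_measurable lebesgue"
    by (rule borel_measurable_AE[OF borel_measurable_integrable[OF int] ae])
  show "laplaceable g p"
    unfolding laplaceable_def set_integrable_def
    using int integrable_cong_AE[OF borel_measurable_integrable[OF int] m ae] by simp
  show "laplace f p = laplace g p"
    unfolding laplace_def set_lebesgue_integral_def
    by (rule integral_cong_AE[OF borel_measurable_integrable[OF int] m ae])
qed

lemma AE_nonzero_time: "AE t in (lebesgue :: real measure). t \<noteq> c"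
  by (rule AE_completion) (rule AE_lborel_singleton)

lemma laplaceable_dominated:
  assumes c: "continuous_on {0<..} f" and g: "laplaceable g p" and le: "AE t in lebesgue. 0 \<le> t \<longrightarrow> \<bar>f t\<bar> \<le> g t"
  shows "laplaceable f p"
proof -
  have [measurable]: "pos_part_time f \<in> borel_measurable borel" by (rule pos_part_time_borel[OF c])
  have m: "(\<lambda>t. pos_part_time f t * exp (- p * t)) \<in> borel_measurable lebesgue"
  proof (rule measurable_completion)
    show "(\<lambda>t. pos_part_time f t * exp (- p * t)) \<in> borel_measurable lborel" by measurable
  qed
  have "laplaceable (pos_part_time f) p"
    unfolding laplaceable_def set_integrable_def
  proof (rule Bochner_Integration.integrable_bound)
    show "integrable lebesgue (\<lambda>t. indicator {0..} t *\<^sub>R (g t * exp (- p * t)))"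
      using g by (simp add: laplaceable_def set_integrable_def)
    show "(\<lambda>t. indicator {0..} t *\<^sub>R (pos_part_time f t * exp (- p * t))) \<in> borel_measurable lebesgue"
      by (intro borel_measurable_scaleR borel_measurable_indicator m) auto
    show "AE t in lebesgue. norm (indicator {0..} t *\<^sub>R (pos_part_time f t * exp (- p * t))) \<le> norm (indicator {0..} t *\<^sub>R (g t * exp (- p * t)))"
      using le by eventually_elim (auto simp: indicator_def pos_part_time_def abs_mult)
  qed
  then show ?thesis
    by (rule laplace_cong_AE) (use AE_nonzero_time[of 0] in \<open>eventually_elim, simp add: pos_part_time_def\<close>)
qed

lemma laplace_bound:
  assumes f: "laplaceable f p" and g: "laplaceable g p" and le: "AE t in lebesgue. 0 \<le> t \<longrightarrow> \<bar>f t\<bar> \<le> g t"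
  shows "\<bar>laplace f p\<bar> \<le> laplace g p"
proof -
  have "\<bar>laplace f p\<bar> \<le> (LINT t|lebesgue. \<bar>indicator {0..} t *\<^sub>R (f t * exp (- p * t))\<bar>)"
    unfolding laplace_def set_lebesgue_integral_def by (rule integral_abs_bound)
  also have "\<dots> \<le> laplace g p"
    unfolding laplace_def set_lebesgue_integral_def
  proof (rule integral_mono_AE)
    show "AE t in lebesgue. \<bar>indicator {0..} t *\<^sub>R (f t * exp (- p * t))\<bar> \<le> indicator {0..} t *\<^sub>R (g t * exp (- p * t))"
      using le by eventually_elim (auto simp: indicator_def abs_mult)
  qed (use f g in \<open>auto simp: laplaceable_def set_integrable_def\<close>)
  finally show ?thesis .
qed

lemma set_integral_mult_const:
  fixes f :: "'a \<Rightarrow> real"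
  shows "(LINT x:A|M. f x * c) = (LINT x:A|M. f x) * c" "(LINT x:A|M. c * f x) = c * (LINT x:A|M. f x)"
proof -
  have "(\<lambda>x. indicator A x *\<^sub>R (f x * c)) = (\<lambda>x. (indicator A x *\<^sub>R f x) * c)" by (simp add: mult.assoc)
  then show "(LINT x:A|M. f x * c) = (LINT x:A|M. f x) * c" unfolding set_lebesgue_integral_def by simp
  then show "(LINT x:A|M. c * f x) = c * (LINT x:A|M. f x)" by (simp add: mult.commute)
qed

lemma set_integral_cong_nonneg_time:
  fixes f :: "real \<Rightarrow> real"
  shows "(\<And>t. 0 \<le> t \<Longrightarrow> f t = g t) \<Longrightarrow> (LINT t:{0..}|lebesgue. f t) = (LINT t:{0..}|lebesgue. g t)"
  by (rule set_lebesgue_integral_cong) auto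

text \<open>
  At \<open>t = 0\<close> the kernel is \<open>0\<close>, being a quotient by zero, as \<open>convolution_limit\<close> requires.
\<close>

definition kernel :: "real \<Rightarrow> real \<Rightarrow> real \<Rightarrow> real" where
  "kernel C a t = 1 / (C * t powr a)"

lemma kernel_props:
  assumes "0 < a" "a < 1" "1 \<le> p" "0 < C"
  shows "pos_part_time (kernel C a) \<in> borel_measurable borel"
    and "laplaceable (kernel C a) p" and "0 < laplace (kernel C a) p" "kernel C a 0 = 0"
proof -
  have k: "kernel C a = (\<lambda>t. (1 / C) * (1 / t powr a))" by (simp add: kernel_def fun_eq_iff)
  have "pos_part_time (kernel C a) = (\<lambda>t. (1 / C) * pos_part_time (\<lambda>t. 1 / t powr a) t)"
    by (auto simp: k pos_part_time_def)
  then show "pos_part_time (kernel C a) \<in> borel_measurable borel" using power_kernel(1)[OF assms(1-3)] by simp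
  show "laplaceable (kernel C a) p" unfolding k by (rule laplaceable_cmult[OF power_kernel(2)[OF assms(1-3)]])
  show "0 < laplace (kernel C a) p" unfolding k laplace_cmult using power_kernel(3)[OF assms(1-3)] assms(4) by simp
  show "kernel C a 0 = 0" by (simp add: kernel_def)
qed

locale weak_solution = bounded_open_set +
  fixes \<alpha> \<beta> :: real and u0 :: vfield and S0 :: mfield and u :: "real \<Rightarrow> vfield" and S :: "real \<Rightarrow> mfield"
  assumes \<alpha>: "0 < \<alpha>" "\<alpha> < 1" and \<beta>: "0 < \<beta>" "\<beta> < 1" and S0: "S0 \<in> L2 \<Omega>"
    and in_F: "(u, S) \<in> F_space \<Omega>" and solves: "WF_solution \<alpha> \<beta> \<Omega> u0 S0 (u, S)"
begin

lemma u_L2: "0 \<le> t \<Longrightarrow> u t \<in> L2 \<Omega>"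
  using in_F by (auto simp: F_space_def C0_into_def H_def)

lemma S_L2: "0 < t \<Longrightarrow> S t \<in> L2 \<Omega>"
  using in_F by (auto simp: F_space_def C0_into_def)

lemma u_L1loc: "u \<in> L1loc_into (V \<Omega>) (Vnorm)"
  using in_F by (auto simp: F_space_def)

lemmas u_V = L1loc_V_AE[OF u_L1loc]

lemma C0_into_inner_continuous:
  fixes f :: "real \<Rightarrow> pt \<Rightarrow> 'b::euclidean_space"
  assumes f: "f \<in> C0_into I X (norm2)" and X: "X \<subseteq> L2 \<Omega>" and A: "A \<in> L2 \<Omega>"
  shows "continuous_on I (\<lambda>t. ip (f t) A)"
  unfolding continuous_on_def
proof
  fix t assume t: "t \<in> I"
  have fL2: "\<And>s. s \<in> I \<Longrightarrow> f s \<in> L2 \<Omega>" and lim: "((\<lambda>s. dist2 (f s) (f t)) \<longlongrightarrow> 0) (at t within I)"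
    using f t X by (auto simp: C0_into_def)
  show "((\<lambda>t. ip (f t) A) \<longlongrightarrow> ip (f t) A) (at t within I)"
  proof (rule LIM_zero_cancel, rule Lim_null_comparison)
    show "((\<lambda>s. dist2 (f s) (f t) * norm2 A) \<longlongrightarrow> 0) (at t within I)"
      using tendsto_mult_right[OF lim, of "norm2 A"] by simp
    have "norm (ip (f s) A - ip (f t) A) \<le> dist2 (f s) (f t) * norm2 A" if "s \<in> I" for s
      using L2_Cauchy_Schwarz[OF L2_diff[OF fL2[OF that] fL2[OF t]] A]
      by (simp add: L2_inner_diff_left[OF fL2[OF that] fL2[OF t] A])
    then show "\<forall>\<^sub>F s in at t within I. norm (ip (f s) A - ip (f t) A) \<le> dist2 (f s) (f t) * norm2 A"
      by (simp add: eventually_at_filter)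
  qed
qed

lemma u_continuous: "f \<in> L2 \<Omega> \<Longrightarrow> continuous_on {0..} (\<lambda>t. ip (u t) f)"
  by (rule C0_into_inner_continuous[of u _ "H \<Omega>"]) (use in_F in \<open>auto simp: F_space_def H_def\<close>)

lemma S_continuous: "A \<in> L2 \<Omega> \<Longrightarrow> continuous_on {0<..} (\<lambda>t. ip (S t) A)"
  by (rule C0_into_inner_continuous[of S _ "L2 \<Omega>"]) (use in_F in \<open>auto simp: F_space_def\<close>)

text \<open>
  Points at which all transforms of the solution converge absolutely. The bound \<open>1 \<le> p\<close> is the range in which
  \<open>power_kernel\<close> controls the kernels.
\<close>

definition admissible :: "real \<Rightarrow> bool" where
  "admissible p \<longleftrightarrow> 1 \<le> p \<and> laplaceable (\<lambda>t. Vnorm (u t)) p \<and> laplaceable (\<lambda>t. norm2 (S t)) p"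

lemma admissible_ex: obtains M where "\<And>p. M \<le> p \<Longrightarrow> admissible p"
proof -
  from in_F obtain M1 M2 where M: "laplaceable (\<lambda>t. norm2 (grad (u t))) M1" "laplaceable (\<lambda>t. norm2 (S t)) M2"
    unfolding F_space_def Lap_def laplaceable_def by auto
  have 1: "laplaceable (\<lambda>t. Vnorm (u t)) M1"
    by (rule laplace_cong_AE(1)[OF M(1)]) (use u_V in \<open>eventually_elim, simp add: V_norm_eq\<close>)
  show ?thesis
    by (rule that[of "max 1 (max M1 M2)"]) (auto simp: admissible_def intro: laplaceable_mono[OF 1] laplaceable_mono[OF M(2)])
qed

lemma u_laplaceable:
  assumes p: "admissible p" and f: "f \<in> L2 \<Omega>" shows "laplaceable (\<lambda>t. ip (u t) f) p"
proof -
  obtain C where "0 \<le> C" "\<And>u. u \<in> V \<Omega> \<Longrightarrow> norm2 u \<le> C * Vnorm u" using Poincare_V by blast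
  from functional_laplaceable[OF u_L1loc V_functional_L2[OF this f]] show ?thesis
    using p by (simp add: admissible_def)
qed

lemma sgrad_laplaceable:
  assumes p: "admissible p" and A: "A \<in> L2 \<Omega>" shows "laplaceable (\<lambda>t. ip (sgrad (u t)) A) p"
  using functional_laplaceable[OF u_L1loc V_functional_sgrad[OF A]] p by (simp add: admissible_def)

lemma S_bound:
  assumes A: "A \<in> L2 \<Omega>"
  shows "AE t in lebesgue. 0 \<le> t \<longrightarrow> \<bar>ip (S t) A\<bar> \<le> norm2 A * norm2 (S t)"
  using AE_nonzero_time[of 0] by eventually_elim (use L2_Cauchy_Schwarz[OF S_L2 A] in \<open>auto simp: mult.commute\<close>)

lemma S_laplaceable:
  assumes p: "admissible p" and A: "A \<in> L2 \<Omega>" shows "laplaceable (\<lambda>t. ip (S t) A) p"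
  by (rule laplaceable_dominated[OF S_continuous[OF A] laplaceable_cmult S_bound[OF A]]) (use p in \<open>simp add: admissible_def\<close>)

text \<open>
  The momentum equation tested with cutoffs of \<open>exp (- p t)\<close>, in the limit.
\<close>

lemma momentum_laplace:
  assumes p: "admissible p" and \<theta>: "\<theta> \<in> V \<Omega>"
  shows "ip u0 \<theta> - p * laplace (\<lambda>t. ip (u t) \<theta>) p = laplace (\<lambda>t. ip (S t) (grad \<theta>)) p"
proof -
  obtain C where "exp_approximation p C (- p) (exp_cutoff' p)" by (rule exp_cutoff'_approx)
  then interpret d: exp_approximation p C "- p" "exp_cutoff' p" .
  interpret e: exp_approximation p "exp 1" 1 "exp_cutoff p" by (rule exp_cutoff_approx)
  have \<theta>L2: "\<theta> \<in> L2 \<Omega>" "grad \<theta> \<in> L2 \<Omega>" by (rule H10_vecD[OF V_H10_vec[OF \<theta>]])+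
  have "ip u0 \<theta> + (LINT t:{0..}|lebesgue. ip (u t) \<theta> * exp_cutoff' p n t)
      = (LINT t:{0..}|lebesgue. ip (S t) (grad \<theta>) * exp_cutoff p n t)" for n
  proof -
    have "weak_momentum \<Omega> u0 u S \<theta> (exp_cutoff p n)"
      using solves \<theta> exp_cutoff_time_test[of p n] by (auto simp: WF_solution_def)
    moreover have "exp_cutoff p n 0 = 1" by (simp add: exp_cutoff_def flat0_one)
    moreover have "(LINT t:{0..}|lebesgue. ip (u t) \<theta> * hderiv (exp_cutoff p n) t)
        = (LINT t:{0..}|lebesgue. ip (u t) \<theta> * exp_cutoff' p n t)"
      by (rule set_integral_cong_nonneg_time) (simp add: hderiv_exp_cutoff)
    ultimately show ?thesis unfolding weak_momentum_def set_integral_mult_const by (simp add: L2_inner_def)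
  qed
  moreover have "(\<lambda>n. ip u0 \<theta> + (LINT t:{0..}|lebesgue. ip (u t) \<theta> * exp_cutoff' p n t))
      \<longlonglongrightarrow> ip u0 \<theta> + - p * laplace (\<lambda>t. ip (u t) \<theta>) p"
    by (intro tendsto_add tendsto_const d.single_limit u_laplaceable[OF p \<theta>L2(1)])
  moreover have "(\<lambda>n. LINT t:{0..}|lebesgue. ip (S t) (grad \<theta>) * exp_cutoff p n t)
      \<longlonglongrightarrow> 1 * laplace (\<lambda>t. ip (S t) (grad \<theta>)) p"
    by (intro e.single_limit S_laplaceable[OF p \<theta>L2(2)])
  ultimately show ?thesis using LIMSEQ_unique by fastforce
qed

abbreviation "\<kappa>\<^sub>\<alpha> \<equiv> laplace (kernel (Gamma (1 - \<alpha>)) \<alpha>)"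
abbreviation "\<kappa>\<^sub>\<beta> p \<equiv> laplace (kernel 1 \<beta>) p / Gamma (1 - \<beta>)"

lemma kernel_pos: "1 \<le> p \<Longrightarrow> 0 < \<kappa>\<^sub>\<alpha> p" "1 \<le> p \<Longrightarrow> 0 < \<kappa>\<^sub>\<beta> p"
  using kernel_props(3)[OF \<alpha>, of p "Gamma (1 - \<alpha>)"] kernel_props(3)[OF \<beta>, of p 1] \<alpha> \<beta>
  by (auto simp: Gamma_real_pos)

text \<open>
  The field against which the weak constitutive law pairs the velocity when tested with \<open>a\<close> in row \<open>i\<close>:
  after integration by parts it stands for row \<open>i\<close> of minus twice the symmetric gradient.
\<close>

definition flux :: "vfield \<Rightarrow> 3 \<Rightarrow> vfield" where
  "flux a i x = (\<chi> j. (if j = i then \<Sum>k\<in>UNIV. pd k (\<lambda>y. a y $ k) x else 0) + pd i (\<lambda>y. a y $ j) x)"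

lemma Cc_inf_vecD: "a \<in> Cc_inf_vec \<Omega> \<Longrightarrow> (\<lambda>x. a x $ k) \<in> Cc_inf \<Omega>"
  by (simp add: Cc_inf_vec_def)

lemma Cc_inf_vec_L2: "a \<in> Cc_inf_vec \<Omega> \<Longrightarrow> a \<in> L2 \<Omega>"
  by (auto simp: L2_vec_iff intro: Cc_inf_L2 Cc_inf_vecD)

lemma L2_sum: "finite I \<Longrightarrow> (\<And>i. i \<in> I \<Longrightarrow> f i \<in> L2 \<Omega>) \<Longrightarrow> (\<lambda>x. \<Sum>i\<in>I. f i x :: 'b::euclidean_space) \<in> L2 \<Omega>"
  by (induction I rule: finite_induct) (auto intro: L2_zero L2_add)

lemma L2_inner_sum_right:
  "finite I \<Longrightarrow> g \<in> L2 \<Omega> \<Longrightarrow> (\<And>i. i \<in> I \<Longrightarrow> f i \<in> L2 \<Omega>) \<Longrightarrow>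
    ip g (\<lambda>x. \<Sum>i\<in>I. f i x :: 'b::euclidean_space) = (\<Sum>i\<in>I. ip g (f i))"
proof (induction I rule: finite_induct)
  case empty
  then show ?case by (simp add: L2_inner_eq)
qed (simp add: L2_inner_add_right L2_sum)

lemma flux_L2:
  assumes "a \<in> Cc_inf_vec \<Omega>" shows "flux a i \<in> L2 \<Omega>"
proof -
  have pdL2: "pd k (\<lambda>y. a y $ j) \<in> L2 \<Omega>" for k j by (intro Cc_inf_L2 Cc_inf_pd Cc_inf_vecD assms)
  have "(\<lambda>x. flux a i x $ j) \<in> L2 \<Omega>" for j
    unfolding flux_def by (cases "j = i") (auto intro!: L2_add L2_sum pdL2)
  then show ?thesis by (simp add: L2_vec_iff)
qed

lemma flux_eq_sgrad:
  assumes a: "a \<in> Cc_inf_vec \<Omega>" and v: "v \<in> V \<Omega>"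
  shows "ip v (flux a i) = - ip (\<lambda>x. sgrad v x $ i) a"
proof -
  note vH = V_H10_vec[OF v]
  have vL2: "(\<lambda>x. v x $ j) \<in> L2 \<Omega>" for j using H10_vecD(2)[OF vH] by (simp add: L2_vec_iff)
  have pdL2: "pd k (\<lambda>y. a y $ j) \<in> L2 \<Omega>" for k j by (intro Cc_inf_L2 Cc_inf_pd Cc_inf_vecD a)
  have w: "ip (\<lambda>x. v x $ j) (pd k (\<lambda>y. a y $ l)) = - ip (wpd \<Omega> k (\<lambda>x. v x $ j)) (\<lambda>x. a x $ l)" for j k l
    using H1D(3)[OF H10_vecD(1)[OF vH]] Cc_inf_vecD[OF a] unfolding has_weak_pd_iff by blast
  have wL2: "wpd \<Omega> k (\<lambda>x. v x $ j) \<in> L2 \<Omega>" for k j by (rule H1D(2)[OF H10_vecD(1)[OF vH]])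
  have aL2: "(\<lambda>x. a x $ j) \<in> L2 \<Omega>" for j by (intro Cc_inf_L2 Cc_inf_vecD a)
  have comp: "ip (\<lambda>x. v x $ j) (\<lambda>x. flux a i x $ j)
      = (if j = i then (\<Sum>k\<in>UNIV. ip (\<lambda>x. v x $ i) (pd k (\<lambda>y. a y $ k))) else 0)
        + ip (\<lambda>x. v x $ j) (pd i (\<lambda>y. a y $ j))" for j
    by (cases "j = i") (simp_all add: flux_def L2_inner_add_right L2_inner_sum_right L2_sum vL2 pdL2)
  have "ip v (flux a i) = (\<Sum>j\<in>UNIV. ip (\<lambda>x. v x $ j) (\<lambda>x. flux a i x $ j))"
    by (rule L2_inner_vec[OF H10_vecD(2)[OF vH] flux_L2[OF a]])
  also have "\<dots> = - (\<Sum>j\<in>UNIV. ip (wpd \<Omega> j (\<lambda>x. v x $ i)) (\<lambda>x. a x $ j) + ip (wpd \<Omega> i (\<lambda>x. v x $ j)) (\<lambda>x. a x $ j))"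
    unfolding comp by (simp add: sum.distrib sum_subtractf w sum_negf)
  also have "(\<Sum>j\<in>UNIV. ip (wpd \<Omega> j (\<lambda>x. v x $ i)) (\<lambda>x. a x $ j) + ip (wpd \<Omega> i (\<lambda>x. v x $ j)) (\<lambda>x. a x $ j))
      = (\<Sum>j\<in>UNIV. ip (\<lambda>x. sgrad v x $ i $ j) (\<lambda>x. a x $ j))"
    by (simp add: sgrad_def wgrad_def transpose_def L2_inner_add_left wL2 aL2)
  also have "\<dots> = ip (\<lambda>x. sgrad v x $ i) a"
    by (rule L2_inner_vec[symmetric]) (use sgrad_L2[OF v] Cc_inf_vec_L2[OF a] in \<open>simp_all add: L2_vec_iff[of "sgrad v"]\<close>)
  finally show ?thesis .
qed

text \<open>
  A test with a vector field in one row is a test of the whole stress with this matrix field.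
\<close>

definition single_row :: "3 \<Rightarrow> vfield \<Rightarrow> mfield" where
  "single_row i a x = (\<chi> k. if k = i then a x else 0)"

lemma single_row_L2:
  assumes "a \<in> L2 \<Omega>" shows "single_row i a \<in> L2 \<Omega>"
proof -
  have "(\<lambda>x. single_row i a x $ k) \<in> L2 \<Omega>" for k
    by (cases "k = i") (simp_all add: single_row_def assms L2_zero)
  then show ?thesis by (simp add: L2_vec_iff[of "single_row i a"])
qed

lemma L2_inner_single_row: "ip (\<lambda>x. F x $ i) a = ip F (single_row i a)"
proof -
  have "F x $ i \<bullet> a x = F x \<bullet> single_row i a x" for x
  proof -
    have "F x \<bullet> single_row i a x = (\<Sum>k\<in>UNIV. F x $ k \<bullet> single_row i a x $ k)" by (rule inner_vec_def)
    also have "\<dots> = (\<Sum>k\<in>UNIV. if k = i then F x $ i \<bullet> a x else 0)"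
      by (rule sum.cong) (auto simp: single_row_def)
    finally show ?thesis by simp
  qed
  then show ?thesis by (simp add: L2_inner_def)
qed

text \<open>
  The constitutive law tested with cutoffs of \<open>exp (- p t)\<close>, in the limit. The fractional derivative of
  the stress becomes multiplication by \<open>p\<close> times the transform of its kernel, minus the initial stress
  times the same transform.
\<close>

lemma constitutive_laplace:
  assumes p: "admissible p" and a: "a \<in> Cc_inf_vec \<Omega>"
  shows "(1 + p * \<kappa>\<^sub>\<alpha> p) * laplace (\<lambda>t. ip (\<lambda>x. S t x $ i) a) p
    = \<kappa>\<^sub>\<alpha> p * ip (\<lambda>x. S0 x $ i) a - \<kappa>\<^sub>\<beta> p * laplace (\<lambda>t. ip (u t) (flux a i)) p"
proof -
  obtain C where "exp_approximation p C (- p) (exp_cutoff' p)" by (rule exp_cutoff'_approx)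
  then interpret d: exp_approximation p C "- p" "exp_cutoff' p" .
  interpret e: exp_approximation p "exp 1" 1 "exp_cutoff p" by (rule exp_cutoff_approx)
  have p1: "1 \<le> p" using p by (simp add: admissible_def)
  let ?K = "kernel (Gamma (1 - \<alpha>)) \<alpha>" and ?L = "kernel 1 \<beta>"
  let ?s = "\<lambda>t. ip (\<lambda>x. S t x $ i) a" and ?f = "\<lambda>t. ip (u t) (flux a i)"
  let ?init = "ip (\<lambda>x. S0 x $ i) a"
  note K = kernel_props[OF \<alpha> p1 Gamma_real_pos[of "1 - \<alpha>"]] and L = kernel_props[OF \<beta> p1 zero_less_one]
  have K: "pos_part_time ?K \<in> borel_measurable borel" "laplaceable ?K p" "?K 0 = 0" using K \<alpha> by auto
  have aL2: "a \<in> L2 \<Omega>" by (rule Cc_inf_vec_L2[OF a])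
  note row = L2_inner_single_row[of _ i a] and AL2 = single_row_L2[OF aL2, of i]
  have s_cont: "continuous_on {0<..} ?s" unfolding row by (rule S_continuous[OF AL2])
  have s_lap: "laplaceable ?s p" unfolding row by (rule S_laplaceable[OF p AL2])
  have f_cont: "continuous_on {0<..} ?f" by (rule continuous_on_subset[OF u_continuous[OF flux_L2[OF a]]]) auto
  have f_lap: "laplaceable ?f p" by (rule u_laplaceable[OF p flux_L2[OF a]])
  note s_meas = pos_part_time_borel[OF s_cont] and f_meas = pos_part_time_borel[OF f_cont]
  have dot: "(\<Sum>j\<in>UNIV. F x $ i $ j * a x $ j) = F x $ i \<bullet> a x" for F :: mfield and x
    by (simp add: inner_vec_def)
  have fl: "(LINT x:\<Omega>|lebesgue. (\<Sum>k\<in>UNIV. pd k (\<lambda>y. a y $ k) x) * u \<tau> x $ i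
           + (\<Sum>j\<in>UNIV. u \<tau> x $ j * pd i (\<lambda>y. a y $ j) x)) = ?f \<tau>" for \<tau>
  proof -
    have "(\<Sum>k\<in>UNIV. pd k (\<lambda>y. a y $ k) x) * u \<tau> x $ i + (\<Sum>j\<in>UNIV. u \<tau> x $ j * pd i (\<lambda>y. a y $ j) x)
        = u \<tau> x \<bullet> flux a i x" for x
      by (simp add: inner_vec_def flux_def distrib_left sum.distrib if_distrib[of "\<lambda>y. _ * y"] mult.commute cong: if_cong)
    then show ?thesis by (simp add: L2_inner_def)
  qed
  have "- (LINT \<tau>:{0..}|lebesgue. ?K \<tau> * exp_cutoff p n \<tau>) * ?init
      - (LINT \<tau>:{0..}|lebesgue. LINT t:{\<tau>..}|lebesgue. hderiv (exp_cutoff p n) t * ?K \<tau> * ?s (t - \<tau>))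
      + (LINT t:{0..}|lebesgue. ?s t * exp_cutoff p n t)
      = - (1 / Gamma (1 - \<beta>)) * (LINT t:{0..}|lebesgue. LINT \<tau>:{0..t}|lebesgue. exp_cutoff p n t * ?L (t - \<tau>) * ?f \<tau>)" for n
  proof -
    have "weak_constitutive \<alpha> \<beta> \<Omega> S0 u S a (exp_cutoff p n) i"
      using solves a exp_cutoff_time_test[of p n] by (auto simp: WF_solution_def)
    then show ?thesis
      unfolding weak_constitutive_def dot fl set_integral_mult_const
      by (simp add: L2_inner_def[symmetric] kernel_def mult.commute set_integral_mult_const)
  qed
  moreover have "(\<lambda>n. - (LINT \<tau>:{0..}|lebesgue. ?K \<tau> * exp_cutoff p n \<tau>) * ?init
      - (LINT \<tau>:{0..}|lebesgue. LINT t:{\<tau>..}|lebesgue. hderiv (exp_cutoff p n) t * ?K \<tau> * ?s (t - \<tau>))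
      + (LINT t:{0..}|lebesgue. ?s t * exp_cutoff p n t))
     \<longlonglongrightarrow> - (1 * laplace ?K p) * ?init - (- p * laplace ?K p * laplace ?s p) + 1 * laplace ?s p"
    by (intro tendsto_add tendsto_diff tendsto_mult tendsto_minus tendsto_const e.single_limit K s_lap
        d.convolution_limit(1)[where G="\<lambda>n. hderiv (exp_cutoff p n)"] s_meas hderiv_exp_cutoff)
  moreover have "(\<lambda>n. - (1 / Gamma (1 - \<beta>)) * (LINT t:{0..}|lebesgue. LINT \<tau>:{0..t}|lebesgue. exp_cutoff p n t * ?L (t - \<tau>) * ?f \<tau>))
     \<longlonglongrightarrow> - (1 / Gamma (1 - \<beta>)) * (1 * laplace ?L p * laplace ?f p)"
    by (intro tendsto_mult tendsto_const e.convolution_limit(2) L f_lap f_meas refl)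
  ultimately have "- (1 * laplace ?K p) * ?init - (- p * laplace ?K p * laplace ?s p) + 1 * laplace ?s p
     = - (1 / Gamma (1 - \<beta>)) * (1 * laplace ?L p * laplace ?f p)"
    using LIMSEQ_unique by (simp only:)
  then show ?thesis by (simp add: algebra_simps)
qed

end

section \<open>Uniqueness\<close>

lemma le_of_le_multiple: 
  fixes x b :: real assumes "x * x \<le> b * x" "0 \<le> b" shows "x \<le> b"
proof (rule ccontr)
  assume "\<not> x \<le> b"
  then have "b < x" "0 < x" using assms(2) by auto
  then have "b * x < x * x" by simp
  then show False using assms(1) by linarith
qed

context weak_solution
begin

lemma gradient_rows:
  assumes \<Phi>: "\<And>i. \<Phi> i \<in> Cc_inf \<Omega>"
  defines "A \<equiv> \<lambda>x. \<chi> i j. pd j (\<Phi> i) x"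
  shows "A \<in> L2 \<Omega>" and "(\<lambda>x. A x $ i) \<in> Cc_inf_vec \<Omega>"
proof -
  show r: "(\<lambda>x. A x $ i) \<in> Cc_inf_vec \<Omega>" for i
    unfolding Cc_inf_vec_def A_def by (simp add: Cc_inf_pd[OF \<Phi>])
  show "A \<in> L2 \<Omega>" using Cc_inf_vec_L2[OF r] by (simp add: L2_vec_iff[of A])
qed

text \<open>
  Summing over rows, and undoing the integration by parts for the velocities, which lie in \<open>V\<close> at
  almost all times.
\<close>

lemma constitutive_laplace_gradient:
  assumes p: "admissible p" and A: "A \<in> L2 \<Omega>" "\<And>i. (\<lambda>x. A x $ i) \<in> Cc_inf_vec \<Omega>"
  shows "(1 + p * \<kappa>\<^sub>\<alpha> p) * laplace (\<lambda>t. ip (S t) A) p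
    = \<kappa>\<^sub>\<alpha> p * ip S0 A + \<kappa>\<^sub>\<beta> p * laplace (\<lambda>t. ip (sgrad (u t)) A) p"
proof -
  let ?s = "\<lambda>i t. ip (\<lambda>x. S t x $ i) (\<lambda>x. A x $ i)"
  let ?f = "\<lambda>i t. ip (u t) (flux (\<lambda>x. A x $ i) i)"
  have s: "laplaceable (?s i) p" for i
    unfolding L2_inner_single_row by (rule S_laplaceable[OF p single_row_L2[OF Cc_inf_vec_L2[OF A(2)]]])
  have f: "laplaceable (?f i) p" for i by (rule u_laplaceable[OF p flux_L2[OF A(2)]])
  have sum_s: "laplace (\<lambda>t. ip (S t) A) p = (\<Sum>i\<in>UNIV. laplace (?s i) p)"
  proof -
    have "laplace (\<lambda>t. ip (S t) A) p = laplace (\<lambda>t. \<Sum>i\<in>UNIV. ?s i t) p"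
      by (rule laplace_cong_AE(2)[OF S_laplaceable[OF p A(1)]])
         (use AE_nonzero_time[of 0] in \<open>eventually_elim, use A(1) S_L2 in \<open>simp add: L2_inner_vec\<close>\<close>)
    then show ?thesis by (simp add: laplace_sum s)
  qed
  have sum_f: "(\<Sum>i\<in>UNIV. laplace (?f i) p) = - laplace (\<lambda>t. ip (sgrad (u t)) A) p"
  proof -
    have "laplace (\<lambda>t. \<Sum>i\<in>UNIV. ?f i t) p = laplace (\<lambda>t. -1 * ip (sgrad (u t)) A) p"
    proof (rule laplace_cong_AE(2)[OF laplaceable_sum])
      show "AE t in lebesgue. 0 \<le> t \<longrightarrow> (\<Sum>i\<in>UNIV. ?f i t) = -1 * ip (sgrad (u t)) A"
        using u_V by eventually_elim (simp add: flux_eq_sgrad A L2_inner_vec sgrad_L2 sum_negf)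
    qed (use f in auto)
    then show ?thesis unfolding laplace_cmult by (simp add: laplace_sum f)
  qed
  have "ip S0 A = (\<Sum>i\<in>UNIV. ip (\<lambda>x. S0 x $ i) (\<lambda>x. A x $ i))"
    by (rule L2_inner_vec[OF S0 A(1)])
  moreover have "(1 + p * \<kappa>\<^sub>\<alpha> p) * (\<Sum>i\<in>UNIV. laplace (?s i) p)
      = \<kappa>\<^sub>\<alpha> p * (\<Sum>i\<in>UNIV. ip (\<lambda>x. S0 x $ i) (\<lambda>x. A x $ i)) - \<kappa>\<^sub>\<beta> p * (\<Sum>i\<in>UNIV. laplace (?f i) p)"
    unfolding sum_distrib_left constitutive_laplace[OF p A(2)] by (rule sum_subtractf)
  ultimately show ?thesis unfolding sum_s sum_f by simp
qed

text \<open>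
  All terms are \<open>L\<^sup>2\<close>-continuous in the test matrix, and the gradient of \<open>\<theta>\<close> is an \<open>L\<^sup>2\<close> limit of
  gradients of smooth compactly supported fields.
\<close>

lemma constitutive_laplace_V:
  assumes p: "admissible p" and \<theta>: "\<theta> \<in> V \<Omega>"
  shows "(1 + p * \<kappa>\<^sub>\<alpha> p) * laplace (\<lambda>t. ip (S t) (grad \<theta>)) p
    = \<kappa>\<^sub>\<alpha> p * ip S0 (grad \<theta>) + \<kappa>\<^sub>\<beta> p * laplace (\<lambda>t. ip (sgrad (u t)) (grad \<theta>)) p"
proof -
  let ?W = "grad \<theta>"
  have W: "?W \<in> L2 \<Omega>" by (rule H10_vecD(3)[OF V_H10_vec[OF \<theta>]])
  have "\<forall>i. \<exists>\<phi>. (\<forall>n. \<phi> n \<in> Cc_inf \<Omega>) \<and>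
      (\<forall>j. (\<lambda>n. norm2 (\<lambda>x. wpd \<Omega> j (\<lambda>x. \<theta> x $ i) x - pd j (\<phi> n) x)) \<longlonglongrightarrow> 0)"
  proof
    fix i
    have "(\<lambda>x. \<theta> x $ i) \<in> H10 \<Omega>" using V_H10_vec[OF \<theta>] by (simp add: H10_vec_def)
    then show "\<exists>\<phi>. (\<forall>n. \<phi> n \<in> Cc_inf \<Omega>) \<and>
      (\<forall>j. (\<lambda>n. norm2 (\<lambda>x. wpd \<Omega> j (\<lambda>x. \<theta> x $ i) x - pd j (\<phi> n) x)) \<longlonglongrightarrow> 0)"
      unfolding H10_iff by blast
  qed
  from choice[OF this] obtain \<Phi> where \<Phi>: "\<And>i n. \<Phi> i n \<in> Cc_inf \<Omega>"
    and lim: "\<And>i j. (\<lambda>n. norm2 (\<lambda>x. wpd \<Omega> j (\<lambda>x. \<theta> x $ i) x - pd j (\<Phi> i n) x)) \<longlonglongrightarrow> 0"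
    by blast
  define A where "A n x = (\<chi> i j. pd j (\<Phi> i n) x)" for n x
  have A: "A n \<in> L2 \<Omega>" "(\<lambda>x. A n x $ i) \<in> Cc_inf_vec \<Omega>" for n i
    unfolding A_def[abs_def] by (rule gradient_rows[of "\<lambda>i. \<Phi> i n"], rule \<Phi>)+
  have AW: "(\<lambda>n. norm2 (\<lambda>x. A n x - ?W x)) \<longlonglongrightarrow> 0"
  proof -
    have "ip (\<lambda>x. ?W x - A n x) (\<lambda>x. ?W x - A n x)
       = (\<Sum>i\<in>UNIV. \<Sum>j\<in>UNIV. (norm2 (\<lambda>x. wpd \<Omega> j (\<lambda>x. \<theta> x $ i) x - pd j (\<Phi> i n) x))\<^sup>2)" for n
    proof -
      have D: "(\<lambda>x. ?W x - A n x) \<in> L2 \<Omega>" by (rule L2_diff[OF W A(1)])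
      then have "(\<lambda>x. (?W x - A n x) $ i) \<in> L2 \<Omega>" for i unfolding L2_vec_iff[of "\<lambda>x. ?W x - A n x"] by blast
      then show ?thesis unfolding L2_inner_vec[OF D D] L2_norm_squared
        by (simp only: L2_inner_vec) (simp add: A_def wgrad_def)
    qed
    then have "(\<lambda>n. norm2 (\<lambda>x. ?W x - A n x)) \<longlonglongrightarrow> sqrt (\<Sum>i\<in>(UNIV :: 3 set). \<Sum>j\<in>(UNIV :: 3 set). 0\<^sup>2)"
      unfolding L2_norm_def[of \<Omega> "\<lambda>x. ?W x - A n x" for n] by (simp only:) (intro tendsto_intros lim)
    then show ?thesis by (simp add: L2_norm_minus_commute[of "A n" for n])
  qed
  have pS: "laplaceable (\<lambda>t. norm2 (S t)) p" and pu: "laplaceable (\<lambda>t. Vnorm (u t)) p"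
    using p by (auto simp: admissible_def)
  have limS: "(\<lambda>n. laplace (\<lambda>t. ip (S t) (A n)) p) \<longlonglongrightarrow> laplace (\<lambda>t. ip (S t) ?W) p"
  proof (rule LIM_zero_cancel, rule Lim_null_comparison)
    show "(\<lambda>n. norm2 (\<lambda>x. A n x - ?W x) * laplace (\<lambda>t. norm2 (S t)) p) \<longlonglongrightarrow> 0"
      using tendsto_mult_right[OF AW] by fastforce
    have "norm (laplace (\<lambda>t. ip (S t) (A n)) p - laplace (\<lambda>t. ip (S t) ?W) p)
        \<le> norm2 (\<lambda>x. A n x - ?W x) * laplace (\<lambda>t. norm2 (S t)) p" for n
      unfolding laplace_diff[OF S_laplaceable[OF p A(1)] S_laplaceable[OF p W], symmetric] laplace_cmult[symmetric] real_norm_def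
    proof (rule laplace_bound)
      show "AE t in lebesgue. 0 \<le> t \<longrightarrow> \<bar>ip (S t) (A n) - ip (S t) ?W\<bar> \<le> norm2 (\<lambda>x. A n x - ?W x) * norm2 (S t)"
        using AE_nonzero_time[of 0] S_bound[OF L2_diff[OF A(1)[of n] W]]
        by eventually_elim (simp add: L2_inner_diff_right S_L2 A W)
    qed (intro laplaceable_diff laplaceable_cmult S_laplaceable p A W pS)+
    then show "\<forall>\<^sub>F n in sequentially. norm (laplace (\<lambda>t. ip (S t) (A n)) p - laplace (\<lambda>t. ip (S t) ?W) p)
        \<le> norm2 (\<lambda>x. A n x - ?W x) * laplace (\<lambda>t. norm2 (S t)) p" by simp
  qed
  have limu: "(\<lambda>n. laplace (\<lambda>t. ip (sgrad (u t)) (A n)) p) \<longlonglongrightarrow> laplace (\<lambda>t. ip (sgrad (u t)) ?W) p"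
  proof (rule LIM_zero_cancel, rule Lim_null_comparison)
    show "(\<lambda>n. (2 * norm2 (\<lambda>x. A n x - ?W x)) * laplace (\<lambda>t. Vnorm (u t)) p) \<longlonglongrightarrow> 0"
      using tendsto_mult_right[OF tendsto_mult_left[OF AW, of 2]] by fastforce
    have "norm (laplace (\<lambda>t. ip (sgrad (u t)) (A n)) p - laplace (\<lambda>t. ip (sgrad (u t)) ?W) p)
        \<le> (2 * norm2 (\<lambda>x. A n x - ?W x)) * laplace (\<lambda>t. Vnorm (u t)) p" for n
      unfolding laplace_diff[OF sgrad_laplaceable[OF p A(1)] sgrad_laplaceable[OF p W], symmetric] laplace_cmult[symmetric] real_norm_def
    proof (rule laplace_bound)
      show "AE t in lebesgue. 0 \<le> t \<longrightarrow> \<bar>ip (sgrad (u t)) (A n) - ip (sgrad (u t)) ?W\<bar> \<le> 2 * norm2 (\<lambda>x. A n x - ?W x) * Vnorm (u t)"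
        using u_V
      proof eventually_elim
        fix t assume v: "0 \<le> t \<longrightarrow> u t \<in> V \<Omega>"
        show "0 \<le> t \<longrightarrow> \<bar>ip (sgrad (u t)) (A n) - ip (sgrad (u t)) ?W\<bar> \<le> 2 * norm2 (\<lambda>x. A n x - ?W x) * Vnorm (u t)"
          using V_functionalD(4)[OF V_functional_sgrad[OF L2_diff[OF A(1)[of n] W]], of "u t"] v
          by (simp add: L2_inner_diff_right sgrad_L2 A W)
      qed
    qed (intro laplaceable_diff laplaceable_cmult sgrad_laplaceable p A W pu)+
    then show "\<forall>\<^sub>F n in sequentially. norm (laplace (\<lambda>t. ip (sgrad (u t)) (A n)) p - laplace (\<lambda>t. ip (sgrad (u t)) ?W) p)
        \<le> (2 * norm2 (\<lambda>x. A n x - ?W x)) * laplace (\<lambda>t. Vnorm (u t)) p" by simp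
  qed
  have lim0: "(\<lambda>n. ip S0 (A n)) \<longlonglongrightarrow> ip S0 ?W"
  proof (rule LIM_zero_cancel, rule Lim_null_comparison)
    show "(\<lambda>n. norm2 S0 * norm2 (\<lambda>x. A n x - ?W x)) \<longlonglongrightarrow> 0"
      using tendsto_mult_left[OF AW] by fastforce
    have "norm (ip S0 (A n) - ip S0 ?W) \<le> norm2 S0 * norm2 (\<lambda>x. A n x - ?W x)" for n
      using L2_Cauchy_Schwarz[OF S0 L2_diff[OF A(1)[of n] W]] by (simp add: L2_inner_diff_right S0 A W)
    then show "\<forall>\<^sub>F n in sequentially. norm (ip S0 (A n) - ip S0 ?W) \<le> norm2 S0 * norm2 (\<lambda>x. A n x - ?W x)"
      by simp
  qed
  have "(\<lambda>n. (1 + p * \<kappa>\<^sub>\<alpha> p) * laplace (\<lambda>t. ip (S t) (A n)) p) \<longlonglongrightarrow> (1 + p * \<kappa>\<^sub>\<alpha> p) * laplace (\<lambda>t. ip (S t) ?W) p"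
    by (intro tendsto_mult tendsto_const limS)
  moreover have "(\<lambda>n. \<kappa>\<^sub>\<alpha> p * ip S0 (A n) + \<kappa>\<^sub>\<beta> p * laplace (\<lambda>t. ip (sgrad (u t)) (A n)) p)
     \<longlonglongrightarrow> \<kappa>\<^sub>\<alpha> p * ip S0 ?W + \<kappa>\<^sub>\<beta> p * laplace (\<lambda>t. ip (sgrad (u t)) ?W) p"
    by (intro tendsto_add tendsto_mult tendsto_const limu lim0)
  ultimately show ?thesis
    unfolding constitutive_laplace_gradient[OF p A] by (rule LIMSEQ_unique)
qed

text \<open>
  Testing \<open>h\<close> with the functional given by its own gradient bounds its norm uniformly in \<open>e\<close>.
\<close>

lemma approximate_u:
  assumes p: "admissible p" and e: "0 < e"
  shows "\<exists>h\<in>V \<Omega>. (\<forall>l C. V_functional l C \<longrightarrow> \<bar>laplace (\<lambda>t. l (u t)) p - l h\<bar> \<le> C * e) \<and>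
    Vnorm h \<le> laplace (\<lambda>t. Vnorm (u t)) p + e"
proof (rule approximate_laplace_transform[OF u_L1loc _ e])
  show pu: "laplaceable (\<lambda>t. Vnorm (u t)) p" using p by (simp add: admissible_def)
  fix h assume h: "h \<in> V \<Omega>" and hl: "\<And>l C. V_functional l C \<Longrightarrow> \<bar>laplace (\<lambda>t. l (u t)) p - l h\<bar> \<le> C * e"
  let ?L = "laplace (\<lambda>t. Vnorm (u t)) p"
  define l where "l v = ip (grad v) (grad h)" for v
  have l: "V_functional l (Vnorm h)"
    unfolding l_def V_norm_eq[OF h] by (rule V_functional_wgrad[OF H10_vecD(3)[OF V_H10_vec[OF h]]])
  have "\<bar>laplace (\<lambda>t. l (u t)) p\<bar> \<le> Vnorm h * ?L"
    unfolding laplace_cmult[symmetric]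
  proof (rule laplace_bound[OF functional_laplaceable[OF u_L1loc l pu] laplaceable_cmult[OF pu]])
    show "AE t in lebesgue. 0 \<le> t \<longrightarrow> \<bar>l (u t)\<bar> \<le> Vnorm h * Vnorm (u t)"
      using u_V by eventually_elim (use V_functionalD(4)[OF l] in blast)
  qed
  moreover have "l h = Vnorm h * Vnorm h"
    by (simp add: l_def V_norm_eq[OF h] L2_norm_squared[symmetric] power2_eq_square)
  ultimately have quad: "Vnorm h * Vnorm h \<le> (?L + e) * Vnorm h"
    using hl[OF l] by (simp add: algebra_simps)
  have "\<bar>laplace (\<lambda>t. Vnorm (u t)) p\<bar> \<le> ?L"
    by (rule laplace_bound[OF pu pu]) (simp add: V_norm_nonneg)
  then have "0 \<le> ?L + e" using e by linarith
  note le = le_of_le_multiple[OF quad this]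
  show ?thesis
  proof (intro bexI[OF _ h] conjI allI impI le)
    fix l C assume "V_functional l C"
    then show "\<bar>laplace (\<lambda>t. l (u t)) p - l h\<bar> \<le> C * e" by (rule hl)
  qed
qed

end

text \<open>
  The energy argument. Here \<open>D\<close> and \<open>E\<close> are the functionals given by the transforms of the difference of
  the velocities and of its symmetric gradient; eliminating the stress leaves \<open>a D + b E = 0\<close> on \<open>V\<close>
  with \<open>a, b > 0\<close>. At an approximate transform \<open>h\<close> of the difference, \<open>D h\<close> is nearly \<open>\<parallel>h\<parallel>\<^sup>2\<close> and \<open>E h\<close>
  is nearly nonnegative, so \<open>h\<close> and hence \<open>D\<close> are small.
\<close>

lemma (in bounded_open_set) two_solutions_agree:
  assumes "weak_solution \<Omega> \<alpha> \<beta> u0 S0 u S" and "weak_solution \<Omega> \<alpha> \<beta> u0 S0 v R"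
  shows "same_pair \<Omega> (u, S) (v, R)"
proof -
  interpret s: weak_solution \<Omega> \<alpha> \<beta> u0 S0 u S by fact
  interpret r: weak_solution \<Omega> \<alpha> \<beta> u0 S0 v R by fact
  obtain M1 where M1: "\<And>p. M1 \<le> p \<Longrightarrow> s.admissible p" by (rule s.admissible_ex) blast
  obtain M2 where M2: "\<And>p. M2 \<le> p \<Longrightarrow> r.admissible p" by (rule r.admissible_ex) blast
  define M where "M = max M1 M2"
  have ad: "s.admissible p" "r.admissible p" if "M \<le> p" for p using that M1 M2 by (auto simp: M_def)
  obtain CP where CP: "0 \<le> CP" "\<And>u. u \<in> V \<Omega> \<Longrightarrow> norm2 u \<le> CP * Vnorm u" using Poincare_V by blast
  have Du: "laplace (\<lambda>t. ip (u t) f) p = laplace (\<lambda>t. ip (v t) f) p"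
    if pM: "M \<le> p" and f: "f \<in> L2 \<Omega>" for p f
  proof -
    note ads = ad[OF pM]
    have p1: "1 \<le> p" using ads by (simp add: s.admissible_def)
    define a where "a = p * (1 + p * s.\<kappa>\<^sub>\<alpha> p)"
    define b where "b = s.\<kappa>\<^sub>\<beta> p"
    have a: "0 < a" and b: "0 < b" using s.kernel_pos[OF p1] p1 by (auto simp: a_def b_def intro!: mult_pos_pos add_pos_pos)
    define D where "D \<theta> = laplace (\<lambda>t. ip (u t) \<theta>) p - laplace (\<lambda>t. ip (v t) \<theta>) p" for \<theta>
    define E where "E \<theta> = laplace (\<lambda>t. ip (sgrad (u t)) (grad \<theta>)) p - laplace (\<lambda>t. ip (sgrad (v t)) (grad \<theta>)) p" for \<theta>
    have balance: "a * D \<theta> + b * E \<theta> = 0" if \<theta>: "\<theta> \<in> V \<Omega>" for \<theta>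
    proof -
      define X where "X = laplace (\<lambda>t. ip (S t) (grad \<theta>)) p - laplace (\<lambda>t. ip (R t) (grad \<theta>)) p"
      have "p * D \<theta> = - X"
        using s.momentum_laplace[OF ads(1) \<theta>] r.momentum_laplace[OF ads(2) \<theta>] by (simp add: D_def X_def algebra_simps)
      moreover have "(1 + p * s.\<kappa>\<^sub>\<alpha> p) * X = b * E \<theta>"
        using s.constitutive_laplace_V[OF ads(1) \<theta>] r.constitutive_laplace_V[OF ads(2) \<theta>]
        unfolding X_def E_def b_def right_diff_distrib by linarith
      moreover have "a * D \<theta> = (1 + p * s.\<kappa>\<^sub>\<alpha> p) * (p * D \<theta>)" by (simp add: a_def)
      ultimately show ?thesis by simp
    qed
    (* A bound for the gradient norm of h that is uniform for e up to 1. *)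
    define B where "B = laplace (\<lambda>t. Vnorm (u t)) p + laplace (\<lambda>t. Vnorm (v t)) p + 2"
    define K where "K = 2 * CP * CP * B + 4 * b * B / a"
    have main: "\<bar>D f\<bar> \<le> sqrt (K * e) * norm2 f + 2 * CP * norm2 f * e" if e: "0 < e" "e \<le> 1" for e
    proof -
      from s.approximate_u[OF ads(1) e(1)] obtain h1 where h1: "h1 \<in> V \<Omega>"
        "\<forall>l C. V_functional l C \<longrightarrow> \<bar>laplace (\<lambda>t. l (u t)) p - l h1\<bar> \<le> C * e"
        "Vnorm h1 \<le> laplace (\<lambda>t. Vnorm (u t)) p + e"
        by - (elim bexE conjE, rule that)
      from r.approximate_u[OF ads(2) e(1)] obtain h2 where h2: "h2 \<in> V \<Omega>"
        "\<forall>l C. V_functional l C \<longrightarrow> \<bar>laplace (\<lambda>t. l (v t)) p - l h2\<bar> \<le> C * e"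
        "Vnorm h2 \<le> laplace (\<lambda>t. Vnorm (v t)) p + e"
        by - (elim bexE conjE, rule that)
      define h where "h = (\<lambda>x. h1 x - h2 x)"
      have h: "h \<in> V \<Omega>" unfolding h_def by (rule V_diff[OF h1(1) h2(1)])
      have hB: "Vnorm h \<le> B"
        using V_norm_triangle_diff[OF h1(1) h2(1)] h1(3) h2(3) e by (simp add: h_def B_def)
      have B0: "0 \<le> B" using hB V_norm_nonneg[of h] by linarith
      have approx: "\<bar>(laplace (\<lambda>t. l (u t)) p - laplace (\<lambda>t. l (v t)) p) - l h\<bar> \<le> 2 * C * e" if l: "V_functional l C" for l C
        using h1(2)[rule_format, OF l] h2(2)[rule_format, OF l] V_functional_diff(1)[OF l h1(1) h2(1)] by (simp add: h_def)
      have hL2: "h \<in> L2 \<Omega>" "grad h \<in> L2 \<Omega>" by (rule H10_vecD[OF V_H10_vec[OF h]])+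
      let ?n = "norm2 h"
      have nB: "?n \<le> CP * B" using CP(2)[OF h] mult_left_mono[OF hB CP(1)] by linarith
      have "\<bar>D h - ?n\<^sup>2\<bar> \<le> 2 * (CP * ?n) * e"
        using approx[OF V_functional_L2[OF CP hL2(1)]] by (simp add: D_def L2_norm_squared)
      also have "\<dots> \<le> 2 * (CP * (CP * B)) * e"
        using e(1) CP(1) nB by (intro mult_right_mono mult_left_mono) auto
      finally have D_low: "?n\<^sup>2 - 2 * CP * CP * B * e \<le> D h" by (simp add: mult.assoc)
      have "\<bar>E h - ip (sgrad h) (grad h)\<bar> \<le> 2 * (2 * Vnorm h) * e"
        using approx[OF V_functional_sgrad[OF hL2(2)]] by (simp add: E_def V_norm_eq[OF h])
      also have "\<dots> \<le> 2 * (2 * B) * e" using e(1) hB by (intro mult_right_mono mult_left_mono) auto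
      finally have E_low: "- 4 * B * e \<le> E h" using sgrad_coercive[OF h] by simp
      have "a * (?n\<^sup>2 - 2 * CP * CP * B * e) + b * (- 4 * B * e) \<le> 0"
        using mult_left_mono[OF D_low less_imp_le[OF a]] mult_left_mono[OF E_low less_imp_le[OF b]] balance[OF h] by linarith
      then have "?n\<^sup>2 \<le> K * e" using a by (simp add: K_def field_simps)
      then have n: "?n \<le> sqrt (K * e)" by (rule real_le_rsqrt)
      have "\<bar>D f\<bar> \<le> \<bar>ip h f\<bar> + 2 * (CP * norm2 f) * e"
        using approx[OF V_functional_L2[OF CP f]] by (simp add: D_def)
      also have "\<bar>ip h f\<bar> \<le> ?n * norm2 f" by (rule L2_Cauchy_Schwarz[OF hL2(1) f])
      also have "\<dots> \<le> sqrt (K * e) * norm2 f" by (rule mult_right_mono[OF n]) simp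
      finally show ?thesis by (simp add: mult.assoc)
    qed
    have "((\<lambda>e. sqrt (K * e) * norm2 f + 2 * CP * norm2 f * e) \<longlongrightarrow> sqrt (K * 0) * norm2 f + 2 * CP * norm2 f * 0) (at_right 0)"
      by (intro tendsto_intros)
    moreover have "\<forall>\<^sub>F e in at_right 0. \<bar>D f\<bar> \<le> sqrt (K * e) * norm2 f + 2 * CP * norm2 f * e"
      by (rule eventually_at_rightI[of 0 1]) (use main in auto)
    ultimately have "\<bar>D f\<bar> \<le> sqrt (K * 0) * norm2 f + 2 * CP * norm2 f * 0"
      by (rule tendsto_lowerbound) simp
    then show ?thesis by (simp add: D_def)
  qed
  (* The transforms agree for all large p, so the scalar products agree at positive times. *)
  have eq_inner: "ip (u t) f = ip (v t) f" if f: "f \<in> L2 \<Omega>" and t: "0 < t" for t f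
  proof -
    have c: "continuous_on {0..} (\<lambda>t. ip (u t) f - ip (v t) f)"
      by (intro continuous_intros s.u_continuous r.u_continuous f)
    have "ip (u t) f - ip (v t) f = 0"
    proof (rule Lerch[OF continuous_on_subset[OF c] _ _ t])
      show "laplaceable (\<lambda>t. ip (u t) f - ip (v t) f) M"
        by (intro laplaceable_diff s.u_laplaceable r.u_laplaceable ad f) auto
      fix p assume p: "M \<le> p"
      show "laplace (\<lambda>t. ip (u t) f - ip (v t) f) p = 0"
        using Du[OF p f] by (simp add: laplace_diff s.u_laplaceable r.u_laplaceable ad p f)
    qed auto
    then show ?thesis by simp
  qed
  (* The initial time follows by continuity. *)
  have eq_inner0: "ip (u t) f = ip (v t) f" if f: "f \<in> L2 \<Omega>" and t: "0 \<le> t" for t f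
  proof (cases "t = 0")
    case True
    have c: "continuous_on {0..} (\<lambda>t. ip (u t) f - ip (v t) f)"
      by (intro continuous_intros s.u_continuous r.u_continuous f)
    then have "((\<lambda>t. ip (u t) f - ip (v t) f) \<longlongrightarrow> ip (u 0) f - ip (v 0) f) (at 0 within {0..})"
      by (simp add: continuous_on_def)
    then have "((\<lambda>t. ip (u t) f - ip (v t) f) \<longlongrightarrow> ip (u 0) f - ip (v 0) f) (at_right 0)"
      by (rule tendsto_within_subset) auto
    moreover have "((\<lambda>t. ip (u t) f - ip (v t) f) \<longlongrightarrow> 0) (at_right 0)"
      by (rule tendsto_eventually, rule eventually_at_rightI[of 0 1]) (use eq_inner[OF f] in auto)
    ultimately have "ip (u 0) f - ip (v 0) f = 0"
      by (intro tendsto_unique[of "at_right (0::real)"]) auto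
    then show ?thesis using True by simp
  qed (use eq_inner[OF f] t in auto)
  have uv: "AE x in lebesgue_on \<Omega>. u t x = v t x" if t: "0 \<le> t" for t
  proof -
    have L: "u t \<in> L2 \<Omega>" "v t \<in> L2 \<Omega>" using s.u_L2 r.u_L2 t by auto
    have d: "(\<lambda>x. u t x - v t x) \<in> L2 \<Omega>" by (rule L2_diff[OF L])
    have "ip (\<lambda>x. u t x - v t x) (\<lambda>x. u t x - v t x) = 0"
      using eq_inner0[OF d t] by (simp add: L2_inner_diff_left[OF L d])
    then have "AE x in lebesgue_on \<Omega>. u t x - v t x = 0"
      by (intro L2_norm_zero_imp_AE[OF d]) (simp add: L2_norm_def)
    then show ?thesis by eventually_elim simp
  qed
  have SR: "AE x in lebesgue_on \<Omega>. S t x = R t x" if t: "0 < t" for t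
  proof -
    have "AE x in lebesgue_on \<Omega>. S t x $ i $ j - R t x $ i $ j = 0" for i j
    proof (rule fundamental_lemma)
      have "(\<lambda>x. F x $ i $ j) \<in> L2 \<Omega>" if "F \<in> L2 \<Omega>" for F :: mfield
        using that unfolding L2_vec_iff[of F] L2_vec_iff[of "\<lambda>x. F x $ i" for i] by blast
      then have L: "(\<lambda>x. S t x $ i $ j) \<in> L2 \<Omega>" "(\<lambda>x. R t x $ i $ j) \<in> L2 \<Omega>"
        using s.S_L2[OF t] r.S_L2[OF t] by auto
      show "(\<lambda>x. S t x $ i $ j - R t x $ i $ j) \<in> L2 \<Omega>" by (rule L2_diff[OF L])
      fix \<phi> assume \<phi>: "\<phi> \<in> Cc_inf \<Omega>"
      (* Testing with phi in entry (i, j) isolates this entry of the stresses. *)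
      define a :: vfield where "a x = (\<chi> k. if k = j then \<phi> x else 0)" for x
      have a: "a \<in> Cc_inf_vec \<Omega>"
      proof -
        have "(\<lambda>x. 0) \<in> Cc_inf \<Omega>" using Cc_inf_mult[OF \<phi> Ck_const[of _ 0]] by simp
        then have "(\<lambda>x. a x $ k) \<in> Cc_inf \<Omega>" for k by (cases "k = j") (simp_all add: a_def \<phi>)
        then show ?thesis by (simp add: Cc_inf_vec_def)
      qed
      let ?A = "s.single_row i a"
      have A: "?A \<in> L2 \<Omega>" by (rule s.single_row_L2[OF s.Cc_inf_vec_L2[OF a]])
      let ?d = "\<lambda>t. ip (S t) ?A - ip (R t) ?A"
      have "?d t = 0"
      proof (rule Lerch[OF _ _ _ t])
        show "continuous_on {0<..} ?d" by (intro continuous_intros s.S_continuous r.S_continuous A)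
        show "laplaceable ?d M" by (intro laplaceable_diff s.S_laplaceable r.S_laplaceable ad A) auto
        fix p assume p: "M \<le> p"
        have p1: "1 \<le> p" using ad(1)[OF p] by (simp add: s.admissible_def)
        have "(1 + p * s.\<kappa>\<^sub>\<alpha> p) * laplace (\<lambda>t. ip (S t) ?A) p = (1 + p * s.\<kappa>\<^sub>\<alpha> p) * laplace (\<lambda>t. ip (R t) ?A) p"
          using s.constitutive_laplace[OF ad(1)[OF p] a, of i] r.constitutive_laplace[OF ad(2)[OF p] a, of i]
            Du[OF p s.flux_L2[OF a, of i]] unfolding s.L2_inner_single_row by simp
        moreover have "0 < 1 + p * s.\<kappa>\<^sub>\<alpha> p" using s.kernel_pos(1)[OF p1] p1 by (simp add: add_pos_pos)
        ultimately show "laplace ?d p = 0"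
          by (simp add: laplace_diff s.S_laplaceable r.S_laplaceable ad p A)
      qed
      moreover have "F x $ i \<bullet> a x = F x $ i $ j * \<phi> x" for F :: mfield and x
        by (simp add: inner_vec_def a_def if_distrib[of "\<lambda>y. _ * y"] cong: if_cong)
      ultimately have "ip (\<lambda>x. S t x $ i $ j) \<phi> - ip (\<lambda>x. R t x $ i $ j) \<phi> = 0"
        unfolding s.L2_inner_single_row[symmetric] by (simp add: L2_inner_def)
      then have "ip (\<lambda>x. S t x $ i $ j - R t x $ i $ j) \<phi> = 0"
        by (simp add: L2_inner_diff_left L Cc_inf_L2[OF \<phi>])
      then show "(LINT x:\<Omega>|lebesgue. (S t x $ i $ j - R t x $ i $ j) * \<phi> x) = 0"
        by (simp add: L2_inner_def)
    qed
    note comp = this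
    have "AE x in lebesgue_on \<Omega>. \<forall>i\<in>UNIV. \<forall>j\<in>UNIV. S t x $ i $ j - R t x $ i $ j = 0"
      by (intro AE_finite_allI comp) auto
    then show ?thesis by eventually_elim (simp add: vec_eq_iff)
  qed
  show ?thesis unfolding same_pair_def using uv SR by simp
qed

theorem corollary3p1:
  fixes \<alpha> \<beta> :: real and \<Omega> :: "(real ^ 3) set"
    and u0 :: "real ^ 3 \<Rightarrow> real ^ 3" and S0 :: "real ^ 3 \<Rightarrow> real ^ 3 ^ 3"
  assumes "0 < \<alpha>" and "\<alpha> < \<beta>" and "\<beta> < 1"
    and "C1_bounded_domain \<Omega>"
    and "u0 \<in> H \<Omega>" and "S0 \<in> L2 \<Omega>"
  shows "\<forall>p\<in>F_space \<Omega>. \<forall>q\<in>F_space \<Omega>.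
           WF_solution \<alpha> \<beta> \<Omega> u0 S0 p \<longrightarrow> WF_solution \<alpha> \<beta> \<Omega> u0 S0 q \<longrightarrow> same_pair \<Omega> p q"
proof (intro ballI impI)
  fix p q
  assume p: "p \<in> F_space \<Omega>" "WF_solution \<alpha> \<beta> \<Omega> u0 S0 p" and q: "q \<in> F_space \<Omega>" "WF_solution \<alpha> \<beta> \<Omega> u0 S0 q"
  have \<Omega>: "bounded_open_set \<Omega>"
    using assms(4) by (auto simp: C1_bounded_domain_def intro!: bounded_open_set.intro)
  have sol: "weak_solution \<Omega> \<alpha> \<beta> u0 S0 (fst z) (snd z)"
    if "z \<in> F_space \<Omega>" "WF_solution \<alpha> \<beta> \<Omega> u0 S0 z" for z
    using assms that
    by (intro weak_solution.intro[OF \<Omega>] weak_solution_axioms.intro) auto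
  show "same_pair \<Omega> p q"
    using bounded_open_set.two_solutions_agree[OF \<Omega> sol[OF p] sol[OF q]] by simp
qed

end
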